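(* Let $A=-\mathcal{A}$ be the opposite of a Sturm-Liouville operator on $X=L^2_\rho(a,b)$, with eigenvalues $\{\lambda_n\}_{n\in\mathbb{N}}$ and orthonormal basis of eigenfunctions $\{\phi_n\}_{n\in\mathbb{N}}$ of $X$, let $\mu=\gamma+\epsilon$ with $\epsilon>0$ and $\lambda_n<\gamma<\infty$ for all $n$, and let $\alpha>0$. Then the Riesz-spectral operator $A$ defined on $D(A)_\alpha$ is the infinitesimal generator of a $C_0$-semigroup $(T(t))_{t\geq0}$ of bounded linear operators on the space $X_\alpha=D((\mu I-A)^\alpha)$.
   Context: Let $a<b$ be real. Let $p,\frac{dp}{dz},q,\rho$ be real-valued continuous functions on $[a,b]$ with $\rho>0$ and $p>0$. $X=L^2_\rho(a,b)$ denotes the space $L^2(a,b)$ of real-valued square integrable functions equipped with the inner product $\langle f,g\rangle_\rho=\int_a^b f(z)g(z)\rho(z)\,dz$. The Sturm-Liouville operator is $(\mathcal{A}f)(z)=\frac{1}{\rho(z)}\left(\frac{d}{dz}\left(-p(z)\frac{df}{dz}(z)\right)+q(z)f(z)\right)$ with domain $D(\mathcal{A})=\{f\in H^2(a,b):\ \alpha_a\frac{df}{dz}(a)+\beta_a f(a)=0=\alpha_b\frac{df}{dz}(b)+\beta_b f(b)\}$, where $(\alpha_a,\beta_a)\neq(0,0)\neq(\alpha_b,\beta_b)$ are real pairs. Put $A=-\mathcal{A}$, $D(A)=D(\mathcal{A})$. Known facts: $A$ is self-adjoint on $X$; its spectrum consists only of simple real eigenvalues $\{\lambda_n\}_{n\in\mathbb{N}}$,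 bounded from above; the normalized eigenfunctions $\{\phi_n\}_{n\in\mathbb{N}}$ form an orthonormal basis of $X$; and $Af=\sum_{n=1}^\infty\lambda_n\langle f,\phi_n\rangle_\rho\phi_n$ for $f\in D(A)=\{f\in X:\ \sum_{n=1}^\infty\lambda_n^2\langle f,\phi_n\rangle_\rho^2<\infty\}$. For $\mu$ as in the claim and $\alpha>0$, $(\mu I-A)^\alpha f=\sum_{n=1}^\infty(\mu-\lambda_n)^\alpha\langle f,\phi_n\rangle_\rho\phi_n$ with domain $X_\alpha:=D((\mu I-A)^\alpha)=\{f\in X:\ \sum_{n=1}^\infty(\mu-\lambda_n)^{2\alpha}\langle f,\phi_n\rangle_\rho^2<\infty\}$, which is a real Hilbert space for the inner product $\langle f,g\rangle_\alpha=\langle(\mu I-A)^\alpha f,(\mu I-A)^\alpha g\rangle_\rho$. Put $\phi_{n,\alpha}=(\mu-\lambda_n)^{-\alpha}\phi_n$ and $D(A)_\alpha=\{f\in X_\alpha:\ \sum_{n=1}^\infty\lambda_n^2\langle f,\phi_{n,\alpha}\rangle_\alpha^2<\infty\}\subset D(A)$. A closed linear operator on a Hilbert space is called Riesz-spectral if it has simple eigenvalues $\{\lambda_n\}_{n\in\mathbb{N}}$ whose corresponding eigenvectors form a Riesz basis of the space, and the closure of $\{\lambda_n\}_{n\in\mathbb{N}}$ is totally disconnected. *)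

theory Defs
  imports "HOL-Analysis.Analysis"
begin

section \<open>Real functions modulo almost-everywhere equality\<close>

quotient_type aefun = "real \<Rightarrow> real" / partial:
  "\<lambda>f g. f \<in> borel_measurable borel \<and> g \<in> borel_measurable borel \<and> (AE x in lborel. f x = g x)"
proof (rule part_equivpI)
  show "\<exists>f::real \<Rightarrow> real. f \<in> borel_measurable borel \<and> f \<in> borel_measurable borel
      \<and> (AE x in lborel. f x = f x)"
    by (rule exI[of _ "\<lambda>_. 0"]) auto
qed (auto intro!: sympI transpI elim: AE_mp)

instantiation aefun :: "{real_algebra, comm_ring}"
begin

lift_definition zero_aefun :: aefun is "\<lambda>_. 0" by simp
lift_definition plus_aefun :: "aefun \<Rightarrow> aefun \<Rightarrow> aefun" is "\<lambda>f g x. f x + g x"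
  by (auto elim: AE_mp)
lift_definition minus_aefun :: "aefun \<Rightarrow> aefun \<Rightarrow> aefun" is "\<lambda>f g x. f x - g x"
  by (auto elim: AE_mp)
lift_definition uminus_aefun :: "aefun \<Rightarrow> aefun" is "\<lambda>f x. - f x"
  by (auto elim: AE_mp)
lift_definition times_aefun :: "aefun \<Rightarrow> aefun \<Rightarrow> aefun" is "\<lambda>f g x. f x * g x"
  by (auto elim: AE_mp)
lift_definition scaleR_aefun :: "real \<Rightarrow> aefun \<Rightarrow> aefun" is "\<lambda>c f x. c * f x"
  by (auto elim: AE_mp)

instance
  by standard (transfer; auto simp: algebra_simps)+

end

lift_definition aefun_integrable :: "aefun \<Rightarrow> bool" is "\<lambda>f. integrable lborel f"
  by (rule integrable_cong_AE) auto

lift_definition aefun_integral :: "aefun \<Rightarrow> real" is "\<lambda>f. integral\<^sup>L lborel f"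
  by (rule integral_cong_AE) auto

text \<open>The class of a Borel function; non-measurable functions are sent to \<open>0\<close>.\<close>

lift_definition aeclass :: "(real \<Rightarrow> real) \<Rightarrow> aefun"
  is "\<lambda>f. if f \<in> borel_measurable borel then f else (\<lambda>_. 0)"
  by auto

definition aeclass_on :: "real \<Rightarrow> real \<Rightarrow> (real \<Rightarrow> real) \<Rightarrow> aefun" where
  "aeclass_on a b f = aeclass (\<lambda>x. indicator {a..b} x * f x)"


section \<open>Lebesgue and Sobolev spaces on an interval\<close>

text \<open>Functions on \<open>(a,b)\<close> are identified with their extension by zero to the real line.\<close>

definition L2 :: "real \<Rightarrow> real \<Rightarrow> aefun set" where
  "L2 a b = {f. aeclass_on a b (\<lambda>_. 1) * f = f \<and> aefun_integrable (f * f)}"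

definition L2_inner :: "real \<Rightarrow> real \<Rightarrow> (real \<Rightarrow> real) \<Rightarrow> aefun \<Rightarrow> aefun \<Rightarrow> real" where
  "L2_inner a b \<rho> f g = aefun_integral (f * g * aeclass_on a b \<rho>)"

text \<open>Weak derivatives on \<open>(a,b)\<close>, tested against continuously differentiable functions with
  compact support in \<open>(a,b)\<close>.\<close>

definition is_weak_deriv :: "real \<Rightarrow> real \<Rightarrow> aefun \<Rightarrow> aefun \<Rightarrow> bool" where
  "is_weak_deriv a b f g \<longleftrightarrow>
     (\<forall>\<psi> \<psi>'. (\<forall>x. (\<psi> has_real_derivative \<psi>' x) (at x)) \<longrightarrow> continuous_on UNIV \<psi>' \<longrightarrow>
        closure {x. \<psi> x \<noteq> 0} \<subseteq> {a<..<b} \<longrightarrow>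
        aefun_integral (f * aeclass \<psi>') = - aefun_integral (g * aeclass \<psi>))"

definition H1 :: "real \<Rightarrow> real \<Rightarrow> aefun set" where
  "H1 a b = {f \<in> L2 a b. \<exists>g \<in> L2 a b. is_weak_deriv a b f g}"

definition weak_deriv :: "real \<Rightarrow> real \<Rightarrow> aefun \<Rightarrow> aefun" where
  "weak_deriv a b f = (THE g. g \<in> L2 a b \<and> is_weak_deriv a b f g)"

definition H2 :: "real \<Rightarrow> real \<Rightarrow> aefun set" where
  "H2 a b = {f \<in> H1 a b. weak_deriv a b f \<in> H1 a b}"

text \<open>The value at \<open>x \<in> [a,b]\<close> of the continuous representative; meaningful for \<open>f\<close> in \<open>H1 a b\<close>.\<close>

definition pt_value :: "real \<Rightarrow> real \<Rightarrow> aefun \<Rightarrow> real \<Rightarrow> real" where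
  "pt_value a b f x =
     (THE y. \<exists>u. continuous_on {a..b} u \<and> f = aeclass_on a b u \<and> y = u x)"


section \<open>The Sturm--Liouville operator\<close>

definition SL_op ::
  "real \<Rightarrow> real \<Rightarrow> (real \<Rightarrow> real) \<Rightarrow> (real \<Rightarrow> real) \<Rightarrow> (real \<Rightarrow> real) \<Rightarrow> aefun \<Rightarrow> aefun" where
  "SL_op a b p q \<rho> f =
     aeclass_on a b (\<lambda>z. 1 / \<rho> z) *
       (weak_deriv a b (- (aeclass_on a b p * weak_deriv a b f)) + aeclass_on a b q * f)"

definition SL_dom :: "real \<Rightarrow> real \<Rightarrow> real \<Rightarrow> real \<Rightarrow> real \<Rightarrow> real \<Rightarrow> aefun set" where
  "SL_dom a b \<alpha>\<^sub>a \<beta>\<^sub>a \<alpha>\<^sub>b \<beta>\<^sub>b =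
     {f \<in> H2 a b.
        \<alpha>\<^sub>a * pt_value a b (weak_deriv a b f) a + \<beta>\<^sub>a * pt_value a b f a = 0 \<and>
        \<alpha>\<^sub>b * pt_value a b (weak_deriv a b f) b + \<beta>\<^sub>b * pt_value a b f b = 0}"


section \<open>Hilbert spaces given by a carrier and an inner product\<close>

text \<open>The same vectors carry several inner products below, so Hilbert spaces are given by a carrier
  set \<open>S\<close> in a real vector space together with an inner product \<open>ip\<close>, rather than by a type class.\<close>

definition ip_norm :: "('v \<Rightarrow> 'v \<Rightarrow> real) \<Rightarrow> 'v \<Rightarrow> real" where
  "ip_norm ip x = sqrt (ip x x)"

definition ip_lim ::
  "('v::real_vector \<Rightarrow> 'v \<Rightarrow> real) \<Rightarrow> ('i \<Rightarrow> 'v) \<Rightarrow> 'v \<Rightarrow> 'i filter \<Rightarrow> bool" where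
  "ip_lim ip u x F \<longleftrightarrow> ((\<lambda>i. ip_norm ip (u i - x)) \<longlongrightarrow> 0) F"

definition hilbert_space :: "'v::real_vector set \<Rightarrow> ('v \<Rightarrow> 'v \<Rightarrow> real) \<Rightarrow> bool" where
  "hilbert_space S ip \<longleftrightarrow>
     subspace S \<and>
     (\<forall>x\<in>S. \<forall>y\<in>S. ip x y = ip y x) \<and>
     (\<forall>x\<in>S. \<forall>y\<in>S. \<forall>z\<in>S. ip (x + y) z = ip x z + ip y z) \<and>
     (\<forall>c. \<forall>x\<in>S. \<forall>y\<in>S. ip (c *\<^sub>R x) y = c * ip x y) \<and>
     (\<forall>x\<in>S. x \<noteq> 0 \<longrightarrow> ip x x > 0) \<and>
     (\<forall>u. (\<forall>n::nat. u n \<in> S) \<longrightarrow>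
        (\<forall>e>0. \<exists>N. \<forall>m\<ge>N. \<forall>n\<ge>N. ip_norm ip (u m - u n) < e) \<longrightarrow>
        (\<exists>x\<in>S. ip_lim ip u x sequentially))"

definition ip_suminf ::
  "'v::real_vector set \<Rightarrow> ('v \<Rightarrow> 'v \<Rightarrow> real) \<Rightarrow> (nat \<Rightarrow> 'v) \<Rightarrow> 'v" where
  "ip_suminf S ip u = (THE s. s \<in> S \<and> ip_lim ip (\<lambda>N. \<Sum>n<N. u n) s sequentially)"

definition dense_span ::
  "'v::real_vector set \<Rightarrow> ('v \<Rightarrow> 'v \<Rightarrow> real) \<Rightarrow> (nat \<Rightarrow> 'v) \<Rightarrow> bool" where
  "dense_span S ip e \<longleftrightarrow>
     range e \<subseteq> S \<and> (\<forall>x\<in>S. \<forall>\<epsilon>>0. \<exists>y\<in>span (range e). ip_norm ip (x - y) < \<epsilon>)"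

definition orthonormal_basis ::
  "'v::real_vector set \<Rightarrow> ('v \<Rightarrow> 'v \<Rightarrow> real) \<Rightarrow> (nat \<Rightarrow> 'v) \<Rightarrow> bool" where
  "orthonormal_basis S ip e \<longleftrightarrow>
     dense_span S ip e \<and> (\<forall>m n. ip (e m) (e n) = (if m = n then 1 else 0))"

definition riesz_basis ::
  "'v::real_vector set \<Rightarrow> ('v \<Rightarrow> 'v \<Rightarrow> real) \<Rightarrow> (nat \<Rightarrow> 'v) \<Rightarrow> bool" where
  "riesz_basis S ip e \<longleftrightarrow>
     dense_span S ip e \<and>
     (\<exists>m>0. \<exists>M>0. \<forall>N. \<forall>c::nat \<Rightarrow> real.
        m * (\<Sum>n<N. (c n)\<^sup>2) \<le> (ip_norm ip (\<Sum>n<N. c n *\<^sub>R e n))\<^sup>2 \<and>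
        (ip_norm ip (\<Sum>n<N. c n *\<^sub>R e n))\<^sup>2 \<le> M * (\<Sum>n<N. (c n)\<^sup>2))"


section \<open>Operators\<close>

definition linear_on_set :: "'v::real_vector set \<Rightarrow> ('v \<Rightarrow> 'v) \<Rightarrow> bool" where
  "linear_on_set D A \<longleftrightarrow>
     (\<forall>x\<in>D. \<forall>y\<in>D. A (x + y) = A x + A y) \<and> (\<forall>c. \<forall>x\<in>D. A (c *\<^sub>R x) = c *\<^sub>R A x)"

definition closed_linear_operator ::
  "'v::real_vector set \<Rightarrow> ('v \<Rightarrow> 'v \<Rightarrow> real) \<Rightarrow> 'v set \<Rightarrow> ('v \<Rightarrow> 'v) \<Rightarrow> bool" where
  "closed_linear_operator S ip D A \<longleftrightarrow>
     subspace D \<and> D \<subseteq> S \<and> A ` D \<subseteq> S \<and> linear_on_set D A \<and>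
     (\<forall>u. \<forall>x\<in>S. \<forall>y\<in>S. (\<forall>n::nat. u n \<in> D) \<longrightarrow>
        ip_lim ip u x sequentially \<longrightarrow> ip_lim ip (\<lambda>n. A (u n)) y sequentially \<longrightarrow>
        x \<in> D \<and> A x = y)"

definition bounded_linear_on_set ::
  "'v::real_vector set \<Rightarrow> ('v \<Rightarrow> 'v \<Rightarrow> real) \<Rightarrow> ('v \<Rightarrow> 'v) \<Rightarrow> bool" where
  "bounded_linear_on_set S ip B \<longleftrightarrow>
     B ` S \<subseteq> S \<and> linear_on_set S B \<and> (\<exists>K. \<forall>x\<in>S. ip_norm ip (B x) \<le> K * ip_norm ip x)"

definition eigenspace :: "'v::real_vector set \<Rightarrow> ('v \<Rightarrow> 'v) \<Rightarrow> real \<Rightarrow> 'v set" where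
  "eigenspace D A l = {x \<in> D. A x = l *\<^sub>R x}"

definition eigenvalues :: "'v::real_vector set \<Rightarrow> ('v \<Rightarrow> 'v) \<Rightarrow> real set" where
  "eigenvalues D A = {l. \<exists>x\<in>eigenspace D A l. x \<noteq> 0}"

text \<open>Simple means algebraically simple: the eigenspace is a line and there are no generalized
  eigenvectors.\<close>

definition simple_eigenvalue :: "'v::real_vector set \<Rightarrow> ('v \<Rightarrow> 'v) \<Rightarrow> real \<Rightarrow> bool" where
  "simple_eigenvalue D A l \<longleftrightarrow>
     (\<exists>x. x \<noteq> 0 \<and> eigenspace D A l = span {x}) \<and>
     (\<forall>y\<in>D. A y - l *\<^sub>R y \<in> eigenspace D A l \<longrightarrow> y \<in> eigenspace D A l)"

definition totally_disconnected :: "'a::topological_space set \<Rightarrow> bool" where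
  "totally_disconnected S \<longleftrightarrow> (\<forall>C\<subseteq>S. connected C \<longrightarrow> (\<forall>x\<in>C. \<forall>y\<in>C. x = y))"

definition riesz_spectral ::
  "'v::real_vector set \<Rightarrow> ('v \<Rightarrow> 'v \<Rightarrow> real) \<Rightarrow> 'v set \<Rightarrow> ('v \<Rightarrow> 'v) \<Rightarrow> bool" where
  "riesz_spectral S ip D A \<longleftrightarrow>
     hilbert_space S ip \<and> closed_linear_operator S ip D A \<and>
     (\<exists>l e. inj l \<and> range l = eigenvalues D A \<and>
        (\<forall>n::nat. simple_eigenvalue D A (l n) \<and> e n \<in> eigenspace D A (l n)) \<and>
        riesz_basis S ip e \<and> totally_disconnected (closure (range l)))"

text \<open>The operator \<open>f \<mapsto> \<Sum>n. c n \<langle>f, e n\<rangle> e n\<close> with its natural domain.\<close>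

definition diag_dom ::
  "'v::real_vector set \<Rightarrow> ('v \<Rightarrow> 'v \<Rightarrow> real) \<Rightarrow> (nat \<Rightarrow> 'v) \<Rightarrow> (nat \<Rightarrow> real) \<Rightarrow> 'v set" where
  "diag_dom S ip e c = {f \<in> S. summable (\<lambda>n. (c n)\<^sup>2 * (ip f (e n))\<^sup>2)}"

definition diag_op ::
  "'v::real_vector set \<Rightarrow> ('v \<Rightarrow> 'v \<Rightarrow> real) \<Rightarrow> (nat \<Rightarrow> 'v) \<Rightarrow> (nat \<Rightarrow> real) \<Rightarrow> 'v \<Rightarrow> 'v" where
  "diag_op S ip e c f = ip_suminf S ip (\<lambda>n. (c n * ip f (e n)) *\<^sub>R e n)"

definition power_inner ::
  "'v::real_vector set \<Rightarrow> ('v \<Rightarrow> 'v \<Rightarrow> real) \<Rightarrow> (nat \<Rightarrow> 'v) \<Rightarrow> (nat \<Rightarrow> real) \<Rightarrow> 'v \<Rightarrow> 'v \<Rightarrow> real" where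
  "power_inner S ip e c f g = ip (diag_op S ip e c f) (diag_op S ip e c g)"


section \<open>Semigroups\<close>

definition C0_semigroup ::
  "'v::real_vector set \<Rightarrow> ('v \<Rightarrow> 'v \<Rightarrow> real) \<Rightarrow> (real \<Rightarrow> 'v \<Rightarrow> 'v) \<Rightarrow> bool" where
  "C0_semigroup S ip T \<longleftrightarrow>
     (\<forall>t\<ge>0. bounded_linear_on_set S ip (T t)) \<and>
     (\<forall>f\<in>S. T 0 f = f) \<and>
     (\<forall>s\<ge>0. \<forall>t\<ge>0. \<forall>f\<in>S. T (s + t) f = T s (T t f)) \<and>
     (\<forall>f\<in>S. ip_lim ip (\<lambda>t. T t f) f (at_right 0))"

definition infinitesimal_generator ::
  "'v::real_vector set \<Rightarrow> ('v \<Rightarrow> 'v \<Rightarrow> real) \<Rightarrow> (real \<Rightarrow> 'v \<Rightarrow> 'v) \<Rightarrow> 'v set \<Rightarrow> ('v \<Rightarrow> 'v) \<Rightarrow> bool"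
where
  "infinitesimal_generator S ip T D A \<longleftrightarrow>
     D = {f \<in> S. \<exists>g\<in>S. ip_lim ip (\<lambda>h. (T h f - f) /\<^sub>R h) g (at_right 0)} \<and>
     (\<forall>f\<in>D. A f \<in> S \<and> ip_lim ip (\<lambda>h. (T h f - f) /\<^sub>R h) (A f) (at_right 0))"

end

theory Submission
  imports Defs
begin

text \<open>In an orthonormal basis of eigenvectors the operator is diagonal, so once the spaces are
  identified with weighted sequence spaces the semigroup is multiplication by \<open>exp (lam n * t)\<close>;
  its orbits and difference quotients converge by dominated convergence for series. What has to be
  extracted from the Sturm--Liouville equation is that \<open>A\<close> is closed (so that it acts diagonally
  on all of \<open>DA\<^sub>\<alpha>\<close>) and that the eigenvalues do not accumulate. Both follow from integrating
  \<open>(p f')' = q f + \<rho> g\<close> twice: \<open>A f = g\<close> means that \<open>f\<close> is \<open>f(a) + (p f')(a) \<integral> 1/p\<close> plus a bounded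
  double primitive of \<open>q f + \<rho> g\<close>, where the two constants are themselves bounded functionals of
  \<open>(f, g)\<close>. Hence the graph is the kernel of bounded maps, and \<open>|f(t)|\<close> is bounded by the norms of
  \<open>f\<close> and \<open>A f\<close>; applied to \<open>\<Sum>n\<in>F. \<phi> n t *\<^sub>R \<phi> n\<close> this bounds \<open>\<Sum>n\<in>F. (\<phi> n t)\<^sup>2\<close>, and integrating over \<open>t\<close>
  bounds the cardinality of any finite set \<open>F\<close> of indices with bounded eigenvalues.\<close>

text \<open>The assumptions describe \<open>A\<close> only on the eigenvectors; its spectral
  expansion has to be derived. Without closedness nothing is known about \<open>A\<close> on
  infinite combinations, and without a bound on the number of eigenvalues in a bounded set the
  closure of the spectrum could contain an interval. The integrated form of the equation serves both
  purposes and calls for no Green's function: double primitives are bounded on L2, boundary values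
  become bounded functionals of the pair \<open>(f, A f)\<close>, and no value of the spectral
  parameter has to be chosen. Since domain and operator are given by weak derivatives of classes,
  the du Bois-Reymond lemma has to be proved to pass from them to primitives.

  The exponent \<alpha> enters through an isometry. Because \<open>\<mu> - lam n\<close> stays above
  \<epsilon>, the power of \<open>\<mu> I - A\<close> maps the smaller space isometrically onto
  \<open>X\<close> and carries one orthonormal basis to the other. The abstract theory of diagonal
  operators is thus applied on the smaller space, with the same eigenvalues.\<close>

lemma tendsto_suminf_zero_dominated:
  fixes f :: "'i \<Rightarrow> nat \<Rightarrow> real"
  assumes g: "summable g"
    and dom: "eventually (\<lambda>t. \<forall>n. 0 \<le> f t n \<and> f t n \<le> g n) F"
    and lim: "\<And>n. ((\<lambda>t. f t n) \<longlongrightarrow> 0) F"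
  shows "((\<lambda>t. \<Sum>n. f t n) \<longlongrightarrow> 0) F"
proof (rule tendstoI)
  fix e :: real assume e: "e > 0"
  \<comment> \<open>Cutting where the tail of \<open>g\<close> drops below half of \<open>e\<close>
    is uniform in \<open>t\<close>, since \<open>g\<close> eventually dominates every
    \<open>f t\<close>; only the finite head is left to the pointwise limits.\<close>
  from suminf_exist_split[OF half_gt_zero[OF e] g]
  obtain N where N: "norm (\<Sum>i. g (i + N)) < e / 2" by blast
  have "((\<lambda>t. \<Sum>n<N. f t n) \<longlongrightarrow> (\<Sum>n<N. 0)) F"
    by (intro tendsto_sum lim)
  then have "eventually (\<lambda>t. dist (\<Sum>n<N. f t n) 0 < e / 2) F"
    using e by (auto dest!: tendstoD[where e="e/2"])
  with dom show "eventually (\<lambda>t. dist (\<Sum>n. f t n) 0 < e) F"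
  proof eventually_elim
    case (elim t)
    have sf: "summable (f t)"
      by (rule summable_comparison_test'[OF g, of 0]) (use elim in auto)
    have "(\<Sum>i. f t (i + N)) \<le> (\<Sum>i. g (i + N))"
      using elim sf g by (intro suminf_le) (auto simp: summable_iff_shift)
    moreover have "(\<Sum>n. f t n) = (\<Sum>i. f t (i + N)) + (\<Sum>n<N. f t n)"
      by (rule suminf_split_initial_segment[OF sf])
    moreover have "0 \<le> (\<Sum>n. f t n)" using elim sf by (intro suminf_nonneg) auto
    ultimately show ?case using elim(2) N by (auto simp: dist_real_def)
  qed
qed

section \<open>Orthonormal bases and diagonal operators\<close>

locale real_hilbert =
  fixes S :: "'v::real_vector set" and ip :: "'v \<Rightarrow> 'v \<Rightarrow> real"
  assumes hilbert: "hilbert_space S ip"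
begin

lemma subspace_S: "subspace S"
  using hilbert unfolding hilbert_space_def by blast

lemmas S_zero [simp] = subspace_0[OF subspace_S]
lemmas S_add [simp] = subspace_add[OF subspace_S]
lemmas S_diff [simp] = subspace_diff[OF subspace_S]
lemmas S_scale [simp] = subspace_scale[OF subspace_S]
lemmas S_neg [simp] = subspace_neg[OF subspace_S]
lemmas S_sum [simp] = subspace_sum[OF subspace_S]

lemma ip_commute: "x \<in> S \<Longrightarrow> y \<in> S \<Longrightarrow> ip x y = ip y x"
  using hilbert unfolding hilbert_space_def by blast

lemma ip_add_left: "x \<in> S \<Longrightarrow> y \<in> S \<Longrightarrow> z \<in> S \<Longrightarrow> ip (x + y) z = ip x z + ip y z"
  using hilbert unfolding hilbert_space_def by blast

lemma ip_scale_left: "x \<in> S \<Longrightarrow> y \<in> S \<Longrightarrow> ip (c *\<^sub>R x) y = c * ip x y"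
  using hilbert unfolding hilbert_space_def by blast

lemma ip_pos: "x \<in> S \<Longrightarrow> x \<noteq> 0 \<Longrightarrow> ip x x > 0"
  using hilbert unfolding hilbert_space_def by blast

lemma complete:
  assumes "\<And>n. u n \<in> S"
    and "\<And>e. e > 0 \<Longrightarrow> \<exists>N. \<forall>m\<ge>N. \<forall>n\<ge>N. ip_norm ip (u m - u n) < e"
  shows "\<exists>x\<in>S. ip_lim ip u x sequentially"
  using hilbert assms unfolding hilbert_space_def by blast

lemma ip_zero_left [simp]: "y \<in> S \<Longrightarrow> ip 0 y = 0"
  using ip_scale_left[of 0 y 0] by simp

lemma ip_diff_left: "x \<in> S \<Longrightarrow> y \<in> S \<Longrightarrow> z \<in> S \<Longrightarrow> ip (x - y) z = ip x z - ip y z"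
  using ip_add_left[of x "-1 *\<^sub>R y" z] ip_scale_left[of y z "-1"] by simp

lemma ip_sum_left:
  "finite I \<Longrightarrow> (\<And>i. i \<in> I \<Longrightarrow> u i \<in> S) \<Longrightarrow> y \<in> S \<Longrightarrow> ip (\<Sum>i\<in>I. u i) y = (\<Sum>i\<in>I. ip (u i) y)"
  by (induction I rule: finite_induct) (auto simp: ip_add_left)

lemma ip_add_right: "x \<in> S \<Longrightarrow> y \<in> S \<Longrightarrow> z \<in> S \<Longrightarrow> ip z (x + y) = ip z x + ip z y"
  using ip_add_left[of x y z] by (metis ip_commute S_add)

lemma ip_diff_right: "x \<in> S \<Longrightarrow> y \<in> S \<Longrightarrow> z \<in> S \<Longrightarrow> ip z (x - y) = ip z x - ip z y"
  using ip_diff_left[of x y z] by (metis ip_commute S_diff)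

lemma ip_scale_right: "x \<in> S \<Longrightarrow> y \<in> S \<Longrightarrow> ip y (c *\<^sub>R x) = c * ip y x"
  using ip_scale_left[of x y c] by (metis ip_commute S_scale)

lemma ip_sum_right:
  "finite I \<Longrightarrow> (\<And>i. i \<in> I \<Longrightarrow> u i \<in> S) \<Longrightarrow> y \<in> S \<Longrightarrow> ip y (\<Sum>i\<in>I. u i) = (\<Sum>i\<in>I. ip y (u i))"
  by (induction I rule: finite_induct) (auto simp: ip_add_right ip_commute[of y 0])

lemma ip_ge_0 [simp]: "x \<in> S \<Longrightarrow> 0 \<le> ip x x"
  by (cases "x = 0") (auto dest: ip_pos)

lemma ip_eq_0_iff: "x \<in> S \<Longrightarrow> ip x x = 0 \<longleftrightarrow> x = 0"
  by (cases "x = 0") (auto dest: ip_pos)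

abbreviation "nrm \<equiv> ip_norm ip"

lemma nrm_sq: "x \<in> S \<Longrightarrow> (nrm x)\<^sup>2 = ip x x"
  by (simp add: ip_norm_def)

lemma nrm_nonneg [simp]: "x \<in> S \<Longrightarrow> 0 \<le> nrm x"
  by (simp add: ip_norm_def)

lemma nrm_scale: "x \<in> S \<Longrightarrow> nrm (c *\<^sub>R x) = \<bar>c\<bar> * nrm x"
  by (simp add: ip_norm_def ip_scale_left ip_scale_right real_sqrt_mult power2_eq_square[symmetric]
      flip: mult.assoc)

lemma nrm_minus_commute: "x \<in> S \<Longrightarrow> y \<in> S \<Longrightarrow> nrm (x - y) = nrm (y - x)"
  using nrm_scale[of "y - x" "-1"] by simp

lemma Cauchy_Schwarz:
  assumes "x \<in> S" "y \<in> S"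
  shows "\<bar>ip x y\<bar> \<le> nrm x * nrm y"
proof (cases "y = 0")
  case True
  then show ?thesis using assms by (simp add: ip_commute[of x 0] ip_norm_def)
next
  case False
  then have p: "ip y y > 0" using assms ip_pos by auto
  define t where "t = ip x y / ip y y"
  have "0 \<le> ip (x - t *\<^sub>R y) (x - t *\<^sub>R y)" using assms by auto
  also have "\<dots> = ip x x - 2 * t * ip x y + t * t * ip y y"
    using assms by (simp add: ip_diff_left ip_diff_right ip_scale_left ip_scale_right
        ip_commute[of y x] algebra_simps)
  also have "\<dots> = ip x x - (ip x y)\<^sup>2 / ip y y"
    using p by (simp add: t_def power2_eq_square field_simps)
  finally have "(ip x y)\<^sup>2 \<le> ip x x * ip y y" using p by (simp add: field_simps)
  then have "sqrt ((ip x y)\<^sup>2) \<le> sqrt (ip x x * ip y y)" by (rule real_sqrt_le_mono)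
  then show ?thesis by (simp add: ip_norm_def real_sqrt_mult)
qed

lemma nrm_triangle:
  assumes "x \<in> S" "y \<in> S"
  shows "nrm (x + y) \<le> nrm x + nrm y"
proof (rule power2_le_imp_le)
  have "(nrm (x + y))\<^sup>2 = ip x x + 2 * ip x y + ip y y"
    using assms by (simp add: nrm_sq ip_add_left ip_add_right ip_commute[of y x])
  also have "\<dots> \<le> (nrm x)\<^sup>2 + 2 * (nrm x * nrm y) + (nrm y)\<^sup>2"
    using Cauchy_Schwarz[OF assms] assms by (simp add: nrm_sq)
  finally show "(nrm (x + y))\<^sup>2 \<le> (nrm x + nrm y)\<^sup>2"
    by (simp add: power2_eq_square algebra_simps)
qed (use assms in auto)

lemma nrm_triangle_diff:
  assumes "x \<in> S" "y \<in> S" "z \<in> S"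
  shows "nrm (x - z) \<le> nrm (x - y) + nrm (y - z)"
  using nrm_triangle[of "x - y" "y - z"] assms by auto

lemma ip_lim_unique:
  assumes "x \<in> S" "y \<in> S" "\<And>i. u i \<in> S" "ip_lim ip u x F" "ip_lim ip u y F" "F \<noteq> bot"
  shows "x = y"
proof -
  have "((\<lambda>i. nrm (u i - x) + nrm (u i - y)) \<longlongrightarrow> 0 + 0) F"
    using assms(4,5) unfolding ip_lim_def by (rule tendsto_add)
  moreover have "nrm (x - y) \<le> nrm (u i - x) + nrm (u i - y)" for i
    using nrm_triangle_diff[of x "u i" y] nrm_minus_commute[of x "u i"] assms by auto
  ultimately have "nrm (x - y) \<le> 0"
    using assms(6) by (intro tendsto_le[OF assms(6) _ tendsto_const]) auto
  then have "nrm (x - y) = 0" using assms nrm_nonneg[of "x - y"] by (intro antisym) auto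
  then have "ip (x - y) (x - y) = 0"
    using assms nrm_sq[of "x - y"] by simp
  then show ?thesis using assms ip_eq_0_iff[of "x - y"] by auto
qed

text \<open>Cauchy-Schwarz bounds the error in each coefficient by the error in norm. Membership is
  asked only eventually, because along \<open>at_right 0\<close> the difference quotients are known
  to lie in the space only for positive times.\<close>

lemma ip_lim_ip:
  assumes "ip_lim ip u x F" "eventually (\<lambda>i. u i \<in> S) F" "x \<in> S" "y \<in> S"
  shows "((\<lambda>i. ip (u i) y) \<longlongrightarrow> ip x y) F"
proof -
  have *: "((\<lambda>i. nrm (u i - x) * nrm y) \<longlongrightarrow> 0) F"
    using assms(1) unfolding ip_lim_def by (auto intro: tendsto_mult_left_zero)
  have "((\<lambda>i. ip (u i) y - ip x y) \<longlongrightarrow> 0) F"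
  proof (rule Lim_null_comparison[OF _ *])
    show "eventually (\<lambda>i. norm (ip (u i) y - ip x y) \<le> nrm (u i - x) * nrm y) F"
      using assms(2)
    proof eventually_elim
      case (elim i)
      then show ?case using Cauchy_Schwarz[of "u i - x" y] assms by (simp add: ip_diff_left)
    qed
  qed
  then show ?thesis by (rule LIM_zero_cancel)
qed

end

section \<open>Fourier series in an orthonormal basis\<close>

locale onb = real_hilbert S ip
  for S :: "'v::real_vector set" and ip :: "'v \<Rightarrow> 'v \<Rightarrow> real" +
  fixes e :: "nat \<Rightarrow> 'v"
  assumes basis: "orthonormal_basis S ip e"
begin

lemma e_in [simp]: "e n \<in> S"
  using basis unfolding orthonormal_basis_def dense_span_def by blast

lemma ip_e [simp]: "ip (e m) (e n) = (if m = n then 1 else 0)"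
  using basis unfolding orthonormal_basis_def by blast

lemma e_nonzero [simp]: "e n \<noteq> 0"
  by (metis ip_e ip_zero_left e_in zero_neq_one)

lemma ip_fin_sum_e:
  assumes "finite F"
  shows "ip (\<Sum>n\<in>F. c n *\<^sub>R e n) (e k) = (if k \<in> F then c k else 0)"
proof -
  have "ip (\<Sum>n\<in>F. c n *\<^sub>R e n) (e k) = (\<Sum>n\<in>F. ip (c n *\<^sub>R e n) (e k))"
    by (rule ip_sum_left[OF assms]) auto
  also have "\<dots> = (\<Sum>n\<in>F. if k = n then c k else 0)"
    by (rule sum.cong) (auto simp: ip_scale_left)
  finally show ?thesis using assms by simp
qed

lemma ip_sum_e:
  assumes "finite F"
  shows "ip (\<Sum>n\<in>F. c n *\<^sub>R e n) (\<Sum>n\<in>F. c n *\<^sub>R e n) = (\<Sum>n\<in>F. (c n)\<^sup>2)"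
proof -
  have X: "(\<Sum>n\<in>F. c n *\<^sub>R e n) \<in> S" by auto
  have "ip (\<Sum>n\<in>F. c n *\<^sub>R e n) (\<Sum>n\<in>F. c n *\<^sub>R e n) = (\<Sum>k\<in>F. ip (\<Sum>n\<in>F. c n *\<^sub>R e n) (c k *\<^sub>R e k))"
    by (rule ip_sum_right[OF assms _ X]) simp
  also have "\<dots> = (\<Sum>k\<in>F. (c k)\<^sup>2)"
    by (rule sum.cong) (simp_all add: ip_scale_right X ip_fin_sum_e[OF assms] power2_eq_square)
  finally show ?thesis .
qed

text \<open>Completing the square in the coefficients. With \<open>c n = ip x (e n)\<close> the last
  sum vanishes, which gives both the best approximation property and the remainder in Parseval's
  identity.\<close>

lemma ip_diff_fin_sum:
  assumes x: "x \<in> S"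
  shows "ip (x - (\<Sum>n<N. c n *\<^sub>R e n)) (x - (\<Sum>n<N. c n *\<^sub>R e n))
     = ip x x - (\<Sum>n<N. (ip x (e n))\<^sup>2) + (\<Sum>n<N. (c n - ip x (e n))\<^sup>2)"
proof -
  let ?y = "\<Sum>n<N. c n *\<^sub>R e n"
  have y: "?y \<in> S" by auto
  have 1: "ip x ?y = (\<Sum>n<N. c n * ip x (e n))"
    using x by (subst ip_sum_right) (auto simp: ip_scale_right)
  have 2: "ip ?y ?y = (\<Sum>n<N. c n * c n)"
    by (simp add: ip_sum_e power2_eq_square)
  have "ip (x - ?y) (x - ?y) = ip x x - 2 * ip x ?y + ip ?y ?y"
    using x y by (simp add: ip_diff_left ip_diff_right ip_commute[of ?y x])
  also have "\<dots> = ip x x - (\<Sum>n<N. (ip x (e n))\<^sup>2) + (\<Sum>n<N. (c n - ip x (e n))\<^sup>2)"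
  proof -
    have "(c n - ip x (e n))\<^sup>2 = c n * c n - 2 * (c n * ip x (e n)) + (ip x (e n))\<^sup>2" for n
      by (simp add: power2_eq_square algebra_simps)
    then have "(\<Sum>n<N. (c n - ip x (e n))\<^sup>2)
        = (\<Sum>n<N. c n * c n) - 2 * (\<Sum>n<N. c n * ip x (e n)) + (\<Sum>n<N. (ip x (e n))\<^sup>2)"
      by (simp only: sum.distrib sum_subtractf sum_distrib_left)
    then show ?thesis unfolding 1 2 by simp
  qed
  finally show ?thesis .
qed

text \<open>Allowing every sufficiently large length, with zero padding, makes an element of the
  span comparable to a Fourier partial sum of the same length.\<close>

lemma span_range_e:
  assumes "y \<in> span (range e)"
  shows "\<exists>N c. \<forall>M\<ge>N. y = (\<Sum>n<M. c n *\<^sub>R e n)"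
  using assms
proof (induction rule: span_induct_alt)
  case base
  show ?case by (rule exI[of _ 0], rule exI[of _ "\<lambda>_. 0"]) auto
next
  case (step r x y)
  then obtain k N c where k: "x = e k" and N: "\<forall>M\<ge>N. y = (\<Sum>n<M. c n *\<^sub>R e n)" by auto
  have "r *\<^sub>R x + y = (\<Sum>n<M. (c n + (if n = k then r else 0)) *\<^sub>R e n)" if "M \<ge> max N (Suc k)" for M
  proof -
    have "(\<Sum>n<M. (if n = k then r else 0) *\<^sub>R e n) = (\<Sum>n<M. if n = k then r *\<^sub>R e k else 0)"
      by (rule sum.cong) auto
    also have "\<dots> = r *\<^sub>R x" using that k by simp
    finally have "(\<Sum>n<M. (if n = k then r else 0) *\<^sub>R e n) = r *\<^sub>R x" .
    moreover have "(\<Sum>n<M. c n *\<^sub>R e n) = y" using N that by auto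
    ultimately show ?thesis by (simp only: scaleR_add_left sum.distrib add.commute)
  qed
  then show ?case
    by (intro exI[of _ "max N (Suc k)"] exI[of _ "\<lambda>n. c n + (if n = k then r else 0)"]) auto
qed

text \<open>An approximant from the dense span is a sum of any length \<open>M\<close> beyond some
  \<open>N\<close>, and the Fourier partial sum of length \<open>M\<close> minimizes the distance
  among all such sums, hence is at least as close.\<close>

lemma partial_sums_lim:
  assumes x: "x \<in> S"
  shows "ip_lim ip (\<lambda>N. \<Sum>n<N. ip x (e n) *\<^sub>R e n) x sequentially"
  unfolding ip_lim_def
proof (rule LIMSEQ_I)
  fix r :: real assume "r > 0"
  then obtain y where y: "y \<in> span (range e)" "nrm (x - y) < r"
    using basis x unfolding orthonormal_basis_def dense_span_def by blast
  obtain N c where N: "\<forall>M\<ge>N. y = (\<Sum>n<M. c n *\<^sub>R e n)" using span_range_e[OF y(1)] by blast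
  have "norm (nrm ((\<Sum>n<M. ip x (e n) *\<^sub>R e n) - x) - 0) < r" if M: "M \<ge> N" for M
  proof -
    let ?p = "\<Sum>n<M. ip x (e n) *\<^sub>R e n"
    have p: "?p \<in> S" by auto
    have "ip (x - ?p) (x - ?p) \<le> ip (x - y) (x - y)"
      using N M unfolding ip_diff_fin_sum[OF x] by (simp add: ip_diff_fin_sum[OF x] sum_nonneg)
    then have "nrm (x - ?p) \<le> nrm (x - y)" unfolding ip_norm_def by (rule real_sqrt_le_mono)
    then show ?thesis using y(2) nrm_minus_commute[OF x p] nrm_nonneg[of "x - ?p"] x p by auto
  qed
  then show "\<exists>no. \<forall>n\<ge>no. norm (nrm ((\<Sum>n<n. ip x (e n) *\<^sub>R e n) - x) - 0) < r" by blast
qed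

lemma Parseval:
  assumes x: "x \<in> S"
  shows "(\<lambda>n. (ip x (e n))\<^sup>2) sums ip x x"
proof -
  have "(\<lambda>N. (nrm ((\<Sum>n<N. ip x (e n) *\<^sub>R e n) - x))\<^sup>2) \<longlonglongrightarrow> 0\<^sup>2"
    using partial_sums_lim[OF x] unfolding ip_lim_def by (rule tendsto_power)
  moreover have "(nrm ((\<Sum>n<N. ip x (e n) *\<^sub>R e n) - x))\<^sup>2 = ip x x - (\<Sum>n<N. (ip x (e n))\<^sup>2)" for N
    using x nrm_minus_commute[of x "\<Sum>n<N. ip x (e n) *\<^sub>R e n"] ip_diff_fin_sum[OF x, of "\<lambda>n. ip x (e n)" N]
      nrm_sq[of "x - (\<Sum>n<N. ip x (e n) *\<^sub>R e n)"] by simp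
  ultimately have "(\<lambda>N. ip x x - (\<Sum>n<N. (ip x (e n))\<^sup>2)) \<longlonglongrightarrow> 0" by simp
  then have "(\<lambda>N. ip x x - (ip x x - (\<Sum>n<N. (ip x (e n))\<^sup>2))) \<longlonglongrightarrow> ip x x - 0"
    by (intro tendsto_diff tendsto_const)
  then show ?thesis by (simp add: sums_def)
qed

lemma summable_coeff: "x \<in> S \<Longrightarrow> summable (\<lambda>n. (ip x (e n))\<^sup>2)"
  using Parseval by (auto simp: sums_iff)

lemma ip_self_eq: "x \<in> S \<Longrightarrow> ip x x = (\<Sum>n. (ip x (e n))\<^sup>2)"
  using Parseval by (auto simp: sums_iff)

lemma coeff_eqI:
  assumes "x \<in> S" "y \<in> S" "\<And>n. ip x (e n) = ip y (e n)"
  shows "x = y"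
proof -
  have "ip (x - y) (x - y) = 0"
    using assms by (subst ip_self_eq) (auto simp: ip_diff_left)
  then show ?thesis using assms ip_eq_0_iff[of "x - y"] by auto
qed

text \<open>The squared norm of a block of the sum is the corresponding block of the convergent
  series, so the partial sums are Cauchy; the coefficients of the limit follow by continuity of
  \<open>ip\<close>.\<close>

lemma Riesz_Fischer:
  assumes c: "summable (\<lambda>n. (c n)\<^sup>2)"
  shows "\<exists>s\<in>S. \<forall>n. ip s (e n) = c n"
proof -
  let ?u = "\<lambda>N. \<Sum>n<N. c n *\<^sub>R e n"
  have d: "ip (?u m - ?u n) (?u m - ?u n) = (\<Sum>k\<in>{n..<m}. (c k)\<^sup>2)" if "n \<le> m" for m n
  proof -
    have "{..<m} - {..<n} = {n..<m}" by auto
    then have "?u m - ?u n = (\<Sum>k\<in>{n..<m}. c k *\<^sub>R e k)"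
      using sum_diff[of "{..<m}" "{..<n}" "\<lambda>k. c k *\<^sub>R e k"] that by simp
    then show ?thesis by (simp only: ip_sum_e finite_atLeastLessThan)
  qed
  have "\<exists>s\<in>S. ip_lim ip ?u s sequentially"
  proof (rule complete)
    fix r :: real assume r: "r > 0"
    then have "r\<^sup>2 > 0" by simp
    from c this obtain N where N: "\<And>m n. m \<ge> N \<Longrightarrow> norm (\<Sum>k\<in>{m..<n}. (c k)\<^sup>2) < r\<^sup>2"
      unfolding summable_Cauchy by blast
    have *: "nrm (?u m - ?u n) < r" if "N \<le> n" "n \<le> m" for m n
    proof -
      have "ip (?u m - ?u n) (?u m - ?u n) < r\<^sup>2" using d[OF that(2)] N[OF that(1), of m] by simp
      then have "nrm (?u m - ?u n) < sqrt (r\<^sup>2)"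
        unfolding ip_norm_def by (simp only: real_sqrt_less_iff)
      then show ?thesis using r by simp
    qed
    have "nrm (?u m - ?u n) < r" if "N \<le> n" "N \<le> m" for m n
      using *[of n m] *[of m n] that nrm_minus_commute[of "?u m" "?u n"] S_sum by (cases "n \<le> m") auto
    then show "\<exists>N. \<forall>m\<ge>N. \<forall>n\<ge>N. nrm (?u m - ?u n) < r" by blast
  qed auto
  then obtain s where s: "s \<in> S" "ip_lim ip ?u s sequentially" by blast
  have "ip s (e n) = c n" for n
  proof -
    have "(\<lambda>N. ip (?u N) (e n)) \<longlonglongrightarrow> ip s (e n)"
      by (rule ip_lim_ip[OF s(2)]) (auto simp: s)
    moreover have "(\<lambda>N. ip (?u N) (e n)) \<longlonglongrightarrow> c n"
      unfolding ip_fin_sum_e[OF finite_lessThan]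
      by (rule tendsto_eventually, rule eventually_sequentiallyI[of "Suc n"]) simp
    ultimately show ?thesis by (rule LIMSEQ_unique)
  qed
  then show ?thesis using s by blast
qed

text \<open>\<open>ip_suminf\<close> is a definite description, and uniqueness of norm limits within
  \<open>S\<close> is what gives it a value.\<close>

lemma ip_suminf_eq:
  assumes s: "s \<in> S"
  shows "ip_suminf S ip (\<lambda>n. ip s (e n) *\<^sub>R e n) = s"
  unfolding ip_suminf_def
proof (rule the_equality)
  show "s \<in> S \<and> ip_lim ip (\<lambda>N. \<Sum>n<N. ip s (e n) *\<^sub>R e n) s sequentially"
    using s partial_sums_lim by blast
next
  fix t assume t: "t \<in> S \<and> ip_lim ip (\<lambda>N. \<Sum>n<N. ip s (e n) *\<^sub>R e n) t sequentially"
  show "t = s"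
    by (rule ip_lim_unique[where F=sequentially and u="\<lambda>N. \<Sum>n<N. ip s (e n) *\<^sub>R e n"])
      (use s t partial_sums_lim[OF s] in auto)
qed

text \<open>Riesz-Fischer turns the summability in the domain into a vector with the multiplied
  coefficients, and uniqueness of the sum identifies it with \<open>diag_op\<close>. Later arguments
  work with these coefficients.\<close>

lemma diag_op_props:
  assumes "f \<in> diag_dom S ip e c"
  shows "diag_op S ip e c f \<in> S" "\<And>n. ip (diag_op S ip e c f) (e n) = c n * ip f (e n)"
proof -
  have "summable (\<lambda>n. (c n * ip f (e n))\<^sup>2)"
    using assms by (simp add: diag_dom_def power_mult_distrib)
  then obtain s where s: "s \<in> S" "\<And>n. ip s (e n) = c n * ip f (e n)"
    using Riesz_Fischer[of "\<lambda>n. c n * ip f (e n)"] by auto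
  then have "diag_op S ip e c f = s"
    using ip_suminf_eq[OF s(1)] by (simp add: diag_op_def)
  with s show "diag_op S ip e c f \<in> S" "\<And>n. ip (diag_op S ip e c f) (e n) = c n * ip f (e n)"
    by auto
qed

lemma subspace_diag_dom: "subspace (diag_dom S ip e c)"
proof (rule subspaceI)
  show "0 \<in> diag_dom S ip e c" by (simp add: diag_dom_def)
next
  fix x y assume xy: "x \<in> diag_dom S ip e c" "y \<in> diag_dom S ip e c"
  have "summable (\<lambda>n. (c n)\<^sup>2 * (ip (x + y) (e n))\<^sup>2)"
  proof (rule summable_comparison_test'[of "\<lambda>n. 2 * ((c n)\<^sup>2 * (ip x (e n))\<^sup>2) + 2 * ((c n)\<^sup>2 * (ip y (e n))\<^sup>2)" 0])
    show "summable (\<lambda>n. 2 * ((c n)\<^sup>2 * (ip x (e n))\<^sup>2) + 2 * ((c n)\<^sup>2 * (ip y (e n))\<^sup>2))"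
      using xy by (intro summable_add summable_mult) (auto simp: diag_dom_def)
    fix n
    have "(s + t)\<^sup>2 \<le> 2 * s\<^sup>2 + 2 * t\<^sup>2" for s t :: real
      using sum_squares_bound[of s t] by (simp add: power2_sum)
    from mult_left_mono[OF this[of "ip x (e n)" "ip y (e n)"], of "(c n)\<^sup>2"]
    show "norm ((c n)\<^sup>2 * (ip (x + y) (e n))\<^sup>2) \<le> 2 * ((c n)\<^sup>2 * (ip x (e n))\<^sup>2) + 2 * ((c n)\<^sup>2 * (ip y (e n))\<^sup>2)"
      using xy by (simp add: diag_dom_def ip_add_left algebra_simps)
  qed
  then show "x + y \<in> diag_dom S ip e c" using xy by (auto simp: diag_dom_def)
next
  fix r x assume x: "x \<in> diag_dom S ip e c"
  have "summable (\<lambda>n. r\<^sup>2 * ((c n)\<^sup>2 * (ip x (e n))\<^sup>2))"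
    using x by (intro summable_mult) (auto simp: diag_dom_def)
  then show "r *\<^sub>R x \<in> diag_dom S ip e c"
    using x by (auto simp: diag_dom_def ip_scale_left power_mult_distrib mult_ac)
qed

lemma e_in_diag_dom [simp]: "e k \<in> diag_dom S ip e c"
proof -
  have "summable (\<lambda>n. if n \<in> {k} then (c n)\<^sup>2 else 0)" by (rule summable_If_finite_set) simp
  moreover have "(c n)\<^sup>2 * (ip (e k) (e n))\<^sup>2 = (if n \<in> {k} then (c n)\<^sup>2 else 0)" for n by auto
  ultimately show ?thesis by (auto simp: diag_dom_def)
qed

lemma bounded_diag_dom:
  assumes "\<And>n. \<bar>c n\<bar> \<le> K"
  shows "diag_dom S ip e c = S"
proof -
  have "summable (\<lambda>n. (c n)\<^sup>2 * (ip f (e n))\<^sup>2)" if "f \<in> S" for f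
  proof (rule summable_comparison_test'[of "\<lambda>n. K\<^sup>2 * (ip f (e n))\<^sup>2" 0])
    show "summable (\<lambda>n. K\<^sup>2 * (ip f (e n))\<^sup>2)" by (intro summable_mult summable_coeff that)
    fix n have "(c n)\<^sup>2 \<le> K\<^sup>2" using power_mono[OF assms[of n], of 2] by simp
    then show "norm ((c n)\<^sup>2 * (ip f (e n))\<^sup>2) \<le> K\<^sup>2 * (ip f (e n))\<^sup>2"
      by (simp add: mult_right_mono)
  qed
  then show ?thesis by (auto simp: diag_dom_def)
qed

lemma linear_on_set_diag_op: "linear_on_set (diag_dom S ip e c) (diag_op S ip e c)"
  unfolding linear_on_set_def
proof (intro conjI ballI allI)
  note D = subspace_diag_dom[of c]
  fix x y assume xy: "x \<in> diag_dom S ip e c" "y \<in> diag_dom S ip e c"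
  then have "x \<in> S" "y \<in> S" by (auto simp: diag_dom_def)
  then show "diag_op S ip e c (x + y) = diag_op S ip e c x + diag_op S ip e c y"
    using xy subspace_add[OF D xy]
    by (intro coeff_eqI) (auto simp: diag_op_props ip_add_left algebra_simps)
next
  note D = subspace_diag_dom[of c]
  fix r x assume x: "x \<in> diag_dom S ip e c"
  then have "x \<in> S" by (auto simp: diag_dom_def)
  then show "diag_op S ip e c (r *\<^sub>R x) = r *\<^sub>R diag_op S ip e c x"
    using x subspace_scale[OF D x]
    by (intro coeff_eqI) (auto simp: diag_op_props ip_scale_left algebra_simps)
qed

lemma riesz_basis_e: "riesz_basis S ip e"
proof -
  have "(nrm (\<Sum>n<N. c n *\<^sub>R e n))\<^sup>2 = (\<Sum>n<N. (c n)\<^sup>2)" for N c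
    by (simp add: nrm_sq ip_sum_e)
  then show ?thesis using basis unfolding riesz_basis_def orthonormal_basis_def
    by (auto intro!: exI[of _ 1])
qed

end

locale diagonal_operator = onb S ip e
  for S :: "'v::real_vector set" and ip :: "'v \<Rightarrow> 'v \<Rightarrow> real" and e :: "nat \<Rightarrow> 'v" +
  fixes lam :: "nat \<Rightarrow> real" and A :: "'v \<Rightarrow> 'v" and \<gamma> :: real
  assumes A_in: "f \<in> diag_dom S ip e lam \<Longrightarrow> A f \<in> S"
    and A_coeff: "f \<in> diag_dom S ip e lam \<Longrightarrow> ip (A f) (e n) = lam n * ip f (e n)"
    and lam_inj: "inj lam"
    and lam_le: "lam n \<le> \<gamma>"
begin

abbreviation "D \<equiv> diag_dom S ip e lam"

lemma D_S: "f \<in> D \<Longrightarrow> f \<in> S" by (simp add: diag_dom_def)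

text \<open>Square summability of the coefficients of \<open>g\<close> is literally the summability
  that defines the domain. Both closedness and the maximality of the generator's domain come down to
  this.\<close>

lemma D_I: "f \<in> S \<Longrightarrow> g \<in> S \<Longrightarrow> (\<And>n. ip g (e n) = lam n * ip f (e n)) \<Longrightarrow> f \<in> D"
  using summable_coeff[of g] by (simp add: diag_dom_def power_mult_distrib)

lemma A_eqI: "f \<in> D \<Longrightarrow> g \<in> S \<Longrightarrow> (\<And>n. ip g (e n) = lam n * ip f (e n)) \<Longrightarrow> A f = g"
  by (rule coeff_eqI) (auto simp: A_in A_coeff)

lemma closed_A: "closed_linear_operator S ip D A"
  unfolding closed_linear_operator_def
proof (intro conjI allI ballI impI)
  show "subspace D" by (rule subspace_diag_dom)
  show "D \<subseteq> S" using D_S by auto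
  show "A ` D \<subseteq> S" using A_in by auto
  show "linear_on_set D A"
    unfolding linear_on_set_def
  proof (intro conjI ballI allI)
    fix x y assume "x \<in> D" "y \<in> D"
    then show "A (x + y) = A x + A y"
      by (intro A_eqI subspace_add[OF subspace_diag_dom] S_add)
        (auto simp: A_in A_coeff ip_add_left D_S algebra_simps)
  next
    fix r x assume "x \<in> D"
    then show "A (r *\<^sub>R x) = r *\<^sub>R A x"
      by (intro A_eqI subspace_scale[OF subspace_diag_dom] S_scale)
        (auto simp: A_in A_coeff ip_scale_left D_S algebra_simps)
  qed
next
  fix u x y assume x: "x \<in> S" and y: "y \<in> S" and u: "\<forall>n. u n \<in> D"
    and ux: "ip_lim ip u x sequentially" and Au: "ip_lim ip (\<lambda>n. A (u n)) y sequentially"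
  have c: "ip y (e k) = lam k * ip x (e k)" for k
  proof (rule LIMSEQ_unique)
    show "(\<lambda>n. ip (A (u n)) (e k)) \<longlonglongrightarrow> ip y (e k)"
      using u y by (intro ip_lim_ip[OF Au]) (auto simp: A_in)
    have "(\<lambda>n. lam k * ip (u n) (e k)) \<longlonglongrightarrow> lam k * ip x (e k)"
      using u x by (intro tendsto_mult_left ip_lim_ip[OF ux]) (auto simp: D_S)
    then show "(\<lambda>n. ip (A (u n)) (e k)) \<longlonglongrightarrow> lam k * ip x (e k)"
      using u by (simp add: A_coeff)
  qed
  show "x \<in> D" using D_I[OF x y c] .
  then show "A x = y" using A_eqI[OF _ y c] by blast
qed

lemma eigenspace_A: "eigenspace D A (lam k) = span {e k}"
proof (intro set_eqI iffI)
  fix x assume "x \<in> eigenspace D A (lam k)"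
  then have x: "x \<in> D" "A x = lam k *\<^sub>R x" by (auto simp: eigenspace_def)
  have "lam n * ip x (e n) = lam k * ip x (e n)" for n
    using A_coeff[OF x(1), of n] x D_S by (auto simp: ip_scale_left)
  then have "n \<noteq> k \<Longrightarrow> ip x (e n) = 0" for n using lam_inj by (auto dest: injD)
  then have "x = ip x (e k) *\<^sub>R e k"
    using x D_S by (intro coeff_eqI) (auto simp: ip_scale_left)
  then show "x \<in> span {e k}" by (auto simp: span_singleton)
next
  fix x assume "x \<in> span {e k}"
  then obtain r where r: "x = r *\<^sub>R e k" by (auto simp: span_singleton)
  have "x \<in> D" unfolding r by (intro subspace_scale[OF subspace_diag_dom]) simp
  moreover from this have "A x = lam k *\<^sub>R x"
    by (rule A_eqI) (auto simp: r ip_scale_left)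
  ultimately show "x \<in> eigenspace D A (lam k)" by (simp add: eigenspace_def)
qed

text \<open>The \<open>k\<close>-th coefficient of \<open>A y - lam k *\<^sub>R y\<close> is zero
  for every \<open>y\<close> in the domain, so this vector can be a multiple of \<open>e k\<close>
  only if it vanishes; this rules out generalized eigenvectors.\<close>

lemma simple_A: "simple_eigenvalue D A (lam k)"
  unfolding simple_eigenvalue_def
proof (intro conjI ballI impI)
  show "\<exists>x. x \<noteq> 0 \<and> eigenspace D A (lam k) = span {x}"
    using eigenspace_A e_nonzero by blast
next
  fix y assume y: "y \<in> D" and "A y - lam k *\<^sub>R y \<in> eigenspace D A (lam k)"
  then obtain r where r: "A y - lam k *\<^sub>R y = r *\<^sub>R e k"
    unfolding eigenspace_A by (auto simp: span_singleton)
  have "ip (A y - lam k *\<^sub>R y) (e k) = 0"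
    using y by (simp add: ip_diff_left ip_scale_left A_in A_coeff D_S)
  then have "r = 0" unfolding r by (simp add: ip_scale_left)
  then show "y \<in> eigenspace D A (lam k)" using r y by (simp add: eigenspace_def)
qed

lemma eigenvalues_A: "eigenvalues D A = range lam"
proof (intro set_eqI iffI)
  fix l assume "l \<in> eigenvalues D A"
  then obtain x where x: "x \<in> D" "A x = l *\<^sub>R x" "x \<noteq> 0"
    by (auto simp: eigenvalues_def eigenspace_def)
  then obtain n where "ip x (e n) \<noteq> 0"
    using coeff_eqI[of x 0] D_S by auto
  moreover have "lam n * ip x (e n) = l * ip x (e n)"
    using A_coeff[OF x(1), of n] x D_S by (auto simp: ip_scale_left)
  ultimately show "l \<in> range lam" by auto
next
  fix l assume "l \<in> range lam"
  then obtain n where "l = lam n" by auto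
  then show "l \<in> eigenvalues D A"
    using eigenspace_A[of n] e_nonzero[of n] span_base[of "e n" "{e n}"] unfolding eigenvalues_def by blast
qed

lemma riesz_spectral_A:
  assumes "totally_disconnected (closure (range lam))"
  shows "riesz_spectral S ip D A"
  unfolding riesz_spectral_def
proof (intro conjI exI[of _ lam] exI[of _ e] allI)
  show "e n \<in> eigenspace D A (lam n)" for n unfolding eigenspace_A by (simp add: span_base)
qed (use assms hilbert closed_A lam_inj eigenvalues_A simple_A riesz_basis_e in auto)

section \<open>The exponential semigroup and its generator\<close>

definition "T t = diag_op S ip e (\<lambda>n. exp (lam n * t))"

lemma exp_lam_le: "t \<ge> 0 \<Longrightarrow> \<bar>exp (lam n * t)\<bar> \<le> exp (\<gamma> * t)"
  using lam_le[of n] by (simp add: mult_right_mono)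

lemma T_dom: "t \<ge> 0 \<Longrightarrow> diag_dom S ip e (\<lambda>n. exp (lam n * t)) = S"
  by (rule bounded_diag_dom[OF exp_lam_le])

lemma T_in [simp]: "t \<ge> 0 \<Longrightarrow> f \<in> S \<Longrightarrow> T t f \<in> S"
  unfolding T_def using T_dom by (intro diag_op_props) auto

lemma T_coeff [simp]: "t \<ge> 0 \<Longrightarrow> f \<in> S \<Longrightarrow> ip (T t f) (e n) = exp (lam n * t) * ip f (e n)"
  unfolding T_def using T_dom by (intro diag_op_props) auto

text \<open>Parseval turns the squared distance into a series over the coefficients, so dominated
  convergence for series applies with coefficientwise limits and one summable majorant.\<close>

lemma ip_lim_coeffI:
  assumes "eventually (\<lambda>i. u i \<in> S) F" "x \<in> S" "summable g"
    and dom: "eventually (\<lambda>i. \<forall>n. (ip (u i) (e n) - ip x (e n))\<^sup>2 \<le> g n) F"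
    and lim: "\<And>n. ((\<lambda>i. ip (u i) (e n)) \<longlongrightarrow> ip x (e n)) F"
  shows "ip_lim ip u x F"
proof -
  have "((\<lambda>i. \<Sum>n. (ip (u i) (e n) - ip x (e n))\<^sup>2) \<longlongrightarrow> 0) F"
  proof (rule tendsto_suminf_zero_dominated[OF \<open>summable g\<close>])
    show "\<forall>\<^sub>F t in F. \<forall>n. 0 \<le> (ip (u t) (e n) - ip x (e n))\<^sup>2 \<and> (ip (u t) (e n) - ip x (e n))\<^sup>2 \<le> g n"
      using dom by (rule eventually_mono) auto
    show "((\<lambda>t. (ip (u t) (e n) - ip x (e n))\<^sup>2) \<longlongrightarrow> 0) F" for n
      using tendsto_power[OF LIM_zero[OF lim[of n]], of 2] by simp
  qed
  then have "((\<lambda>i. sqrt (\<Sum>n. (ip (u i) (e n) - ip x (e n))\<^sup>2)) \<longlongrightarrow> sqrt 0) F"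
    by (rule tendsto_real_sqrt)
  moreover have "eventually (\<lambda>i. sqrt (\<Sum>n. (ip (u i) (e n) - ip x (e n))\<^sup>2) = nrm (u i - x)) F"
    using assms(1)
  proof eventually_elim
    case (elim i)
    then show ?case using \<open>x \<in> S\<close> by (simp add: ip_norm_def ip_self_eq ip_diff_left)
  qed
  ultimately show ?thesis unfolding ip_lim_def
    by (rule_tac Lim_transform_eventually) (simp only: real_sqrt_zero)+
qed

lemma C0_semigroup_T: "C0_semigroup S ip T"
  unfolding C0_semigroup_def
proof (intro conjI allI ballI impI)
  fix t :: real assume t: "t \<ge> 0"
  have "nrm (T t f) \<le> exp (\<gamma> * t) * nrm f" if f: "f \<in> S" for f
  proof (rule power2_le_imp_le)
    have "(nrm (T t f))\<^sup>2 = (\<Sum>n. (exp (lam n * t))\<^sup>2 * (ip f (e n))\<^sup>2)"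
      using t f by (simp add: nrm_sq ip_self_eq power_mult_distrib)
    also have "\<dots> \<le> (\<Sum>n. (exp (\<gamma> * t))\<^sup>2 * (ip f (e n))\<^sup>2)"
    proof (rule suminf_le)
      show "(exp (lam n * t))\<^sup>2 * (ip f (e n))\<^sup>2 \<le> (exp (\<gamma> * t))\<^sup>2 * (ip f (e n))\<^sup>2" for n
        using exp_lam_le[OF t, of n] by (intro mult_right_mono power_mono) auto
      show "summable (\<lambda>n. (exp (lam n * t))\<^sup>2 * (ip f (e n))\<^sup>2)"
        using summable_coeff[OF T_in[OF t f]] t f by (simp add: power_mult_distrib)
    qed (intro summable_mult summable_coeff f)
    also have "\<dots> = (exp (\<gamma> * t) * nrm f)\<^sup>2"
      using f by (simp add: power_mult_distrib nrm_sq ip_self_eq suminf_mult summable_coeff)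
    finally show "(nrm (T t f))\<^sup>2 \<le> (exp (\<gamma> * t) * nrm f)\<^sup>2" .
  qed (use f in auto)
  moreover have "linear_on_set S (T t)"
    using linear_on_set_diag_op[of "\<lambda>n. exp (lam n * t)"] T_dom[OF t] by (simp add: T_def)
  ultimately show "bounded_linear_on_set S ip (T t)"
    unfolding bounded_linear_on_set_def using t by auto
next
  fix f assume "f \<in> S"
  then show "T 0 f = f" by (intro coeff_eqI) auto
next
  fix s t :: real and f assume "s \<ge> 0" "t \<ge> 0" "f \<in> S"
  then show "T (s + t) f = T s (T t f)"
    by (intro coeff_eqI) (auto simp: exp_add distrib_left)
next
  fix f assume f: "f \<in> S"
  \<comment> \<open>Restricting to times below 1 makes the majorant independent of \<open>t\<close>;
    the absolute value covers both signs of \<open>\<gamma>\<close>, and the added 1 accounts for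
    subtracting \<open>f\<close>.\<close>
  show "ip_lim ip (\<lambda>t. T t f) f (at_right 0)"
  proof (rule ip_lim_coeffI[where g="\<lambda>n. (exp \<bar>\<gamma>\<bar> + 1)\<^sup>2 * (ip f (e n))\<^sup>2"])
    show "\<forall>\<^sub>F t in at_right 0. T t f \<in> S"
      using f by (intro eventually_mono[OF eventually_at_right_less]) auto
    show "summable (\<lambda>n. (exp \<bar>\<gamma>\<bar> + 1)\<^sup>2 * (ip f (e n))\<^sup>2)"
      by (intro summable_mult summable_coeff f)
    have "\<forall>\<^sub>F t in at_right 0. t \<in> {0<..<(1::real)}" by (rule eventually_at_right_real) simp
    then show "\<forall>\<^sub>F t in at_right 0. \<forall>n. (ip (T t f) (e n) - ip f (e n))\<^sup>2 \<le> (exp \<bar>\<gamma>\<bar> + 1)\<^sup>2 * (ip f (e n))\<^sup>2"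
    proof eventually_elim
      case (elim t)
      show ?case
      proof
        fix n
        have "\<gamma> * t \<le> \<bar>\<gamma>\<bar> * 1" using elim by (intro mult_mono) auto
        then have "exp (\<gamma> * t) \<le> exp \<bar>\<gamma>\<bar>" by simp
        then have "\<bar>exp (lam n * t)\<bar> \<le> exp \<bar>\<gamma>\<bar>"
          using exp_lam_le[of t n] elim by (meson greaterThanLessThan_iff less_imp_le order_trans)
        then have "\<bar>exp (lam n * t) - 1\<bar> \<le> exp \<bar>\<gamma>\<bar> + 1" by linarith
        then have "(exp (lam n * t) - 1)\<^sup>2 \<le> (exp \<bar>\<gamma>\<bar> + 1)\<^sup>2" using power_mono[of "\<bar>exp (lam n * t) - 1\<bar>" "exp \<bar>\<gamma>\<bar> + 1" 2] by simp
        then have "(exp (lam n * t) - 1)\<^sup>2 * (ip f (e n))\<^sup>2 \<le> (exp \<bar>\<gamma>\<bar> + 1)\<^sup>2 * (ip f (e n))\<^sup>2"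
          by (rule mult_right_mono) simp
        moreover have "ip (T t f) (e n) - ip f (e n) = (exp (lam n * t) - 1) * ip f (e n)"
          using elim f by (simp add: algebra_simps)
        ultimately show "(ip (T t f) (e n) - ip f (e n))\<^sup>2 \<le> (exp \<bar>\<gamma>\<bar> + 1)\<^sup>2 * (ip f (e n))\<^sup>2"
          by (simp add: power_mult_distrib)
      qed
    qed
  next
    fix n
    have "((\<lambda>t. exp (lam n * t) * ip f (e n)) \<longlongrightarrow> exp (lam n * 0) * ip f (e n)) (at_right 0)"
      by (intro tendsto_intros)
    then have "((\<lambda>t. exp (lam n * t) * ip f (e n)) \<longlongrightarrow> ip f (e n)) (at_right 0)" by simp
    moreover have "eventually (\<lambda>t. exp (lam n * t) * ip f (e n) = ip (T t f) (e n)) (at_right 0)"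
      using f by (intro eventually_mono[OF eventually_at_right_less]) auto
    ultimately show "((\<lambda>t. ip (T t f) (e n)) \<longlongrightarrow> ip f (e n)) (at_right 0)"
      by (rule Lim_transform_eventually)
  qed (use f in auto)
qed

lemma quot_in: "t > 0 \<Longrightarrow> f \<in> S \<Longrightarrow> (T t f - f) /\<^sub>R t \<in> S" by auto

lemma quot_coeff:
  "t > 0 \<Longrightarrow> f \<in> S \<Longrightarrow> ip ((T t f - f) /\<^sub>R t) (e n) = (exp (lam n * t) - 1) / t * ip f (e n)"
  by (simp add: ip_scale_left ip_diff_left field_simps)

lemma quot_coeff_lim:
  assumes f: "f \<in> S"
  shows "((\<lambda>h. ip ((T h f - f) /\<^sub>R h) (e n)) \<longlongrightarrow> lam n * ip f (e n)) (at_right 0)"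
proof -
  have "((\<lambda>t. exp (lam n * t)) has_real_derivative lam n) (at 0)"
    by (auto intro!: derivative_eq_intros)
  then have "((\<lambda>h. (exp (lam n * h) - 1) / h) \<longlongrightarrow> lam n) (at 0)"
    by (simp add: DERIV_def)
  then have "((\<lambda>h. (exp (lam n * h) - 1) / h * ip f (e n)) \<longlongrightarrow> lam n * ip f (e n)) (at_right 0)"
    by (intro tendsto_mult_right) (simp add: filterlim_at_split)
  moreover have "eventually (\<lambda>h. (exp (lam n * h) - 1) / h * ip f (e n) = ip ((T h f - f) /\<^sub>R h) (e n)) (at_right 0)"
    using quot_coeff f by (intro eventually_mono[OF eventually_at_right_less]) auto
  ultimately show ?thesis by (rule Lim_transform_eventually)
qed

text \<open>Applying \<open>1 + x \<le> exp x\<close> at \<open>x\<close> and at \<open>- x\<close>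
  gives \<open>x \<le> exp x - 1 \<le> x * exp x\<close>. The bound is linear in
  \<open>\<bar>lam n\<bar>\<close> because the eigenvalues may tend to minus infinity and membership
  in \<open>D\<close> makes just the squares of \<open>lam n\<close> times the coefficient
  summable.\<close>

lemma exp_quot_bound:
  assumes t: "0 < t" "t < 1"
  shows "\<bar>(exp (lam n * t) - 1) / t\<bar> \<le> \<bar>lam n\<bar> * exp \<bar>\<gamma>\<bar>"
proof -
  have g: "exp (lam n * t) \<le> exp \<bar>\<gamma>\<bar>"
  proof -
    have "lam n * t \<le> \<bar>\<gamma>\<bar> * t" using lam_le[of n] t by (intro mult_right_mono) auto
    also have "\<dots> \<le> \<bar>\<gamma>\<bar> * 1" using t by (intro mult_left_mono) auto
    finally show ?thesis by simp
  qed
  have 1: "exp (lam n * t) - 1 \<ge> lam n * t" using exp_ge_add_one_self[of "lam n * t"] by linarith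
  have "1 - exp (- (lam n * t)) \<le> lam n * t" using exp_ge_add_one_self[of "- (lam n * t)"] by linarith
  then have "exp (lam n * t) * (1 - exp (- (lam n * t))) \<le> exp (lam n * t) * (lam n * t)"
    by (intro mult_left_mono) auto
  then have 2: "exp (lam n * t) - 1 \<le> exp (lam n * t) * (lam n * t)"
    by (simp add: right_diff_distrib exp_minus_inverse)
  have "exp (lam n * t) * (lam n * t) \<le> exp (lam n * t) * (\<bar>lam n\<bar> * t)"
    using t by (intro mult_left_mono mult_right_mono) auto
  also have "\<dots> \<le> exp \<bar>\<gamma>\<bar> * (\<bar>lam n\<bar> * t)"
    using g t by (intro mult_right_mono) auto
  finally have "exp (lam n * t) * (lam n * t) \<le> exp \<bar>\<gamma>\<bar> * (\<bar>lam n\<bar> * t)" .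
  moreover have "\<bar>lam n\<bar> * t \<le> exp \<bar>\<gamma>\<bar> * (\<bar>lam n\<bar> * t)"
    using t mult_right_mono[of 1 "exp \<bar>\<gamma>\<bar>" "\<bar>lam n\<bar> * t"] by simp
  moreover have "- (\<bar>lam n\<bar> * t) \<le> lam n * t"
    using t mult_right_mono[of "- \<bar>lam n\<bar>" "lam n" t] by simp
  ultimately have "\<bar>exp (lam n * t) - 1\<bar> \<le> exp \<bar>\<gamma>\<bar> * (\<bar>lam n\<bar> * t)"
    using 1 2 by linarith
  then show ?thesis using t by (simp add: abs_divide pos_divide_le_eq mult_ac)
qed

lemma infinitesimal_generator_A: "infinitesimal_generator S ip T D A"
proof -
  have conv: "ip_lim ip (\<lambda>h. (T h f - f) /\<^sub>R h) (A f) (at_right 0)" if f: "f \<in> D" for f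
  proof (rule ip_lim_coeffI[where g="\<lambda>n. (exp \<bar>\<gamma>\<bar> + 1)\<^sup>2 * ((lam n)\<^sup>2 * (ip f (e n))\<^sup>2)"])
    show "\<forall>\<^sub>F h in at_right 0. (T h f - f) /\<^sub>R h \<in> S"
      using D_S[OF f] quot_in by (intro eventually_mono[OF eventually_at_right_less]) auto
    show "A f \<in> S" using f by (rule A_in)
    show "summable (\<lambda>n. (exp \<bar>\<gamma>\<bar> + 1)\<^sup>2 * ((lam n)\<^sup>2 * (ip f (e n))\<^sup>2))"
      using f by (intro summable_mult) (auto simp: diag_dom_def)
    have "\<forall>\<^sub>F t in at_right 0. t \<in> {0<..<(1::real)}" by (rule eventually_at_right_real) simp
    then show "\<forall>\<^sub>F h in at_right 0. \<forall>n. (ip ((T h f - f) /\<^sub>R h) (e n) - ip (A f) (e n))\<^sup>2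
        \<le> (exp \<bar>\<gamma>\<bar> + 1)\<^sup>2 * ((lam n)\<^sup>2 * (ip f (e n))\<^sup>2)"
    proof eventually_elim
      case (elim t)
      show ?case
      proof
        fix n
        have "\<bar>(exp (lam n * t) - 1) / t - lam n\<bar> \<le> (exp \<bar>\<gamma>\<bar> + 1) * \<bar>lam n\<bar>"
        proof -
          have "\<bar>(exp (lam n * t) - 1) / t - lam n\<bar> \<le> \<bar>(exp (lam n * t) - 1) / t\<bar> + \<bar>lam n\<bar>"
            by (rule abs_triangle_ineq4)
          also have "\<dots> \<le> \<bar>lam n\<bar> * exp \<bar>\<gamma>\<bar> + \<bar>lam n\<bar>"
            using exp_quot_bound[of t n] elim by simp
          finally show ?thesis by (simp add: distrib_right mult.commute[of "exp \<bar>\<gamma>\<bar>"])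
        qed
        then have "((exp (lam n * t) - 1) / t - lam n)\<^sup>2 \<le> ((exp \<bar>\<gamma>\<bar> + 1) * \<bar>lam n\<bar>)\<^sup>2"
          using power_mono[of "\<bar>(exp (lam n * t) - 1) / t - lam n\<bar>" "(exp \<bar>\<gamma>\<bar> + 1) * \<bar>lam n\<bar>" 2] by simp
        then have "((exp (lam n * t) - 1) / t - lam n)\<^sup>2 * (ip f (e n))\<^sup>2
            \<le> ((exp \<bar>\<gamma>\<bar> + 1) * \<bar>lam n\<bar>)\<^sup>2 * (ip f (e n))\<^sup>2"
          by (rule mult_right_mono) simp
        moreover have "ip ((T t f - f) /\<^sub>R t) (e n) - ip (A f) (e n)
            = ((exp (lam n * t) - 1) / t - lam n) * ip f (e n)"
          using elim D_S[OF f] by (simp only: quot_coeff A_coeff[OF f] left_diff_distrib greaterThanLessThan_iff)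
        ultimately show "(ip ((T t f - f) /\<^sub>R t) (e n) - ip (A f) (e n))\<^sup>2
            \<le> (exp \<bar>\<gamma>\<bar> + 1)\<^sup>2 * ((lam n)\<^sup>2 * (ip f (e n))\<^sup>2)"
          by (simp add: power_mult_distrib)
      qed
    qed
    show "((\<lambda>h. ip ((T h f - f) /\<^sub>R h) (e n)) \<longlongrightarrow> ip (A f) (e n)) (at_right 0)" for n
      using quot_coeff_lim[OF D_S[OF f], of n] by (simp only: A_coeff[OF f])
  qed
  \<comment> \<open>Maximality of the domain: the coefficients of any limit \<open>g\<close> of the
    quotients are the limits of the scalar quotients, hence equal
    \<open>lam n * ip f (e n)\<close>.\<close>
  have "f \<in> D" if f: "f \<in> S" and g: "g \<in> S" and l: "ip_lim ip (\<lambda>h. (T h f - f) /\<^sub>R h) g (at_right 0)" for f g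
  proof (rule D_I[OF f g])
    fix n
    have "((\<lambda>h. ip ((T h f - f) /\<^sub>R h) (e n)) \<longlongrightarrow> ip g (e n)) (at_right 0)"
      using f g quot_in by (intro ip_lim_ip[OF l] eventually_mono[OF eventually_at_right_less]) auto
    then show "ip g (e n) = lam n * ip f (e n)"
      using quot_coeff_lim[OF f] by (intro tendsto_unique[OF trivial_limit_at_right_real])
  qed
  then show ?thesis
    unfolding infinitesimal_generator_def using conv A_in D_S by blast
qed

end

section \<open>The domain of a diagonal operator bounded below, as a Hilbert space\<close>

locale power_space = onb S ip e
  for S :: "'v::real_vector set" and ip :: "'v \<Rightarrow> 'v \<Rightarrow> real" and e :: "nat \<Rightarrow> 'v" +
  fixes w :: "nat \<Rightarrow> real" and \<delta> :: real
  assumes delta: "\<delta> > 0" and w_ge: "\<delta> \<le> w n"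
begin

abbreviation "Sw \<equiv> diag_dom S ip e w"
abbreviation "W \<equiv> diag_op S ip e w"
abbreviation "ipw \<equiv> power_inner S ip e w"

lemma w_pos [simp]: "w n > 0" using delta w_ge[of n] by linarith

lemma w_nz [simp]: "w n \<noteq> 0" using w_pos[of n] by linarith

lemma Sw_S: "f \<in> Sw \<Longrightarrow> f \<in> S" by (simp add: diag_dom_def)

lemmas Sw_subspace = subspace_diag_dom[of w]

lemma W_add: "f \<in> Sw \<Longrightarrow> g \<in> Sw \<Longrightarrow> W (f + g) = W f + W g"
  using linear_on_set_diag_op[of w] unfolding linear_on_set_def by blast

lemma W_scale: "f \<in> Sw \<Longrightarrow> W (r *\<^sub>R f) = r *\<^sub>R W f"
  using linear_on_set_diag_op[of w] unfolding linear_on_set_def by blast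

lemma W_diff: "f \<in> Sw \<Longrightarrow> g \<in> Sw \<Longrightarrow> W (f - g) = W f - W g"
  using W_add[of f "-1 *\<^sub>R g"] W_scale[of g "-1"] subspace_scale[OF Sw_subspace, of g "-1"] by simp

lemma W_sum:
  "finite I \<Longrightarrow> (\<And>i. i \<in> I \<Longrightarrow> u i \<in> Sw) \<Longrightarrow> W (\<Sum>i\<in>I. u i) = (\<Sum>i\<in>I. W (u i))"
proof (induction I rule: finite_induct)
  case empty
  show ?case using W_scale[of 0 0] subspace_0[OF Sw_subspace] by simp
next
  case (insert i I)
  then show ?case using subspace_sum[OF Sw_subspace, of I u] by (simp add: W_add)
qed

lemma W_in: "f \<in> Sw \<Longrightarrow> W f \<in> S"
  by (rule diag_op_props)

lemma W_e: "W (e n) = w n *\<^sub>R e n"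
  by (rule coeff_eqI) (auto simp: diag_op_props ip_scale_left)

text \<open>As the weights stay above \<open>\<delta>\<close>, their reciprocals are bounded, so the
  inverse multiplier is defined on all of \<open>S\<close> and takes its values in
  \<open>Sw\<close>.\<close>

lemma W_surj:
  assumes v: "v \<in> S"
  shows "\<exists>u\<in>Sw. W u = v"
proof -
  have "\<bar>1 / w n\<bar> \<le> 1 / \<delta>" for n
    using w_ge[of n] w_pos[of n] delta by (simp add: frac_le)
  then have dom: "v \<in> diag_dom S ip e (\<lambda>n. 1 / w n)"
    using bounded_diag_dom[of "\<lambda>n. 1 / w n"] v by blast
  define u where "u = diag_op S ip e (\<lambda>n. 1 / w n) v"
  have u: "u \<in> S" "\<And>n. ip u (e n) = 1 / w n * ip v (e n)"
    unfolding u_def by (rule diag_op_props[OF dom])+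
  have "(\<lambda>n. (w n)\<^sup>2 * (ip u (e n))\<^sup>2) = (\<lambda>n. (ip v (e n))\<^sup>2)"
    by (simp add: u power_mult_distrib power_divide)
  then have uw: "u \<in> Sw" using u(1) summable_coeff[OF v] by (simp add: diag_dom_def)
  have "ip (W u) (e n) = ip v (e n)" for n
    by (simp add: diag_op_props(2)[OF uw] u(2))
  then have "W u = v" by (intro coeff_eqI W_in uw v)
  with uw show ?thesis by blast
qed

lemma ipw_norm: "ip_norm ipw f = nrm (W f)"
  by (simp add: ip_norm_def power_inner_def)

text \<open>\<open>W\<close> preserves norms by the definition of \<open>ipw\<close> and maps onto
  \<open>S\<close>: a Cauchy sequence is sent to \<open>S\<close>, completed there and pulled back.
  Definiteness holds because no weight is zero.\<close>

lemma hilbert_Sw: "hilbert_space Sw ipw"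
  unfolding hilbert_space_def
proof (intro conjI ballI allI impI)
  show "subspace Sw" by (rule Sw_subspace)
next
  fix x y assume "x \<in> Sw" "y \<in> Sw"
  then show "ipw x y = ipw y x" unfolding power_inner_def by (intro ip_commute W_in)
next
  fix x y z assume "x \<in> Sw" "y \<in> Sw" "z \<in> Sw"
  then show "ipw (x + y) z = ipw x z + ipw y z"
    by (simp add: power_inner_def W_add ip_add_left W_in)
next
  fix c x y assume "x \<in> Sw" "y \<in> Sw"
  then show "ipw (c *\<^sub>R x) y = c * ipw x y"
    by (simp add: power_inner_def W_scale ip_scale_left W_in)
next
  fix x assume x: "x \<in> Sw" "x \<noteq> 0"
  then obtain n where "ip x (e n) \<noteq> 0" using coeff_eqI[of x 0] Sw_S[of x] by auto
  then have "ip (W x) (e n) \<noteq> 0" using x by (simp add: diag_op_props)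
  then have "W x \<noteq> 0" by auto
  then show "0 < ipw x x" unfolding power_inner_def using x by (intro ip_pos W_in)
next
  fix u :: "nat \<Rightarrow> 'v"
  assume u: "\<forall>n. u n \<in> Sw" and C: "\<forall>e>0. \<exists>N. \<forall>m\<ge>N. \<forall>n\<ge>N. ip_norm ipw (u m - u n) < e"
  then have "\<exists>v\<in>S. ip_lim ip (\<lambda>n. W (u n)) v sequentially"
    by (intro complete) (simp_all add: W_in ipw_norm W_diff)
  then obtain v where v: "v \<in> S" "ip_lim ip (\<lambda>n. W (u n)) v sequentially" by blast
  from W_surj[OF v(1)] obtain x where x: "x \<in> Sw" "W x = v" by blast
  have "ip_lim ipw u x sequentially"
    using v(2) x u by (simp add: ip_lim_def ipw_norm W_diff)
  then show "\<exists>x\<in>Sw. ip_lim ipw u x sequentially" using x by blast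
qed

text \<open>\<open>W\<close> sends the rescaled vectors to the \<open>e n\<close>, so orthonormality
  is immediate, and density is that of the Fourier partial sums of \<open>W x\<close>, pulled back
  through \<open>W\<close>.\<close>

lemma basis_Sw: "orthonormal_basis Sw ipw (\<lambda>n. (1 / w n) *\<^sub>R e n)"
proof -
  let ?e = "\<lambda>n. (1 / w n) *\<^sub>R e n"
  have e: "?e n \<in> Sw" for n by (rule subspace_scale[OF Sw_subspace]) simp
  have We: "W (?e n) = e n" for n
    by (simp add: W_scale W_e)
  have "\<exists>y\<in>span (range ?e). ip_norm ipw (x - y) < r" if x: "x \<in> Sw" and r: "r > 0" for x r
  proof -
    have "eventually (\<lambda>N. nrm ((\<Sum>n<N. ip (W x) (e n) *\<^sub>R e n) - W x) < r) sequentially"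
      using partial_sums_lim[OF W_in[OF x]] r unfolding ip_lim_def by (rule order_tendstoD)
    then obtain N where N: "nrm ((\<Sum>n<N. ip (W x) (e n) *\<^sub>R e n) - W x) < r"
      by (auto simp: eventually_sequentially)
    let ?y = "\<Sum>n<N. ip (W x) (e n) *\<^sub>R ?e n"
    have y: "?y \<in> Sw" by (intro subspace_sum[OF Sw_subspace] subspace_scale[OF Sw_subspace] e)
    have "W ?y = (\<Sum>n<N. ip (W x) (e n) *\<^sub>R e n)"
      by (subst W_sum) (auto simp only: W_scale e We finite_lessThan intro!: subspace_scale[OF Sw_subspace] e)
    then have "ip_norm ipw (x - ?y) < r"
      using N x y by (simp add: ipw_norm W_diff W_in nrm_minus_commute[of "W x"])
    moreover have "?y \<in> span (range ?e)" by (intro span_sum span_scale span_base) simp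
    ultimately show ?thesis by blast
  qed
  moreover have "ipw (?e m) (?e n) = (if m = n then 1 else 0)" for m n
    by (simp only: power_inner_def We ip_e)
  ultimately show ?thesis
    using e unfolding orthonormal_basis_def dense_span_def by blast
qed

text \<open>Each argument of \<open>ipw\<close> contributes one factor \<open>w n\<close>, and the
  normalization of the basis vector cancels one of the two.\<close>

lemma ipw_coeff:
  assumes "f \<in> Sw"
  shows "ipw f ((1 / w n) *\<^sub>R e n) = w n * ip f (e n)"
  using assms by (simp add: power_inner_def W_scale W_e diag_op_props ip_scale_right W_in)

end

section \<open>Representatives of square integrable functions\<close>

lemma aefun_rep:
  obtains u where "u \<in> borel_measurable borel" "f = aeclass u"
proof -
  have "\<forall>f. \<exists>u. u \<in> borel_measurable borel \<and> f = aeclass u"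
    by transfer auto
  then show ?thesis using that by blast
qed

lemma aeclass_eq_iff:
  "u \<in> borel_measurable borel \<Longrightarrow> v \<in> borel_measurable borel \<Longrightarrow>
    aeclass u = aeclass v \<longleftrightarrow> (AE x in lborel. u x = v x)"
  by transfer auto

lemma aeclass_eqI: "(\<And>x. u x = v x) \<Longrightarrow> aeclass u = aeclass v"
  by (rule arg_cong[where f=aeclass]) auto

lemma aeclass_0: "aeclass (\<lambda>x. 0) = 0"
  by transfer auto

lemma aeclass_add:
  "u \<in> borel_measurable borel \<Longrightarrow> v \<in> borel_measurable borel \<Longrightarrow>
    aeclass u + aeclass v = aeclass (\<lambda>x. u x + v x)"
  by transfer auto

lemma aeclass_diff:
  "u \<in> borel_measurable borel \<Longrightarrow> v \<in> borel_measurable borel \<Longrightarrow>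
    aeclass u - aeclass v = aeclass (\<lambda>x. u x - v x)"
  by transfer auto

lemma aeclass_mult:
  "u \<in> borel_measurable borel \<Longrightarrow> v \<in> borel_measurable borel \<Longrightarrow>
    aeclass u * aeclass v = aeclass (\<lambda>x. u x * v x)"
  by transfer auto

lemma aeclass_scale: "u \<in> borel_measurable borel \<Longrightarrow> c *\<^sub>R aeclass u = aeclass (\<lambda>x. c * u x)"
  by transfer auto

lemma aefun_integral_aeclass:
  "u \<in> borel_measurable borel \<Longrightarrow> aefun_integral (aeclass u) = (\<integral>x. u x \<partial>lborel)"
  by transfer auto

lemma aefun_integrable_aeclass:
  "u \<in> borel_measurable borel \<Longrightarrow> aefun_integrable (aeclass u) \<longleftrightarrow> integrable lborel u"
  by transfer auto

text \<open>A representative that vanishes outside \<open>{a..b}\<close> at every point and not just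
  almost everywhere, so that membership in \<open>L2 a b\<close> can be handled pointwise.\<close>

definition sq_on :: "real \<Rightarrow> real \<Rightarrow> (real \<Rightarrow> real) \<Rightarrow> bool" where
  "sq_on a b u \<longleftrightarrow> u \<in> borel_measurable borel \<and> (\<forall>x. x \<notin> {a..b} \<longrightarrow> u x = 0) \<and>
     integrable lborel (\<lambda>x. (u x)\<^sup>2)"

lemma sq_on_measurable [measurable_dest]: "sq_on a b u \<Longrightarrow> u \<in> borel_measurable borel"
  by (simp add: sq_on_def)

lemma sq_on_outside: "sq_on a b u \<Longrightarrow> x \<notin> {a..b} \<Longrightarrow> u x = 0"
  by (simp add: sq_on_def)

lemma sq_on_indicator: "sq_on a b u \<Longrightarrow> indicator {a..b} x * u x = u x"
  by (auto simp: sq_on_def indicator_def)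

lemma sq_on_integrable_square: "sq_on a b u \<Longrightarrow> integrable lborel (\<lambda>x. (u x)\<^sup>2)"
  by (simp add: sq_on_def)

lemma sq_on_integrable_mult:
  assumes "sq_on a b u" "sq_on a b v"
  shows "integrable lborel (\<lambda>x. u x * v x)"
proof (rule Bochner_Integration.integrable_bound[of lborel "\<lambda>x. (u x)\<^sup>2 + (v x)\<^sup>2"])
  note [measurable] = assms[THEN sq_on_measurable]
  show "integrable lborel (\<lambda>x. (u x)\<^sup>2 + (v x)\<^sup>2)"
    using assms by (intro Bochner_Integration.integrable_add sq_on_integrable_square)
  show "(\<lambda>x. u x * v x) \<in> borel_measurable lborel" by measurable
  have "\<bar>s * t\<bar> \<le> s\<^sup>2 + t\<^sup>2" for s t :: real
  proof -
    have "2 * (\<bar>s\<bar> * \<bar>t\<bar>) \<le> s\<^sup>2 + t\<^sup>2" "0 \<le> \<bar>s\<bar> * \<bar>t\<bar>"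
      using sum_squares_bound[of "\<bar>s\<bar>" "\<bar>t\<bar>"] by simp_all
    then show ?thesis unfolding abs_mult by linarith
  qed
  then show "AE x in lborel. norm (u x * v x) \<le> norm ((u x)\<^sup>2 + (v x)\<^sup>2)" by simp
qed

lemma sq_on_bounded:
  assumes "k \<in> borel_measurable borel" "\<And>x. x \<in> {a..b} \<Longrightarrow> \<bar>k x\<bar> \<le> C"
    and "\<And>x. x \<notin> {a..b} \<Longrightarrow> k x = 0"
  shows "sq_on a b k"
proof -
  note [measurable] = assms(1)
  have "integrable lborel (\<lambda>x. (k x)\<^sup>2)"
  proof (rule Bochner_Integration.integrable_bound[of lborel "\<lambda>x. C\<^sup>2 * indicator {a..b} x"])
    show "integrable lborel (\<lambda>x. C\<^sup>2 * indicator {a..b} x)"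
      by (intro integrable_mult_right integrable_real_indicator) (auto simp: emeasure_lborel_Icc_eq)
    show "AE x in lborel. norm ((k x)\<^sup>2) \<le> norm (C\<^sup>2 * indicator {a..b} x)"
    proof (rule AE_I2)
      fix x
      show "norm ((k x)\<^sup>2) \<le> norm (C\<^sup>2 * indicator {a..b} x)"
        using power_mono[OF assms(2)[of x], of 2] assms(3)[of x] by (cases "x \<in> {a..b}") auto
    qed
  qed measurable
  then show ?thesis using assms by (simp add: sq_on_def)
qed

lemma sq_on_indicator_Icc: "sq_on a b (indicator {a..b})"
  by (rule sq_on_bounded[where C=1]) (auto simp: indicator_def)

lemma sq_on_integrable: "sq_on a b u \<Longrightarrow> integrable lborel u"
  using sq_on_integrable_mult[OF sq_on_indicator_Icc, of a b u] by (simp add: sq_on_indicator)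

lemma sq_on_bounded_mult:
  assumes "k \<in> borel_measurable borel" "\<And>x. x \<in> {a..b} \<Longrightarrow> \<bar>k x\<bar> \<le> C" "sq_on a b u"
  shows "sq_on a b (\<lambda>x. k x * u x)"
proof -
  note [measurable] = assms(1) sq_on_measurable[OF assms(3)]
  have "integrable lborel (\<lambda>x. (k x * u x)\<^sup>2)"
  proof (rule Bochner_Integration.integrable_bound[of lborel "\<lambda>x. C\<^sup>2 * (u x)\<^sup>2"])
    show "integrable lborel (\<lambda>x. C\<^sup>2 * (u x)\<^sup>2)"
      by (intro integrable_mult_right sq_on_integrable_square[OF assms(3)])
    show "AE x in lborel. norm ((k x * u x)\<^sup>2) \<le> norm (C\<^sup>2 * (u x)\<^sup>2)"
    proof (rule AE_I2)
      fix x
      show "norm ((k x * u x)\<^sup>2) \<le> norm (C\<^sup>2 * (u x)\<^sup>2)"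
        using power_mono[OF assms(2)[of x], of 2] sq_on_outside[OF assms(3), of x]
        by (cases "x \<in> {a..b}") (auto simp: power_mult_distrib mult_right_mono)
    qed
  qed measurable
  then show ?thesis using assms(3) by (auto simp: sq_on_def)
qed

lemma sq_on_scale: "sq_on a b u \<Longrightarrow> sq_on a b (\<lambda>x. c * u x)"
  by (rule sq_on_bounded_mult[where C="\<bar>c\<bar>"]) auto

lemma sq_on_add:
  assumes "sq_on a b u" "sq_on a b v"
  shows "sq_on a b (\<lambda>x. u x + v x)"
proof -
  have "integrable lborel (\<lambda>x. (u x)\<^sup>2 + (v x)\<^sup>2 + 2 * (u x * v x))"
    using assms by (intro Bochner_Integration.integrable_add sq_on_integrable_square
        sq_on_integrable_mult integrable_mult_right)
  moreover have "(\<lambda>x. (u x + v x)\<^sup>2) = (\<lambda>x. (u x)\<^sup>2 + (v x)\<^sup>2 + 2 * (u x * v x))"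
    by (auto simp: power2_sum)
  ultimately show ?thesis using assms by (auto simp: sq_on_def)
qed

lemma sq_on_diff: "sq_on a b u \<Longrightarrow> sq_on a b v \<Longrightarrow> sq_on a b (\<lambda>x. u x - v x)"
  using sq_on_add[OF _ sq_on_scale[of a b v "-1"], of u] by simp

lemma measurable_on_indicator:
  "continuous_on {a..b} k \<Longrightarrow> (\<lambda>x. indicator {a..b} x * k x) \<in> borel_measurable borel" for k :: "real \<Rightarrow> real"
  using borel_measurable_continuous_on_indicator[of "{a..b}" k] by simp

lemma continuous_bounded_on:
  fixes k :: "real \<Rightarrow> real"
  assumes "continuous_on {a..b} k"
  shows "\<exists>C. \<forall>x\<in>{a..b}. \<bar>k x\<bar> \<le> C"
  using compact_imp_bounded[OF compact_continuous_image[OF assms compact_Icc]]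
  by (auto simp: bounded_iff)

lemma sq_on_continuous:
  assumes "continuous_on {a..b} k"
  shows "sq_on a b (\<lambda>x. indicator {a..b} x * k x)"
proof -
  obtain C where "\<forall>x\<in>{a..b}. \<bar>k x\<bar> \<le> C" using continuous_bounded_on[OF assms] by blast
  then show ?thesis
    by (intro sq_on_bounded[where C=C] measurable_on_indicator assms) auto
qed

lemma L2_aeclass:
  assumes u: "sq_on a b u"
  shows "aeclass u \<in> L2 a b"
proof -
  note [measurable] = sq_on_measurable[OF u]
  have "aeclass_on a b (\<lambda>_. 1) * aeclass u = aeclass u"
    unfolding aeclass_on_def by (subst aeclass_mult) (auto simp: sq_on_indicator[OF u])
  then show ?thesis using sq_on_integrable_square[OF u]
    by (simp add: L2_def aeclass_mult aefun_integrable_aeclass power2_eq_square)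
qed

text \<open>Membership in \<open>L2 a b\<close> says that the class is unchanged by the indicator of
  \<open>{a..b}\<close>; the product of any representative with this indicator is therefore still a
  representative, and it vanishes exactly outside.\<close>

lemma L2_rep:
  assumes "f \<in> L2 a b"
  obtains u where "sq_on a b u" "f = aeclass u"
proof -
  obtain v where v[measurable]: "v \<in> borel_measurable borel" and f: "f = aeclass v"
    by (rule aefun_rep)
  let ?u = "\<lambda>x. indicator {a..b} x * v x"
  have "f = aeclass ?u"
    using assms f by (simp add: L2_def aeclass_on_def aeclass_mult)
  moreover from this assms have "integrable lborel (\<lambda>x. ?u x * ?u x)"
    by (simp add: L2_def aeclass_mult aefun_integrable_aeclass)
  then have "sq_on a b ?u" by (simp add: sq_on_def power2_eq_square)
  ultimately show ?thesis using that by blast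
qed

lemma aeclass_on_in_L2:
  "continuous_on {a..b} k \<Longrightarrow> aeclass_on a b k \<in> L2 a b"
  unfolding aeclass_on_def by (intro L2_aeclass sq_on_continuous)

lemma subspace_L2: "subspace (L2 a b)"
proof (rule subspaceI)
  have "sq_on a b (\<lambda>x. 0)" by (simp add: sq_on_def)
  from L2_aeclass[OF this] show "0 \<in> L2 a b" by (simp add: aeclass_0)
next
  fix f g assume "f \<in> L2 a b" "g \<in> L2 a b"
  then obtain u v where "sq_on a b u" "f = aeclass u" "sq_on a b v" "g = aeclass v"
    by (metis L2_rep)
  then show "f + g \<in> L2 a b"
    using L2_aeclass[OF sq_on_add[of a b u v]] by (simp add: aeclass_add sq_on_measurable)
next
  fix c f assume "f \<in> L2 a b"
  then obtain u where "sq_on a b u" "f = aeclass u" by (metis L2_rep)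
  then show "c *\<^sub>R f \<in> L2 a b"
    using L2_aeclass[OF sq_on_scale[of a b u c]] by (simp add: aeclass_scale sq_on_measurable)
qed

text \<open>The increments have summable L1 norms, so by monotone convergence the series of their
  absolute values has a finite integral and is finite almost everywhere; the telescoping series then
  converges absolutely.\<close>

lemma Cauchy_subseq_AE_convergent:
  fixes u :: "nat \<Rightarrow> real \<Rightarrow> real"
  assumes int: "\<And>n. integrable lborel (u n)"
    and small: "\<And>n. (\<integral>x. \<bar>u (Suc n) x - u n x\<bar> \<partial>lborel) \<le> (1/2) ^ n"
  shows "AE x in lborel. convergent (\<lambda>n. u n x)"
proof -
  note [measurable] = borel_measurable_integrable[OF int]
  have "(\<integral>\<^sup>+x. (\<Sum>n. ennreal \<bar>u (Suc n) x - u n x\<bar>) \<partial>lborel)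
      = (\<Sum>n. \<integral>\<^sup>+x. ennreal \<bar>u (Suc n) x - u n x\<bar> \<partial>lborel)"
    by (rule nn_integral_suminf) measurable
  also have "\<dots> = (\<Sum>n. ennreal (\<integral>x. \<bar>u (Suc n) x - u n x\<bar> \<partial>lborel))"
    by (intro suminf_cong nn_integral_eq_integral integrable_abs Bochner_Integration.integrable_diff int) auto
  also have "\<dots> \<le> (\<Sum>n. ennreal ((1/2) ^ n))"
    by (intro suminf_le ennreal_leI small) auto
  also have "\<dots> = ennreal (\<Sum>n. (1/2) ^ n)"
    by (intro suminf_ennreal2) auto
  finally have "(\<integral>\<^sup>+x. (\<Sum>n. ennreal \<bar>u (Suc n) x - u n x\<bar>) \<partial>lborel) \<noteq> \<infinity>"
    by (auto simp: top_unique)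
  then have "AE x in lborel. (\<Sum>n. ennreal \<bar>u (Suc n) x - u n x\<bar>) \<noteq> \<infinity>"
    by (intro nn_integral_PInf_AE) measurable
  then show ?thesis
  proof eventually_elim
    case (elim x)
    then have "summable (\<lambda>n. \<bar>u (Suc n) x - u n x\<bar>)"
      by (intro summable_suminf_not_top) auto
    then have "summable (\<lambda>n. u (Suc n) x - u n x)" by (rule summable_rabs_cancel)
    then have "convergent (\<lambda>n. \<Sum>i<n. u (Suc i) x - u i x)" by (simp add: summable_iff_convergent)
    then show ?case
      using sum_lessThan_telescope[of "\<lambda>n. u n x"] convergent_diff_const_right_iff[of "\<lambda>n. u n x" "u 0 x"]
      by simp
  qed
qed

section \<open>Weighted square integrable functions as a Hilbert space\<close>

locale weighted_L2 =
  fixes a b :: real and \<rho> :: "real \<Rightarrow> real"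
  assumes ab: "a < b" and \<rho>_cont: "continuous_on {a..b} \<rho>"
    and \<rho>_pos: "x \<in> {a..b} \<Longrightarrow> \<rho> x > 0"
begin

abbreviation "ip \<equiv> L2_inner a b \<rho>"

lemma \<rho>_bounds: "\<exists>m M. m > 0 \<and> M > 0 \<and> (\<forall>x\<in>{a..b}. m \<le> \<rho> x \<and> \<rho> x \<le> M)"
proof -
  have ne: "{a..b} \<noteq> {}" using ab by auto
  obtain x where "x \<in> {a..b}" "\<forall>y\<in>{a..b}. \<rho> x \<le> \<rho> y"
    using continuous_attains_inf[OF compact_Icc ne \<rho>_cont] by blast
  moreover obtain y where "y \<in> {a..b}" "\<forall>z\<in>{a..b}. \<rho> z \<le> \<rho> y"
    using continuous_attains_sup[OF compact_Icc ne \<rho>_cont] by blast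
  ultimately show ?thesis using \<rho>_pos by (intro exI[of _ "\<rho> x"] exI[of _ "\<rho> y"]) auto
qed

definition "w x = indicator {a..b} x * \<rho> x"

lemma w_measurable [measurable]: "w \<in> borel_measurable borel"
  unfolding w_def[abs_def] by (rule measurable_on_indicator[OF \<rho>_cont])

lemma w_nonneg: "w x \<ge> 0" using \<rho>_pos[of x] by (auto simp: w_def indicator_def)

lemma sq_on_w_mult:
  assumes "sq_on a b u" shows "sq_on a b (\<lambda>x. w x * u x)"
proof -
  obtain M where "\<forall>x\<in>{a..b}. \<bar>\<rho> x\<bar> \<le> M" using continuous_bounded_on[OF \<rho>_cont] by blast
  then show ?thesis by (intro sq_on_bounded_mult[where C=M] assms w_measurable) (auto simp: w_def)
qed

lemma ip_aeclass:
  assumes "u \<in> borel_measurable borel" "v \<in> borel_measurable borel"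
  shows "ip (aeclass u) (aeclass v) = (\<integral>x. u x * v x * w x \<partial>lborel)"
proof -
  note [measurable] = assms
  have "aeclass u * aeclass v * aeclass_on a b \<rho> = aeclass (\<lambda>x. u x * v x * w x)"
    unfolding aeclass_on_def w_def[symmetric] by (simp add: aeclass_mult)
  then show ?thesis by (simp add: L2_inner_def aefun_integral_aeclass)
qed

lemma ip_integrable:
  assumes "sq_on a b u" "sq_on a b v"
  shows "integrable lborel (\<lambda>x. u x * v x * w x)"
  using sq_on_integrable_mult[OF assms(1) sq_on_w_mult[OF assms(2)]] by (simp add: mult_ac)

text \<open>\<open>\<rho>\<close> is continuous and positive on a compact interval, so it lies
  between two positive constants; together with the companion upper bound, the weighted norm is
  equivalent to the unweighted one.\<close>

lemma ip_lower_bound: "\<exists>m>0. \<forall>u. sq_on a b u \<longrightarrow> m * (\<integral>x. (u x)\<^sup>2 \<partial>lborel) \<le> ip (aeclass u) (aeclass u)"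
proof -
  obtain m where m: "m > 0" "\<forall>x\<in>{a..b}. m \<le> \<rho> x" using \<rho>_bounds by blast
  have "m * (\<integral>x. (u x)\<^sup>2 \<partial>lborel) \<le> ip (aeclass u) (aeclass u)" if u: "sq_on a b u" for u
  proof -
    have "m * (u x)\<^sup>2 \<le> u x * u x * w x" for x
    proof (cases "x \<in> {a..b}")
      case True
      then show ?thesis using m mult_right_mono[of m "\<rho> x" "(u x)\<^sup>2"] by (simp add: w_def power2_eq_square mult_ac)
    qed (simp add: sq_on_outside[OF u])
    then have "(\<integral>x. m * (u x)\<^sup>2 \<partial>lborel) \<le> (\<integral>x. u x * u x * w x \<partial>lborel)"
      by (intro integral_mono ip_integrable[OF u u] integrable_mult_right sq_on_integrable_square[OF u])
    then show ?thesis using sq_on_measurable[OF u] by (simp add: ip_aeclass)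
  qed
  then show ?thesis using m(1) by blast
qed

lemma ip_upper_bound: "\<exists>M>0. \<forall>u. sq_on a b u \<longrightarrow> ip (aeclass u) (aeclass u) \<le> M * (\<integral>x. (u x)\<^sup>2 \<partial>lborel)"
proof -
  obtain M where M: "M > 0" "\<forall>x\<in>{a..b}. \<rho> x \<le> M" using \<rho>_bounds by blast
  have "ip (aeclass u) (aeclass u) \<le> M * (\<integral>x. (u x)\<^sup>2 \<partial>lborel)" if u: "sq_on a b u" for u
  proof -
    have "u x * u x * w x \<le> M * (u x)\<^sup>2" for x
    proof (cases "x \<in> {a..b}")
      case True
      then show ?thesis using M mult_right_mono[of "\<rho> x" M "(u x)\<^sup>2"] by (simp add: w_def power2_eq_square mult_ac)
    qed (simp add: sq_on_outside[OF u])
    then have "(\<integral>x. u x * u x * w x \<partial>lborel) \<le> (\<integral>x. M * (u x)\<^sup>2 \<partial>lborel)"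
      by (intro integral_mono ip_integrable[OF u u] integrable_mult_right sq_on_integrable_square[OF u])
    then show ?thesis using sq_on_measurable[OF u] by (simp add: ip_aeclass)
  qed
  then show ?thesis using M(1) by blast
qed

text \<open>Cauchy-Schwarz against the constant 1. It is proved by hand because completeness of
  \<open>L2 a b\<close> rests on it, and the Hilbert space lemmas become available only after
  completeness.\<close>

lemma L1_le_L2:
  assumes u: "sq_on a b u"
  shows "(\<integral>x. \<bar>u x\<bar> \<partial>lborel) \<le> sqrt (b - a) * sqrt (\<integral>x. (u x)\<^sup>2 \<partial>lborel)"
proof (cases "(\<integral>x. (u x)\<^sup>2 \<partial>lborel) = 0")
  case True
  then have "AE x in lborel. (u x)\<^sup>2 = 0"
    using sq_on_integrable_square[OF u] by (subst (asm) integral_nonneg_eq_0_iff_AE) auto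
  then have "AE x in lborel. \<bar>u x\<bar> = 0" by auto
  then have "(\<integral>x. \<bar>u x\<bar> \<partial>lborel) = 0" by (rule integral_eq_zero_AE)
  then show ?thesis using True by simp
next
  case False
  define N where "N = sqrt (\<integral>x. (u x)\<^sup>2 \<partial>lborel)"
  have N: "N > 0" "N * N = (\<integral>x. (u x)\<^sup>2 \<partial>lborel)"
    using False integral_nonneg_AE[where M=lborel and f="\<lambda>x. (u x)\<^sup>2"] by (auto simp: N_def less_le)
  define L where "L = sqrt (b - a)"
  have L: "L > 0" "L * L = b - a" using ab by (auto simp: L_def)
  \<comment> \<open>AM-GM with weights chosen so that both terms integrate to \<open>L * N / 2\<close>\<close>
  have "(\<integral>x. \<bar>u x\<bar> \<partial>lborel) \<le> (\<integral>x. (L / (2 * N)) * (u x)\<^sup>2 + (N / (2 * L)) * indicator {a..b} x \<partial>lborel)"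
  proof (rule integral_mono)
    show "integrable lborel (\<lambda>x. \<bar>u x\<bar>)" using sq_on_integrable[OF u] by (rule integrable_abs)
    show "integrable lborel (\<lambda>x. (L / (2 * N)) * (u x)\<^sup>2 + (N / (2 * L)) * indicator {a..b} x)"
      by (intro Bochner_Integration.integrable_add integrable_mult_right sq_on_integrable_square[OF u]
          integrable_real_indicator) (auto simp: emeasure_lborel_Icc_eq)
    fix x
    show "\<bar>u x\<bar> \<le> (L / (2 * N)) * (u x)\<^sup>2 + (N / (2 * L)) * indicator {a..b} x"
    proof (cases "x \<in> {a..b}")
      case True
      have "0 \<le> (L * \<bar>u x\<bar> - N)\<^sup>2" by simp
      then have "2 * (L * \<bar>u x\<bar> * N) \<le> (L * \<bar>u x\<bar>)\<^sup>2 + N\<^sup>2" by (simp add: power2_diff)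
      moreover have "((L / (2 * N)) * (u x)\<^sup>2 + N / (2 * L)) * (2 * L * N) = (L * \<bar>u x\<bar>)\<^sup>2 + N\<^sup>2"
        using L(1) N(1) by (simp add: field_simps power2_eq_square)
      ultimately have "\<bar>u x\<bar> * (2 * L * N) \<le> ((L / (2 * N)) * (u x)\<^sup>2 + N / (2 * L)) * (2 * L * N)"
        by (simp only: mult_ac)
      then have "\<bar>u x\<bar> \<le> (L / (2 * N)) * (u x)\<^sup>2 + N / (2 * L)"
        using L N by (subst (asm) mult_le_cancel_right) auto
      then show ?thesis using True by simp
    qed (simp add: sq_on_outside[OF u])
  qed
  also have "\<dots> = (L / (2 * N)) * (N * N) + (N / (2 * L)) * (L * L)"
    using sq_on_integrable_square[OF u] ab unfolding N(2) L(2)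
    by (subst Bochner_Integration.integral_add) auto
  also have "\<dots> = L * N" using L N by (simp add: field_simps)
  finally show ?thesis by (simp add: N_def L_def)
qed

text \<open>For completeness, a subsequence that converges fast in L1 converges almost everywhere,
  and Fatou's lemma transfers the L2 Cauchy estimate to the pointwise limit. Unweighted integrals
  suffice by the equivalence of norms.\<close>

lemma hilbert_L2: "hilbert_space (L2 a b) ip"
  unfolding hilbert_space_def
proof (intro conjI ballI allI impI)
  show "subspace (L2 a b)" by (rule subspace_L2)
next
  fix x y show "ip x y = ip y x" by (simp add: L2_inner_def mult.commute)
next
  fix x y z assume "x \<in> L2 a b" "y \<in> L2 a b" "z \<in> L2 a b"
  then obtain u v t where u: "sq_on a b u" "x = aeclass u" and v: "sq_on a b v" "y = aeclass v"
    and t: "sq_on a b t" "z = aeclass t"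
    by (metis L2_rep)
  note [measurable] = sq_on_measurable[OF u(1)] sq_on_measurable[OF v(1)] sq_on_measurable[OF t(1)]
  have "ip (x + y) z = (\<integral>x. u x * t x * w x + v x * t x * w x \<partial>lborel)"
    using u v t by (simp add: aeclass_add ip_aeclass algebra_simps)
  then show "ip (x + y) z = ip x z + ip y z"
    using u v t by (simp add: ip_aeclass ip_integrable)
next
  fix c x y assume "x \<in> L2 a b" "y \<in> L2 a b"
  then obtain u v where u: "sq_on a b u" "x = aeclass u" and v: "sq_on a b v" "y = aeclass v"
    by (metis L2_rep)
  note [measurable] = sq_on_measurable[OF u(1)] sq_on_measurable[OF v(1)]
  show "ip (c *\<^sub>R x) y = c * ip x y"
    using u v by (simp add: aeclass_scale ip_aeclass mult.assoc)
next
  fix x assume x: "x \<in> L2 a b" "x \<noteq> 0"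
  then obtain u where u: "sq_on a b u" "x = aeclass u" by (metis L2_rep)
  note [measurable] = sq_on_measurable[OF u(1)]
  obtain m where m: "m > 0" "m * (\<integral>x. (u x)\<^sup>2 \<partial>lborel) \<le> ip x x"
    using ip_lower_bound u by blast
  have "(\<integral>x. (u x)\<^sup>2 \<partial>lborel) \<noteq> 0"
  proof
    assume "(\<integral>x. (u x)\<^sup>2 \<partial>lborel) = 0"
    then have "AE x in lborel. (u x)\<^sup>2 = 0"
      using sq_on_integrable_square[OF u(1)] by (subst (asm) integral_nonneg_eq_0_iff_AE) auto
    then have "AE x in lborel. u x = 0" by auto
    then have "aeclass u = aeclass (\<lambda>x. 0)" by (subst aeclass_eq_iff) auto
    then show False using x u by (simp add: aeclass_0)
  qed
  then have "(\<integral>x. (u x)\<^sup>2 \<partial>lborel) > 0"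
    using integral_nonneg_AE[where M=lborel and f="\<lambda>x. (u x)\<^sup>2"] by (simp add: less_le)
  then have "m * (\<integral>x. (u x)\<^sup>2 \<partial>lborel) > 0" using m by simp
  then show "0 < ip x x" using m by linarith
next
  fix f :: "nat \<Rightarrow> aefun"
  assume f: "\<forall>n. f n \<in> L2 a b" and C: "\<forall>e>0. \<exists>N. \<forall>m\<ge>N. \<forall>n\<ge>N. ip_norm ip (f m - f n) < e"
  have "\<forall>n. \<exists>u. sq_on a b u \<and> f n = aeclass u" using f by (metis L2_rep)
  then obtain u where u: "\<And>n. sq_on a b (u n)" "\<And>n. f n = aeclass (u n)" by metis
  note [measurable] = sq_on_measurable[OF u(1)]
  have d: "sq_on a b (\<lambda>x. u m x - u n x)" for m n by (intro sq_on_diff u)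
  have fd: "f m - f n = aeclass (\<lambda>x. u m x - u n x)" for m n by (simp add: u aeclass_diff)
  obtain m0 where m0: "m0 > 0" "\<forall>u. sq_on a b u \<longrightarrow> m0 * (\<integral>x. (u x)\<^sup>2 \<partial>lborel) \<le> ip (aeclass u) (aeclass u)"
    using ip_lower_bound by blast
  have C2: "\<exists>N. \<forall>m\<ge>N. \<forall>n\<ge>N. (\<integral>x. (u m x - u n x)\<^sup>2 \<partial>lborel) \<le> e" if e: "e > 0" for e
  proof -
    have "sqrt (m0 * e) > 0" using e m0 by simp
    then obtain N where N: "\<And>m n. m\<ge>N \<Longrightarrow> n\<ge>N \<Longrightarrow> ip_norm ip (f m - f n) < sqrt (m0 * e)" using C by blast
    have "(\<integral>x. (u m x - u n x)\<^sup>2 \<partial>lborel) \<le> e" if "m \<ge> N" "n \<ge> N" for m n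
    proof -
      have "ip (f m - f n) (f m - f n) \<le> m0 * e"
        using N[OF that] by (simp add: ip_norm_def)
      moreover have "m0 * (\<integral>x. (u m x - u n x)\<^sup>2 \<partial>lborel) \<le> ip (f m - f n) (f m - f n)"
        using m0(2) d fd by metis
      ultimately have "m0 * (\<integral>x. (u m x - u n x)\<^sup>2 \<partial>lborel) \<le> m0 * e" by linarith
      then show ?thesis using m0 by simp
    qed
    then show ?thesis by blast
  qed
  have "\<exists>N. \<forall>m\<ge>N. \<forall>n\<ge>N. (\<integral>x. \<bar>u m x - u n x\<bar> \<partial>lborel) \<le> e" if e: "e > 0" for e
  proof -
    have "e\<^sup>2 / (b - a) > 0" using e ab by simp
    from C2[OF this] obtain N where N: "\<And>m n. m\<ge>N \<Longrightarrow> n\<ge>N \<Longrightarrow> (\<integral>x. (u m x - u n x)\<^sup>2 \<partial>lborel) \<le> e\<^sup>2 / (b - a)" by blast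
    have "(\<integral>x. \<bar>u m x - u n x\<bar> \<partial>lborel) \<le> e" if "m \<ge> N" "n \<ge> N" for m n
    proof -
      have "(\<integral>x. \<bar>u m x - u n x\<bar> \<partial>lborel) \<le> sqrt (b - a) * sqrt (\<integral>x. (u m x - u n x)\<^sup>2 \<partial>lborel)"
        by (rule L1_le_L2[OF d])
      also have "\<dots> \<le> sqrt (b - a) * sqrt (e\<^sup>2 / (b - a))"
        using N[OF that] ab by (intro mult_left_mono real_sqrt_le_mono) auto
      also have "\<dots> = e" using e ab by (simp add: real_sqrt_divide)
      finally show ?thesis .
    qed
    then show ?thesis by blast
  qed
  then have "\<forall>k. \<exists>N. \<forall>m\<ge>N. \<forall>n\<ge>N. (\<integral>x. \<bar>u m x - u n x\<bar> \<partial>lborel) \<le> (1/2) ^ k"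
    by (intro allI) simp
  then obtain N where N: "\<And>k m n. m \<ge> N k \<Longrightarrow> n \<ge> N k \<Longrightarrow> (\<integral>x. \<bar>u m x - u n x\<bar> \<partial>lborel) \<le> (1/2) ^ k"
    by metis
  \<comment> \<open>Summing all earlier thresholds makes \<open>r\<close> nondecreasing and at least
    \<open>N k\<close>; the extra \<open>k\<close> drives it to infinity.\<close>
  define r where "r k = (\<Sum>i\<le>k. N i) + k" for k
  have r_ge: "N k \<le> r k" "k \<le> r k" for k
    by (auto simp: r_def intro: trans_le_add1 member_le_sum)
  have r_mono: "r k \<le> r (Suc k)" for k by (simp add: r_def)
  have "AE x in lborel. convergent (\<lambda>k. u (r k) x)"
  proof (rule Cauchy_subseq_AE_convergent)
    show "integrable lborel (u (r n))" for n by (rule sq_on_integrable[OF u(1)])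
    show "(\<integral>x. \<bar>u (r (Suc n)) x - u (r n) x\<bar> \<partial>lborel) \<le> (1/2) ^ n" for n
      using r_ge(1)[of n] r_mono[of n] by (intro N) auto
  qed
  then have lim: "AE x in lborel. (\<lambda>k. u (r k) x) \<longlonglongrightarrow> lim (\<lambda>k. u (r k) x)"
    by eventually_elim (simp add: convergent_LIMSEQ_iff)
  \<comment> \<open>Where the subsequence diverges, \<open>lim\<close> is an arbitrary value, but
    this concerns a null set and \<open>v\<close> stays measurable; outside \<open>{a..b}\<close>
    all terms are zero, so \<open>v\<close> is too.\<close>
  define v where "v x = lim (\<lambda>k. u (r k) x)" for x
  have v_meas[measurable]: "v \<in> borel_measurable borel"
    unfolding v_def[abs_def] by measurable
  have v_out: "v x = 0" if "x \<notin> {a..b}" for x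
    using sq_on_outside[OF u(1) that] by (simp add: v_def)
  \<comment> \<open>Fatou along the subsequence: the hypothesis concerns large indices
    \<open>m\<close> only, and \<open>r k\<close> eventually passes \<open>M\<close>.\<close>
  have est: "(\<integral>\<^sup>+x. ennreal ((v x - u n x)\<^sup>2) \<partial>lborel) \<le> ennreal e"
    if e: "\<forall>m\<ge>M. (\<integral>x. (u m x - u n x)\<^sup>2 \<partial>lborel) \<le> e" for n e M
  proof -
    have "(\<integral>\<^sup>+x. ennreal ((v x - u n x)\<^sup>2) \<partial>lborel)
        = (\<integral>\<^sup>+x. liminf (\<lambda>k. ennreal ((u (r k) x - u n x)\<^sup>2)) \<partial>lborel)"
    proof (rule nn_integral_cong_AE)
      show "AE x in lborel. ennreal ((v x - u n x)\<^sup>2) = liminf (\<lambda>k. ennreal ((u (r k) x - u n x)\<^sup>2))"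
        using lim
      proof eventually_elim
        case (elim x)
        then have "(\<lambda>k. ennreal ((u (r k) x - u n x)\<^sup>2)) \<longlonglongrightarrow> ennreal ((v x - u n x)\<^sup>2)"
          unfolding v_def by (intro tendsto_intros)
        then show ?case by (intro lim_imp_Liminf[symmetric]) auto
      qed
    qed
    also have "\<dots> \<le> liminf (\<lambda>k. \<integral>\<^sup>+x. ennreal ((u (r k) x - u n x)\<^sup>2) \<partial>lborel)"
      by (rule nn_integral_liminf) measurable
    also have "\<dots> \<le> limsup (\<lambda>k. \<integral>\<^sup>+x. ennreal ((u (r k) x - u n x)\<^sup>2) \<partial>lborel)"
      by (rule Liminf_le_Limsup) simp
    also have "\<dots> \<le> ennreal e"
    proof (rule Limsup_bounded)
      show "\<forall>\<^sub>F k in sequentially. (\<integral>\<^sup>+x. ennreal ((u (r k) x - u n x)\<^sup>2) \<partial>lborel) \<le> ennreal e"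
        unfolding eventually_sequentially
      proof (intro exI[of _ M] allI impI)
        fix k assume "M \<le> k"
        then have "M \<le> r k" using r_ge(2)[of k] by linarith
        then show "(\<integral>\<^sup>+x. ennreal ((u (r k) x - u n x)\<^sup>2) \<partial>lborel) \<le> ennreal e"
          using e by (subst nn_integral_eq_integral) (auto intro: sq_on_integrable_square[OF d] ennreal_leI)
      qed
    qed
    finally show ?thesis .
  qed
  have vn: "sq_on a b (\<lambda>x. v x - u n x)" "(\<integral>x. (v x - u n x)\<^sup>2 \<partial>lborel) \<le> e"
    if e: "\<forall>m\<ge>M. (\<integral>x. (u m x - u n x)\<^sup>2 \<partial>lborel) \<le> e" and e0: "e \<ge> 0" for n e M
  proof -
    have fin: "(\<integral>\<^sup>+x. ennreal ((v x - u n x)\<^sup>2) \<partial>lborel) \<le> ennreal e" by (rule est[OF e])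
    then have int: "integrable lborel (\<lambda>x. (v x - u n x)\<^sup>2)"
      by (intro integrableI_nonneg) (auto simp: le_less_trans)
    show "sq_on a b (\<lambda>x. v x - u n x)"
      using int v_out sq_on_outside[OF u(1)] by (simp add: sq_on_def)
    show "(\<integral>x. (v x - u n x)\<^sup>2 \<partial>lborel) \<le> e"
      using fin e0 int by (subst (asm) nn_integral_eq_integral) auto
  qed
  have "sq_on a b v"
  proof -
    obtain M where M: "\<forall>m\<ge>M. \<forall>n\<ge>M. (\<integral>x. (u m x - u n x)\<^sup>2 \<partial>lborel) \<le> 1" using C2[of 1] by auto
    then have "sq_on a b (\<lambda>x. v x - u M x)" by (intro vn(1)[of M _ 1]) auto
    from sq_on_add[OF this u(1)[of M]] show ?thesis by simp
  qed
  then have "aeclass v \<in> L2 a b" by (rule L2_aeclass)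
  moreover have "ip_lim ip f (aeclass v) sequentially"
    unfolding ip_lim_def
  proof (rule LIMSEQ_I)
    fix e :: real assume e: "e > 0"
    obtain M0 where M0: "M0 > 0" "\<forall>u. sq_on a b u \<longrightarrow> ip (aeclass u) (aeclass u) \<le> M0 * (\<integral>x. (u x)\<^sup>2 \<partial>lborel)"
      using ip_upper_bound by blast
    define e' where "e' = (e/2)\<^sup>2 / M0"
    have e': "e' > 0" using e M0 by (simp add: e'_def)
    obtain M where M: "\<forall>m\<ge>M. \<forall>n\<ge>M. (\<integral>x. (u m x - u n x)\<^sup>2 \<partial>lborel) \<le> e'" using C2[OF e'] by blast
    have "norm (ip_norm ip (f n - aeclass v) - 0) < e" if n: "n \<ge> M" for n
    proof -
      have A: "\<forall>m\<ge>M. (\<integral>x. (u m x - u n x)\<^sup>2 \<partial>lborel) \<le> e'" using M n by blast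
      have s: "sq_on a b (\<lambda>x. u n x - v x)"
        using sq_on_scale[OF vn(1)[OF A], of "-1"] e' by simp
      have "(\<integral>x. (u n x - v x)\<^sup>2 \<partial>lborel) \<le> e'"
        using vn(2)[OF A] e' by (simp add: power2_commute)
      then have "M0 * (\<integral>x. (u n x - v x)\<^sup>2 \<partial>lborel) \<le> M0 * e'" using M0 by simp
      moreover have "f n - aeclass v = aeclass (\<lambda>x. u n x - v x)" by (simp add: u aeclass_diff)
      ultimately have le: "ip (f n - aeclass v) (f n - aeclass v) \<le> (e/2)\<^sup>2"
        using M0(2)[rule_format, OF s] M0(1) by (simp add: e'_def)
      have "0 \<le> ip (f n - aeclass v) (f n - aeclass v)"
        using m0(2)[rule_format, OF s] m0(1) integral_nonneg_AE[where M=lborel and f="\<lambda>x. (u n x - v x)\<^sup>2"]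
        unfolding \<open>f n - aeclass v = aeclass (\<lambda>x. u n x - v x)\<close>
        by (meson AE_I2 mult_nonneg_nonneg order.trans less_imp_le zero_le_power2)
      then have "\<bar>ip_norm ip (f n - aeclass v)\<bar> \<le> e/2"
        using real_sqrt_le_mono[OF le] e by (simp add: ip_norm_def)
      then show ?thesis using e by simp
    qed
    then show "\<exists>no. \<forall>n\<ge>no. norm (ip_norm ip (f n - aeclass v) - 0) < e" by blast
  qed
  ultimately show "\<exists>x\<in>L2 a b. ip_lim ip f x sequentially" by blast
qed

sublocale real_hilbert "L2 a b" ip
  by standard (rule hilbert_L2)

end

section \<open>Weak derivatives and primitives\<close>

text \<open>\<open>ennreal\<close> truncates negative values, so \<open>g\<close> and
  \<open>- g\<close> define the positive and the negative part as densities. The hypothesis says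
  that these two finite measures agree on all open half-lines; hence they coincide, and densities
  are unique almost everywhere.\<close>

lemma AE_zero_if_tail_integrals_zero:
  fixes g :: "real \<Rightarrow> real"
  assumes g: "integrable lborel g"
    and tail: "\<And>x. (\<integral>y. indicator {x<..} y * g y \<partial>lborel) = 0"
  shows "AE x in lborel. g x = 0"
proof -
  note [measurable] = borel_measurable_integrable[OF g]
  have int: "integrable lborel (\<lambda>y. indicator A y * max 0 (h y))"
    if "integrable lborel h" "A \<in> sets borel" for h :: "real \<Rightarrow> real" and A
    using that by (intro Bochner_Integration.integrable_bound[OF that(1)]) (auto simp: indicator_def)
  have em: "emeasure (density lborel (\<lambda>y. ennreal (h y))) {x<..}
      = ennreal (\<integral>y. indicator {x<..} y * max 0 (h y) \<partial>lborel)"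
    if h: "integrable lborel h" for h :: "real \<Rightarrow> real" and x
  proof -
    have "emeasure (density lborel (\<lambda>y. ennreal (h y))) {x<..} = (\<integral>\<^sup>+y. ennreal (h y) * indicator {x<..} y \<partial>lborel)"
      using borel_measurable_integrable[OF h] by (subst emeasure_density) auto
    also have "\<dots> = (\<integral>\<^sup>+y. ennreal (indicator {x<..} y * max 0 (h y)) \<partial>lborel)"
      by (intro nn_integral_cong) (auto simp: indicator_def max_def ennreal_neg)
    also have "\<dots> = ennreal (\<integral>y. indicator {x<..} y * max 0 (h y) \<partial>lborel)"
      by (intro nn_integral_eq_integral int h) (auto simp: indicator_def)
    finally show ?thesis .
  qed
  have g': "integrable lborel (\<lambda>y. - g y)" using g by simp
  have eq: "(\<integral>y. indicator {x<..} y * max 0 (g y) \<partial>lborel) = (\<integral>y. indicator {x<..} y * max 0 (- g y) \<partial>lborel)" for x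
  proof -
    have "(\<integral>y. indicator {x<..} y * max 0 (g y) \<partial>lborel) - (\<integral>y. indicator {x<..} y * max 0 (- g y) \<partial>lborel)
        = (\<integral>y. indicator {x<..} y * max 0 (g y) - indicator {x<..} y * max 0 (- g y) \<partial>lborel)"
      by (rule Bochner_Integration.integral_diff[symmetric]; rule int) (auto intro: g g')
    also have "\<dots> = (\<integral>y. indicator {x<..} y * g y \<partial>lborel)"
      by (intro Bochner_Integration.integral_cong) (auto simp: indicator_def max_def)
    finally show ?thesis using tail[of x] by simp
  qed
  have "density lborel (\<lambda>y. ennreal (g y)) = density lborel (\<lambda>y. ennreal (- g y))"
    by (rule measure_eqI_lessThan) (auto simp: em[OF g] em[OF g'] eq)
  then have "AE x in lborel. ennreal (g x) = ennreal (- g x)"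
    by (subst (asm) sigma_finite_measure.density_unique_iff[OF sigma_finite_lborel]) auto
  then show ?thesis
  proof eventually_elim
    case (elim x)
    then show ?case
      by (cases "g x \<ge> 0") (auto simp: ennreal_neg not_le)
  qed
qed

section \<open>Primitives of square integrable functions\<close>

lemma sq_on_integral_Icc:
  assumes "sq_on a b u" shows "u integrable_on {x..y}"
    and "(\<integral>t. indicator {x..y} t * u t \<partial>lborel) = integral {x..y} u"
proof -
  note [measurable] = sq_on_measurable[OF assms]
  have "set_integrable lborel {x..y} u"
    unfolding set_integrable_def
    by (rule Bochner_Integration.integrable_bound[OF sq_on_integrable[OF assms]]) (auto simp: indicator_def)
  from set_borel_integral_eq_integral[OF this]
  show "u integrable_on {x..y}" "(\<integral>t. indicator {x..y} t * u t \<partial>lborel) = integral {x..y} u"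
    by (simp_all add: set_lebesgue_integral_def)
qed

text \<open>Integrating the class against the class of an indicator avoids choosing a
  representative: the value at every single point depends on the class alone.\<close>

definition prim :: "real \<Rightarrow> aefun \<Rightarrow> real \<Rightarrow> real" where
  "prim a f x = aefun_integral (f * aeclass_on a x (\<lambda>_. 1))"

lemma prim_aeclass:
  assumes [measurable]: "u \<in> borel_measurable borel"
  shows "prim a (aeclass u) x = (\<integral>t. indicator {a..x} t * u t \<partial>lborel)"
  unfolding prim_def aeclass_on_def
  by (subst aeclass_mult; simp add: aefun_integral_aeclass mult.commute)

lemma prim_eq_integral: "sq_on a b u \<Longrightarrow> prim a (aeclass u) x = integral {a..x} u"
  by (simp add: prim_aeclass sq_on_measurable sq_on_integral_Icc)

lemma prim_continuous:
  assumes "f \<in> L2 a b" shows "continuous_on {a..b} (prim a f)"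
proof -
  from assms obtain u where u: "sq_on a b u" "f = aeclass u" by (rule L2_rep)
  have "prim a f x = integral {a..x} u" for x
    using u by (simp add: prim_eq_integral)
  then show ?thesis
    using indefinite_integral_continuous_1[OF sq_on_integral_Icc(1)[OF u(1), of a b]]
    by (simp cong: continuous_on_cong)
qed

lemma prim_left [simp]: "f \<in> L2 a b \<Longrightarrow> prim a f a = 0"
  by (erule L2_rep) (simp add: prim_eq_integral)

lemma prim_add: "f \<in> L2 a b \<Longrightarrow> g \<in> L2 a b \<Longrightarrow> prim a (f + g) x = prim a f x + prim a g x"
proof -
  assume "f \<in> L2 a b" "g \<in> L2 a b"
  then obtain u v where u: "sq_on a b u" "f = aeclass u" and v: "sq_on a b v" "g = aeclass v"
    by (metis L2_rep)
  then show ?thesis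
    by (simp add: aeclass_add sq_on_measurable prim_eq_integral[OF sq_on_add[OF u(1) v(1)]]
        prim_eq_integral sq_on_integral_Icc Henstock_Kurzweil_Integration.integral_add)
qed

lemma prim_scale: "f \<in> L2 a b \<Longrightarrow> prim a (c *\<^sub>R f) x = c * prim a f x"
proof -
  assume "f \<in> L2 a b"
  then obtain u where u: "sq_on a b u" "f = aeclass u" by (metis L2_rep)
  then show ?thesis
    by (simp add: aeclass_scale sq_on_measurable prim_eq_integral[OF sq_on_scale[OF u(1)]] prim_eq_integral)
qed

lemma prim_diff: "f \<in> L2 a b \<Longrightarrow> g \<in> L2 a b \<Longrightarrow> prim a (f - g) x = prim a f x - prim a g x"
  using prim_add[of f a b "-1 *\<^sub>R g" x] prim_scale[of g a b "-1" x] subspace_scale[OF subspace_L2, of g a b "-1"] by simp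

lemma prim_eq_0_imp:
  assumes f: "f \<in> L2 a b" and ab: "a < b" and z: "\<And>x. x \<in> {a..b} \<Longrightarrow> prim a f x = 0"
  shows "f = 0"
proof -
  from f obtain u where u: "sq_on a b u" "f = aeclass u" by (rule L2_rep)
  note [measurable] = sq_on_measurable[OF u(1)]
  have z': "(\<integral>t. indicator {a..x} t * u t \<partial>lborel) = 0" if "x \<in> {a..b}" for x
    using z[OF that] by (simp add: u prim_aeclass)
  have int: "integrable lborel (\<lambda>t. indicator {a..x} t * u t)" for x
    by (rule Bochner_Integration.integrable_bound[OF sq_on_integrable[OF u(1)]]) (auto simp: indicator_def)
  have "AE x in lborel. u x = 0"
  proof (rule AE_zero_if_tail_integrals_zero[OF sq_on_integrable[OF u(1)]])
    fix x :: real
    \<comment> \<open>For \<open>x\<close> at least \<open>a\<close> the tail integral is the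
      integral up to \<open>b\<close> minus that up to \<open>x\<close> clamped to the interval; for
      smaller \<open>x\<close> it is the whole integral. All of these are values of the
      primitive.\<close>
    let ?y = "max a (min x b)"
    have "(\<integral>y. indicator {x<..} y * u y \<partial>lborel)
        = (\<integral>t. indicator {a..b} t * u t - (if x < a then 0 else indicator {a..?y} t * u t) \<partial>lborel)"
      using ab sq_on_outside[OF u(1)]
      by (intro Bochner_Integration.integral_cong) (auto simp: indicator_def min_def max_def)
    also have "\<dots> = (\<integral>t. indicator {a..b} t * u t \<partial>lborel) - (\<integral>t. (if x < a then 0 else indicator {a..?y} t * u t) \<partial>lborel)"
      using int by (intro Bochner_Integration.integral_diff) (cases "x < a"; simp)+
    also have "\<dots> = 0" using ab z'[of b] z'[of ?y] by (cases "x < a") auto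
    finally show "(\<integral>y. indicator {x<..} y * u y \<partial>lborel) = 0" .
  qed
  then have "aeclass u = aeclass (\<lambda>x. 0)" by (subst aeclass_eq_iff) auto
  then show ?thesis by (simp add: u aeclass_0)
qed

text \<open>The squared difference is continuous and nonnegative with integral zero, so it vanishes
  on the whole interval. This makes the definite description in \<open>pt_value\<close>
  meaningful.\<close>

lemma aeclass_on_eq_imp:
  assumes c: "continuous_on {a..b} k" "continuous_on {a..b} l" and ab: "a < b"
    and eq: "aeclass_on a b k = aeclass_on a b l" and x: "x \<in> {a..b}"
  shows "k x = l x"
proof -
  note [measurable] = measurable_on_indicator[OF c(1)] measurable_on_indicator[OF c(2)]
  have ae: "AE x in lborel. indicator {a..b} x * k x = indicator {a..b} x * l x"
    using eq unfolding aeclass_on_def by (subst (asm) aeclass_eq_iff) auto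
  have c2: "continuous_on {a..b} (\<lambda>x. (k x - l x)\<^sup>2)" by (intro continuous_intros c)
  have "set_integrable lborel {a..b} (\<lambda>x. (k x - l x)\<^sup>2)"
    by (rule borel_integrable_atLeastAtMost'[OF c2])
  then have "integral {a..b} (\<lambda>x. (k x - l x)\<^sup>2) = (\<integral>x. indicator {a..b} x * (k x - l x)\<^sup>2 \<partial>lborel)"
    by (simp add: set_borel_integral_eq_integral(2)[symmetric] set_lebesgue_integral_def)
  also have "\<dots> = 0"
    by (rule integral_eq_zero_AE) (use ae in eventually_elim, auto simp: indicator_def)
  finally show ?thesis
    using integral_eq_0_iff[OF c2 ab] x by auto
qed

lemma pt_value_aeclass_on:
  assumes "continuous_on {a..b} k" "a < b" "x \<in> {a..b}"
  shows "pt_value a b (aeclass_on a b k) x = k x"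
  unfolding pt_value_def
proof (rule the_equality)
  show "\<exists>u. continuous_on {a..b} u \<and> aeclass_on a b k = aeclass_on a b u \<and> k x = u x"
    using assms(1) by blast
next
  fix y assume "\<exists>u. continuous_on {a..b} u \<and> aeclass_on a b k = aeclass_on a b u \<and> y = u x"
  then show "y = k x" using aeclass_on_eq_imp[OF assms(1) _ assms(2) _ assms(3)] by metis
qed

subsection \<open>Test functions\<close>

definition test_pair :: "real \<Rightarrow> real \<Rightarrow> (real \<Rightarrow> real) \<Rightarrow> (real \<Rightarrow> real) \<Rightarrow> bool" where
  "test_pair a b \<psi> \<psi>' \<longleftrightarrow> (\<forall>x. (\<psi> has_real_derivative \<psi>' x) (at x)) \<and> continuous_on UNIV \<psi>' \<and>
     closure {x. \<psi> x \<noteq> 0} \<subseteq> {a<..<b}"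

lemma is_weak_deriv_iff:
  "is_weak_deriv a b f g \<longleftrightarrow> (\<forall>\<psi> \<psi>'. test_pair a b \<psi> \<psi>' \<longrightarrow>
     aefun_integral (f * aeclass \<psi>') = - aefun_integral (g * aeclass \<psi>))"
  unfolding is_weak_deriv_def test_pair_def by blast

lemma test_pair_continuous:
  assumes "test_pair a b \<psi> \<psi>'"
  shows "continuous_on UNIV \<psi>" "continuous_on UNIV \<psi>'"
  using assms by (auto simp: test_pair_def intro!: continuous_at_imp_continuous_on DERIV_isCont)

lemma test_pair_measurable:
  assumes "test_pair a b \<psi> \<psi>'"
  shows "\<psi> \<in> borel_measurable borel" "\<psi>' \<in> borel_measurable borel"
  using test_pair_continuous[OF assms] by (auto intro: borel_measurable_continuous_onI)

lemma test_pair_outside: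
  assumes "test_pair a b \<psi> \<psi>'" "x \<notin> {a<..<b}"
  shows "\<psi> x = 0"
  using assms closure_subset[of "{x. \<psi> x \<noteq> 0}"] by (auto simp: test_pair_def)

text \<open>Integration by parts for a merely square integrable \<open>v\<close>: the left side
  becomes a double integral over \<open>t \<le> x\<close>, Fubini exchanges the order, and the inner
  integral of \<open>\<psi>'\<close> from \<open>t\<close> to \<open>b\<close> is
  \<open>- \<psi> t\<close>. The constant \<open>C\<close> contributes nothing, as
  \<open>\<psi>\<close> vanishes at both ends.\<close>

lemma is_weak_deriv_prim:
  assumes v: "sq_on a b v" and ab: "a < b"
  shows "is_weak_deriv a b (aeclass_on a b (\<lambda>x. C + prim a (aeclass v) x)) (aeclass v)"
  unfolding is_weak_deriv_iff
proof (intro allI impI)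
  fix \<psi> \<psi>' assume t: "test_pair a b \<psi> \<psi>'"
  note [measurable] = sq_on_measurable[OF v] test_pair_measurable[OF t]
  let ?V = "prim a (aeclass v)"
  have Vc: "continuous_on {a..b} ?V" by (intro prim_continuous L2_aeclass v)
  note [measurable] = measurable_on_indicator[OF Vc]
  have FTC: "(\<integral>x. indicator {s..b} x * \<psi>' x \<partial>lborel) = \<psi> b - \<psi> s" if "s \<le> b" for s
    using integral_FTC_Icc_real[of s b \<psi> \<psi>'] that t test_pair_continuous[OF t]
    by (simp add: test_pair_def mult.commute continuous_on_eq_continuous_at)
  have \<psi>ab: "\<psi> a = 0" "\<psi> b = 0" using test_pair_outside[OF t] by auto
  obtain K where K: "\<forall>x\<in>{a..b}. \<bar>\<psi>' x\<bar> \<le> K"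
    using continuous_bounded_on[OF continuous_on_subset[OF test_pair_continuous(2)[OF t]]] by blast
  have sq': "sq_on a b (\<lambda>x. indicator {a..b} x * \<psi>' x)"
    by (rule sq_on_continuous[OF continuous_on_subset[OF test_pair_continuous(2)[OF t]]]) simp
  let ?F = "\<lambda>t x. (if t \<le> x then 1 else 0) * v t * (indicator {a..b} x * \<psi>' x)"
  have intF: "integrable (lborel \<Otimes>\<^sub>M lborel) (case_prod ?F)"
  proof (rule lborel_pair.Fubini_integrable)
    show "case_prod ?F \<in> borel_measurable (lborel \<Otimes>\<^sub>M lborel)" by measurable
    have Fi: "integrable lborel (\<lambda>x. ?F t x)" for t
      by (rule Bochner_Integration.integrable_bound[OF integrable_mult_right[OF sq_on_integrable[OF sq'], of "v t"]]) auto
    then show "AE t in lborel. integrable lborel (\<lambda>x. case_prod ?F (t, x))" by simp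
    show "integrable lborel (\<lambda>t. \<integral>x. norm (case_prod ?F (t, x)) \<partial>lborel)"
    proof (rule Bochner_Integration.integrable_bound)
      show "integrable lborel (\<lambda>t. \<bar>v t\<bar> * (\<integral>x. \<bar>indicator {a..b} x * \<psi>' x\<bar> \<partial>lborel))"
        by (intro integrable_mult_left integrable_abs sq_on_integrable[OF v])
      show "(\<lambda>t. \<integral>x. norm (case_prod ?F (t, x)) \<partial>lborel) \<in> borel_measurable lborel" by measurable
      have "(\<integral>x. norm (?F t x) \<partial>lborel) \<le> (\<integral>x. \<bar>v t\<bar> * \<bar>indicator {a..b} x * \<psi>' x\<bar> \<partial>lborel)" for t
        using Fi[of t] sq_on_integrable[OF sq'] by (intro integral_mono integrable_norm integrable_mult_right integrable_abs)
          (auto simp: abs_mult indicator_def)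
      moreover have "0 \<le> (\<integral>x. norm (?F t x) \<partial>lborel)" for t by (rule integral_nonneg_AE) simp
      ultimately show "AE t in lborel. norm (\<integral>x. norm (case_prod ?F (t, x)) \<partial>lborel)
          \<le> norm (\<bar>v t\<bar> * (\<integral>x. \<bar>indicator {a..b} x * \<psi>' x\<bar> \<partial>lborel))" by simp
    qed
  qed
  have inner1: "(\<integral>t. ?F t x \<partial>lborel) = ?V x * (indicator {a..b} x * \<psi>' x)" for x
  proof -
    have "(\<integral>t. (if t \<le> x then 1 else 0) * v t \<partial>lborel) = ?V x"
      using sq_on_outside[OF v] by (subst prim_aeclass) (auto intro!: Bochner_Integration.integral_cong simp: indicator_def)
    then show ?thesis by simp
  qed
  have inner2: "(\<integral>x. ?F t x \<partial>lborel) = - (v t * \<psi> t)" for t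
  proof (cases "t \<in> {a..b}")
    case True
    have "(\<integral>x. ?F t x \<partial>lborel) = (\<integral>x. v t * (indicator {t..b} x * \<psi>' x) \<partial>lborel)"
      using True by (intro Bochner_Integration.integral_cong) (auto simp: indicator_def)
    also have "\<dots> = - (v t * \<psi> t)" using FTC[of t] True \<psi>ab by simp
    finally show ?thesis .
  qed (simp add: sq_on_outside[OF v])
  have "aefun_integral (aeclass_on a b (\<lambda>x. C + ?V x) * aeclass \<psi>')
      = (\<integral>x. C * (indicator {a..b} x * \<psi>' x) + (\<integral>t. ?F t x \<partial>lborel) \<partial>lborel)"
  proof -
    note [measurable] = measurable_on_indicator[OF continuous_on_add[OF continuous_on_const Vc, of C]]
    have "aefun_integral (aeclass_on a b (\<lambda>x. C + ?V x) * aeclass \<psi>') = (\<integral>x. indicator {a..b} x * (C + ?V x) * \<psi>' x \<partial>lborel)"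
      by (simp add: aeclass_on_def aeclass_mult aefun_integral_aeclass)
    then show ?thesis unfolding inner1 by (simp add: algebra_simps)
  qed
  also have "\<dots> = C * (\<integral>x. indicator {a..b} x * \<psi>' x \<partial>lborel) + (\<integral>x. (\<integral>t. ?F t x \<partial>lborel) \<partial>lborel)"
    using sq_on_integrable[OF sq'] lborel_pair.integrable_snd[OF intF]
    by (subst Bochner_Integration.integral_add) auto
  also have "\<dots> = (\<integral>t. (\<integral>x. ?F t x \<partial>lborel) \<partial>lborel)"
    unfolding lborel_pair.Fubini_integral[OF intF] using FTC[of a] \<psi>ab ab by simp
  also have "\<dots> = - (\<integral>t. v t * \<psi> t \<partial>lborel)" unfolding inner2 by simp
  finally show "aefun_integral (aeclass_on a b (\<lambda>x. C + ?V x) * aeclass \<psi>') = - aefun_integral (aeclass v * aeclass \<psi>)"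
    by (simp add: aeclass_mult aefun_integral_aeclass)
qed

text \<open>An antiderivative of \<open>\<eta>\<close> is constant on each side of
  \<open>{s..t}\<close>, and zero mean makes the two constants equal; subtracting this constant
  gives compact support inside the open interval.\<close>

lemma test_pair_antiderivative:
  assumes st: "a < s" "s < t" "t < b" and \<eta>: "continuous_on UNIV \<eta>"
    and out: "\<And>x. x \<notin> {s..t} \<Longrightarrow> \<eta> x = 0" and int: "(\<integral>x. \<eta> x \<partial>lborel) = 0"
  shows "\<exists>\<psi>. test_pair a b \<psi> \<eta>"
proof -
  have "\<exists>F. \<forall>x::real. - \<infinity> < ereal x \<longrightarrow> ereal x < \<infinity> \<longrightarrow> (F has_vector_derivative \<eta> x) (at x)"
    using \<eta> by (intro einterval_antiderivative) (auto simp: continuous_on_eq_continuous_at)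
  then obtain F where F: "\<And>x. (F has_real_derivative \<eta> x) (at x)"
    by (auto simp: has_real_derivative_iff_has_vector_derivative)
  \<comment> \<open>The support hypothesis leaves out the endpoints themselves; continuity supplies
    them, so that constancy can be argued on closed half-lines.\<close>
  have zero: "\<eta> s = 0" "\<eta> t = 0"
  proof -
    have "\<eta> s = 0 \<and> \<eta> t = 0"
    proof
      have "closed {x. \<eta> x = 0}" using \<eta> by (intro closed_Collect_eq) auto
      moreover have "{..<s} \<subseteq> {x. \<eta> x = 0}" "{t<..} \<subseteq> {x. \<eta> x = 0}" using out by auto
      ultimately have "closure {..<s} \<subseteq> {x. \<eta> x = 0}" "closure {t<..} \<subseteq> {x. \<eta> x = 0}"
        by (simp_all only: closure_minimal)
      then show "\<eta> s = 0" "\<eta> t = 0" by auto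
    qed
    then show "\<eta> s = 0" "\<eta> t = 0" by auto
  qed
  have "\<exists>c. \<forall>x\<in>{..s}. F x = c"
  proof (rule has_field_derivative_zero_constant)
    fix x assume "x \<in> {..s}"
    then have "\<eta> x = 0" using out[of x] zero by (cases "x = s") auto
    with F[of x] show "(F has_real_derivative 0) (at x within {..s})"
      by (auto intro: has_field_derivative_at_within)
  qed auto
  then have L: "F x = F s" if "x \<le> s" for x using that by auto
  have "\<exists>c. \<forall>x\<in>{t..}. F x = c"
  proof (rule has_field_derivative_zero_constant)
    fix x assume "x \<in> {t..}"
    then have "\<eta> x = 0" using out[of x] zero by (cases "x = t") auto
    with F[of x] show "(F has_real_derivative 0) (at x within {t..})"
      by (auto intro: has_field_derivative_at_within)
  qed auto
  then have R: "F x = F t" if "x \<ge> t" for x using that by auto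
  have "F t - F s = (\<integral>x. \<eta> x * indicator {s..t} x \<partial>lborel)"
    using F \<eta> st by (intro integral_FTC_Icc_real[symmetric]) (auto simp: continuous_on_eq_continuous_at)
  also have "\<dots> = (\<integral>x. \<eta> x \<partial>lborel)"
    using out by (intro Bochner_Integration.integral_cong) (auto simp: indicator_def)
  finally have FF: "F t = F s" using int by simp
  have "{x. F x - F s \<noteq> 0} \<subseteq> {s..t}"
  proof
    fix x assume "x \<in> {x. F x - F s \<noteq> 0}"
    then have "\<not> x \<le> s" "\<not> x \<ge> t" using L[of x] R[of x] FF by fastforce+
    then show "x \<in> {s..t}" by simp
  qed
  then have "closure {x. F x - F s \<noteq> 0} \<subseteq> {s..t}" by (rule closure_minimal) simp
  then have "closure {x. F x - F s \<noteq> 0} \<subseteq> {a<..<b}" using st by fastforce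
  then have "test_pair a b (\<lambda>x. F x - F s) \<eta>"
    using F \<eta> by (auto simp: test_pair_def intro!: derivative_eq_intros)
  then show ?thesis by blast
qed

lemma unit_bump_exists:
  fixes s t :: real
  assumes "s < t"
  shows "\<exists>\<theta>. continuous_on UNIV \<theta> \<and> (\<forall>x. x \<notin> {s..t} \<longrightarrow> \<theta> x = 0) \<and> (\<integral>x. \<theta> x \<partial>lborel) = (1::real)"
proof -
  define l where "l = t - s"
  have l: "l > 0" using assms by (simp add: l_def)
  \<comment> \<open>A parabola vanishing at \<open>s\<close> and \<open>t\<close>. The factor 6 over
    \<open>l^3\<close> gives mass 1, because \<open>y * (l - y)\<close> has integral
    \<open>l^3 / 6\<close> over \<open>{0..l}\<close>; the positive part of the parabola is the
    continuous bump.\<close>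
  define f where "f x = 6 * (x - s) * (t - x) / l^3" for x
  define F where "F x = (3 * l * (x - s)\<^sup>2 - 2 * (x - s)^3) / l^3" for x
  have f_pos: "f x \<ge> 0" if "x \<in> {s..t}" for x using that l by (simp add: f_def)
  have f_neg: "f x \<le> 0" if "x \<notin> {s..t}" for x
  proof -
    have "(x - s) * (t - x) \<le> 0" using that assms by (auto simp: mult_le_0_iff)
    then have "6 * ((x - s) * (t - x)) \<le> 0" by linarith
    then show ?thesis using l unfolding f_def mult.assoc by (simp only: divide_le_0_iff) simp
  qed
  have "continuous_on UNIV (\<lambda>x. max 0 (f x))" unfolding f_def using l by (intro continuous_intros) auto
  moreover have "max 0 (f x) = 0" if "x \<notin> {s..t}" for x using f_neg[OF that] by simp
  moreover have "(\<integral>x. max 0 (f x) \<partial>lborel) = (\<integral>x. f x * indicator {s..t} x \<partial>lborel)"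
    using f_pos f_neg by (intro Bochner_Integration.integral_cong) (auto simp: indicator_def max_def intro: antisym)
  moreover have "(\<integral>x. f x * indicator {s..t} x \<partial>lborel) = F t - F s"
  proof (rule integral_FTC_Icc_real)
    fix x
    show "(F has_real_derivative f x) (at x)"
    proof -
      have t: "t = s + l" by (simp add: l_def)
      have "((\<lambda>x. 3 * l * (x - s)\<^sup>2 - 2 * (x - s)^3) has_real_derivative 6 * (x - s) * (t - x)) (at x)"
        by (auto intro!: derivative_eq_intros simp: t power2_eq_square algebra_simps)
      then show ?thesis unfolding F_def f_def by (rule DERIV_cdivide)
    qed
    show "isCont f x" unfolding f_def using l by (intro continuous_intros) auto
  qed (use assms in auto)
  moreover have "F t - F s = 1" using l by (simp add: F_def l_def[symmetric] power2_eq_square power3_eq_cube)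
  ultimately show ?thesis by (intro exI[of _ "\<lambda>x. max 0 (f x)"]) simp
qed

text \<open>Subtracting from a continuous \<open>\<theta>\<close> its mass times a fixed unit bump
  leaves a function of zero mean, hence the derivative of a test function. So \<open>u\<close> pairs
  with every such \<open>\<theta>\<close> as the constant \<open>C\<close> does; approximating
  indicators extends this to intervals, which determine \<open>u\<close> almost everywhere.\<close>

lemma du_Bois_Reymond:
  assumes u: "sq_on a b u" and ab: "a < b"
    and orth: "\<And>\<psi> \<psi>'. test_pair a b \<psi> \<psi>' \<Longrightarrow> (\<integral>x. u x * \<psi>' x \<partial>lborel) = 0"
  shows "\<exists>C. AE x in lborel. u x = indicator {a..b} x * C"
proof -
  note [measurable] = sq_on_measurable[OF u]
  \<comment> \<open>The middle third, a convenient compact subinterval of \<open>{a<..<b}\<close> to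
    carry the reference bump.\<close>
  define s0 where "s0 = (2 * a + b) / 3"
  define t0 where "t0 = (a + 2 * b) / 3"
  have st0: "a < s0" "s0 < t0" "t0 < b" using ab by (auto simp: s0_def t0_def field_simps)
  obtain \<theta>0 where \<theta>0: "continuous_on UNIV \<theta>0" "\<And>x. x \<notin> {s0..t0} \<Longrightarrow> \<theta>0 x = 0" "(\<integral>x. \<theta>0 x \<partial>lborel) = (1::real)"
    using unit_bump_exists[OF st0(2)] by blast
  define C where "C = (\<integral>x. u x * \<theta>0 x \<partial>lborel)"
  have int_cont: "integrable lborel \<theta>" "integrable lborel (\<lambda>x. u x * \<theta> x)"
    if "continuous_on UNIV \<theta>" "a < s" "t < b" "\<And>x. x \<notin> {s..t} \<Longrightarrow> \<theta> x = 0" for \<theta> s t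
  proof -
    have *: "\<theta> x = indicator {a..b} x * \<theta> x" for x using that(2-3) that(4)[of x] by (cases "x \<in> {s..t}") auto
    have "sq_on a b (\<lambda>x. indicator {a..b} x * \<theta> x)"
      by (rule sq_on_continuous[OF continuous_on_subset[OF that(1)]]) simp
    then have sq: "sq_on a b \<theta>" using * by simp
    show "integrable lborel \<theta>" by (rule sq_on_integrable[OF sq])
    show "integrable lborel (\<lambda>x. u x * \<theta> x)" by (rule sq_on_integrable_mult[OF u sq])
  qed
  have key: "(\<integral>x. u x * \<theta> x \<partial>lborel) = C * (\<integral>x. \<theta> x \<partial>lborel)"
    if \<theta>: "continuous_on UNIV \<theta>" and st: "a < s" "s < t" "t < b" and out: "\<And>x. x \<notin> {s..t} \<Longrightarrow> \<theta> x = 0" for \<theta> s t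
  proof -
    define I where "I = (\<integral>x. \<theta> x \<partial>lborel)"
    let ?\<eta> = "\<lambda>x. \<theta> x - I * \<theta>0 x"
    note i = int_cont[OF \<theta> st(1,3) out] int_cont[OF \<theta>0(1) st0(1,3) \<theta>0(2)]
    have "\<exists>\<psi>. test_pair a b \<psi> ?\<eta>"
    proof (rule test_pair_antiderivative[where s="min s s0" and t="max t t0"])
      show "continuous_on UNIV ?\<eta>" by (intro continuous_intros \<theta> \<theta>0)
      show "?\<eta> x = 0" if "x \<notin> {min s s0..max t t0}" for x
      proof -
        have "x \<notin> {s..t}" "x \<notin> {s0..t0}" using that by (auto simp: min_le_iff_disj le_max_iff_disj)
        then show ?thesis using out \<theta>0(2) by simp
      qed
      show "(\<integral>x. ?\<eta> x \<partial>lborel) = 0" using i \<theta>0(3) by (simp add: I_def)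
    qed (use st st0 in auto)
    then obtain \<psi> where "test_pair a b \<psi> ?\<eta>" by blast
    from orth[OF this] have "(\<integral>x. u x * \<theta> x - I * (u x * \<theta>0 x) \<partial>lborel) = 0" by (simp add: algebra_simps)
    then show ?thesis using i by (simp add: C_def I_def)
  qed
  have ind: "(\<integral>x. u x * indicator {s<..<t} x \<partial>lborel) = C * (\<integral>x. indicator {s<..<t} x \<partial>lborel)"
    if st: "a < s" "s < t" "t < b" for s t
  proof -
    \<comment> \<open>Trapezoids with flanks of slope \<open>k\<close>: continuous, between 0 and 1,
      and increasing to the indicator of the open interval.\<close>
    define \<theta> where "\<theta> k x = max 0 (min 1 (real k * min (x - s) (t - x)))" for k x
    have c: "continuous_on UNIV (\<theta> k)" for k unfolding \<theta>_def by (intro continuous_intros)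
    note [measurable] = borel_measurable_continuous_onI[OF c]
    have out: "\<theta> k x = 0" if "x \<notin> {s<..<t}" for k x
    proof -
      have "min (x - s) (t - x) \<le> 0" using that by auto
      then have "real k * min (x - s) (t - x) \<le> 0" by (intro mult_nonneg_nonpos) auto
      then show ?thesis by (auto simp: \<theta>_def)
    qed
    have lim: "(\<lambda>k. \<theta> k x) \<longlonglongrightarrow> indicator {s<..<t} x" for x
    proof (cases "x \<in> {s<..<t}")
      case True
      then have p: "min (x - s) (t - x) > 0" by auto
      then obtain N where N: "1 < real N * min (x - s) (t - x)" using ex_less_of_nat_mult by blast
      have "\<theta> k x = 1" if "k \<ge> N" for k
      proof -
        have "real N * min (x - s) (t - x) \<le> real k * min (x - s) (t - x)"
          using that p by (intro mult_right_mono) auto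
        then show ?thesis using N by (auto simp: \<theta>_def)
      qed
      then show ?thesis using True by (intro tendsto_eventually eventually_sequentiallyI[of N]) simp
    qed (use out in auto)
    have bd: "\<bar>\<theta> k x\<bar> \<le> indicator {s..t} x" for k x
      using out[of x k] by (cases "x \<in> {s<..<t}") (auto simp: indicator_def \<theta>_def)
    have 1: "(\<lambda>k. \<integral>x. \<theta> k x \<partial>lborel) \<longlonglongrightarrow> (\<integral>x. indicator {s<..<t} x \<partial>lborel)"
    proof (rule integral_dominated_convergence[where w="indicator {s..t}"])
      show "integrable lborel (indicator {s..t} :: real \<Rightarrow> real)"
        by (rule integrable_real_indicator) (auto simp: emeasure_lborel_Icc_eq)
    qed (use lim bd in auto)
    have 2: "(\<lambda>k. \<integral>x. u x * \<theta> k x \<partial>lborel) \<longlonglongrightarrow> (\<integral>x. u x * indicator {s<..<t} x \<partial>lborel)"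
    proof (rule integral_dominated_convergence[where w="\<lambda>x. \<bar>u x\<bar>"])
      show "integrable lborel (\<lambda>x. \<bar>u x\<bar>)" using sq_on_integrable[OF u] by simp
      show "AE x in lborel. norm (u x * \<theta> k x) \<le> \<bar>u x\<bar>" for k
      proof (rule AE_I2)
        fix x
        have "\<bar>\<theta> k x\<bar> \<le> 1" using bd[of k x] by (cases "x \<in> {s..t}") auto
        then show "norm (u x * \<theta> k x) \<le> \<bar>u x\<bar>" by (simp add: abs_mult mult_left_le)
      qed
      show "AE x in lborel. (\<lambda>k. u x * \<theta> k x) \<longlonglongrightarrow> u x * indicator {s<..<t} x"
        using lim by (intro AE_I2 tendsto_mult_left) auto
    qed auto
    have "(\<integral>x. u x * \<theta> k x \<partial>lborel) = C * (\<integral>x. \<theta> k x \<partial>lborel)" for k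
      by (rule key[OF c st]) (rule out, auto)
    then have "(\<lambda>k. \<integral>x. u x * \<theta> k x \<partial>lborel) \<longlonglongrightarrow> C * (\<integral>x. indicator {s<..<t} x \<partial>lborel)"
      using tendsto_mult_left[OF 1, of C] by simp
    then show ?thesis by (rule LIMSEQ_unique[OF 2])
  qed
  define g where "g x = u x - indicator {a..b} x * C" for x
  have sqg: "sq_on a b g"
    unfolding g_def[abs_def] by (intro sq_on_diff u sq_on_continuous continuous_on_const)
  note gi = sq_on_integrable[OF sqg]
  note [measurable] = sq_on_measurable[OF sqg]
  have g0: "(\<integral>x. indicator {s<..<t} x * g x \<partial>lborel) = 0" if st: "a < s" "s < t" "t < b" for s t
  proof -
    have i1: "integrable lborel (\<lambda>x. u x * indicator {s<..<t} x)"
      by (rule Bochner_Integration.integrable_bound[OF sq_on_integrable[OF u]]) (auto simp: indicator_def)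
    have i2: "integrable lborel (indicator {s<..<t} :: real \<Rightarrow> real)"
      using st by (intro integrable_real_indicator) auto
    have "(\<integral>x. indicator {s<..<t} x * g x \<partial>lborel) = (\<integral>x. u x * indicator {s<..<t} x - C * indicator {s<..<t} x \<partial>lborel)"
      using st by (intro Bochner_Integration.integral_cong) (auto simp: g_def indicator_def)
    also have "\<dots> = 0" using ind[OF st] i1 i2 by simp
    finally show ?thesis .
  qed
  have "AE x in lborel. g x = 0"
  proof (rule AE_zero_if_tail_integrals_zero[OF gi])
    fix x :: real
    define m where "m = max a x"
    have ae: "AE y in lborel. y \<noteq> a \<and> y \<noteq> b" using AE_lborel_singleton[of a] AE_lborel_singleton[of b] by eventually_elim auto
    have eq: "(\<integral>y. indicator {x<..} y * g y \<partial>lborel) = (\<integral>y. indicator {m<..<b} y * g y \<partial>lborel)"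
    proof (rule integral_cong_AE)
      show "AE y in lborel. indicator {x<..} y * g y = indicator {m<..<b} y * g y"
        using ae
      proof eventually_elim
        case (elim y)
        then show ?case using sq_on_outside[OF sqg, of y] by (auto simp: indicator_def m_def max_def)
      qed
    qed auto
    show "(\<integral>y. indicator {x<..} y * g y \<partial>lborel) = 0"
    proof (cases "m < b")
      case False
      then show ?thesis unfolding eq by simp
    next
      case True
      \<comment> \<open>The \<open>+ 3\<close> keeps \<open>d k\<close> at most a third of the
        length, so the shrunken intervals are nonempty and stay strictly inside the interval from
        \<open>m\<close> to \<open>b\<close>, where \<open>g0\<close> applies.\<close>
      define d where "d k = (b - m) / (real k + 3)" for k
      have d: "0 < d k" "3 * d k \<le> b - m" for k
        using True mult_right_mono[of m b "real k"] by (auto simp: d_def field_simps)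
      have dlim: "d \<longlonglongrightarrow> 0"
        unfolding d_def[abs_def] by real_asymp
      have "(\<lambda>k. \<integral>y. indicator {m + d k<..<b - d k} y * g y \<partial>lborel) \<longlonglongrightarrow> (\<integral>y. indicator {m<..<b} y * g y \<partial>lborel)"
      proof (rule integral_dominated_convergence[where w="\<lambda>y. \<bar>g y\<bar>"])
        show "integrable lborel (\<lambda>y. \<bar>g y\<bar>)" using gi by simp
        show "AE y in lborel. (\<lambda>k. indicator {m + d k<..<b - d k} y * g y) \<longlonglongrightarrow> indicator {m<..<b} y * g y"
        proof (intro AE_I2 tendsto_mult_right)
          fix y :: real
          show "(\<lambda>k. indicator {m + d k<..<b - d k} y) \<longlonglongrightarrow> (indicator {m<..<b} y :: real)"
          proof (cases "y \<in> {m<..<b}")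
            case True
            then have "eventually (\<lambda>k. d k < min (y - m) (b - y)) sequentially"
              by (intro order_tendstoD[OF dlim]) auto
            then have "eventually (\<lambda>k. indicator {m + d k<..<b - d k} y = (1::real)) sequentially"
              by eventually_elim auto
            then show ?thesis using True by (simp add: tendsto_eventually)
          next
            case False
            then have "indicator {m + d k<..<b - d k} y = (0::real)" for k using d(1)[of k] by (auto simp: indicator_def)
            then show ?thesis using False by simp
          qed
        qed
      qed (auto simp: indicator_def)
      moreover have "(\<integral>y. indicator {m + d k<..<b - d k} y * g y \<partial>lborel) = 0" for k
        using d[of k] by (intro g0) (auto simp: m_def)
      ultimately show ?thesis unfolding eq by (simp add: LIMSEQ_const_iff)
    qed
  qed
  then have "AE x in lborel. u x = indicator {a..b} x * C"
    by eventually_elim (simp add: g_def)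
  then show ?thesis by blast
qed

subsection \<open>Sobolev functions as primitives\<close>

lemma aefun_integral_add:
  "aefun_integrable f \<Longrightarrow> aefun_integrable g \<Longrightarrow>
    aefun_integral (f + g) = aefun_integral f + aefun_integral g"
  by transfer auto

lemma aefun_integrable_mult_continuous:
  assumes "f \<in> L2 a b" and k: "continuous_on UNIV k"
  shows "aefun_integrable (f * aeclass k)"
proof -
  obtain u where u: "sq_on a b u" "f = aeclass u" using assms(1) by (rule L2_rep)
  have [measurable]: "k \<in> borel_measurable borel" by (rule borel_measurable_continuous_onI[OF k])
  note [measurable] = sq_on_measurable[OF u(1)]
  have kc: "continuous_on {a..b} k" by (rule continuous_on_subset[OF k]) simp
  have "integrable lborel (\<lambda>x. u x * k x)"
    using sq_on_integrable_mult[OF u(1) sq_on_continuous[OF kc]] sq_on_indicator[OF u(1)]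
    by (simp add: mult.assoc[symmetric] mult.commute[of "u _"])
  then show ?thesis by (simp add: u aeclass_mult aefun_integrable_aeclass)
qed

text \<open>The difference of \<open>f\<close> and the primitive of \<open>g\<close> pairs to zero
  with all derivatives of test functions, so it is a constant by du Bois-Reymond.\<close>

lemma is_weak_deriv_imp_prim:
  assumes f: "f \<in> L2 a b" and g: "g \<in> L2 a b" and ab: "a < b" and wd: "is_weak_deriv a b f g"
  shows "\<exists>C. f = aeclass_on a b (\<lambda>x. C + prim a g x)"
proof -
  obtain u where u: "sq_on a b u" "f = aeclass u" using f by (rule L2_rep)
  obtain v where v: "sq_on a b v" "g = aeclass v" using g by (rule L2_rep)
  let ?h = "\<lambda>x. indicator {a..b} x * prim a g x"
  have c: "continuous_on {a..b} (prim a g)" by (rule prim_continuous[OF g])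
  have h: "sq_on a b ?h" by (rule sq_on_continuous[OF c])
  have sq: "sq_on a b (\<lambda>x. u x - ?h x)" by (intro sq_on_diff u h)
  note [measurable] = sq_on_measurable[OF u(1)] sq_on_measurable[OF h] sq_on_measurable[OF v(1)]
  have "\<exists>C. AE x in lborel. u x - ?h x = indicator {a..b} x * C"
  proof (rule du_Bois_Reymond[OF sq ab])
    fix \<psi> \<psi>' assume t: "test_pair a b \<psi> \<psi>'"
    note [measurable] = test_pair_measurable[OF t]
    have kc: "sq_on a b (\<lambda>x. indicator {a..b} x * \<psi>' x)"
      by (rule sq_on_continuous[OF continuous_on_subset[OF test_pair_continuous(2)[OF t]]]) simp
    have int: "integrable lborel (\<lambda>x. w x * \<psi>' x)" if w: "sq_on a b w" for w
      using sq_on_integrable_mult[OF w kc] sq_on_indicator[OF w]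
      by (simp add: mult.assoc[symmetric] mult.commute[of "w _"])
    have "(\<integral>x. u x * \<psi>' x \<partial>lborel) = aefun_integral (f * aeclass \<psi>')"
      by (simp add: u aeclass_mult aefun_integral_aeclass)
    also have "\<dots> = - aefun_integral (g * aeclass \<psi>)"
      using wd t unfolding is_weak_deriv_iff by blast
    also have "\<dots> = aefun_integral (aeclass_on a b (\<lambda>x. 0 + prim a g x) * aeclass \<psi>')"
      using is_weak_deriv_prim[OF v(1) ab, of 0] t unfolding is_weak_deriv_iff v(2)[symmetric] by simp
    also have "\<dots> = (\<integral>x. ?h x * \<psi>' x \<partial>lborel)"
      by (simp add: aeclass_on_def aeclass_mult aefun_integral_aeclass)
    finally show "(\<integral>x. (u x - ?h x) * \<psi>' x \<partial>lborel) = 0"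
      using int[OF u(1)] int[OF h] by (simp add: left_diff_distrib)
  qed
  then obtain C where C: "AE x in lborel. u x - ?h x = indicator {a..b} x * C" by blast
  have "continuous_on {a..b} (\<lambda>x. C + prim a g x)" by (intro continuous_intros c)
  note [measurable] = measurable_on_indicator[OF this]
  have "f = aeclass_on a b (\<lambda>x. C + prim a g x)"
    unfolding u aeclass_on_def
  proof (subst aeclass_eq_iff)
    show "AE x in lborel. u x = indicator {a..b} x * (C + prim a g x)"
      using C by eventually_elim (simp add: algebra_simps)
  qed measurable
  then show ?thesis by blast
qed

lemma is_weak_deriv_prim':
  assumes "g \<in> L2 a b" "a < b"
  shows "is_weak_deriv a b (aeclass_on a b (\<lambda>x. C + prim a g x)) g"
  using assms is_weak_deriv_prim by (metis L2_rep)

text \<open>Two weak derivatives give two continuous representatives of \<open>f\<close>; comparing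
  them at \<open>a\<close> and then everywhere shows that the primitives coincide. This justifies
  the definite description \<open>weak_deriv\<close>.\<close>

lemma weak_deriv_unique:
  assumes f: "f \<in> L2 a b" and ab: "a < b"
    and g: "g \<in> L2 a b" "is_weak_deriv a b f g" and g': "g' \<in> L2 a b" "is_weak_deriv a b f g'"
  shows "g = g'"
proof -
  obtain C where C: "f = aeclass_on a b (\<lambda>x. C + prim a g x)"
    using is_weak_deriv_imp_prim[OF f g(1) ab g(2)] by blast
  obtain C' where C': "f = aeclass_on a b (\<lambda>x. C' + prim a g' x)"
    using is_weak_deriv_imp_prim[OF f g'(1) ab g'(2)] by blast
  have eq: "C + prim a g x = C' + prim a g' x" if "x \<in> {a..b}" for x
  proof (rule aeclass_on_eq_imp[OF _ _ ab _ that])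
    show "continuous_on {a..b} (\<lambda>x. C + prim a g x)" "continuous_on {a..b} (\<lambda>x. C' + prim a g' x)"
      using g g' by (intro continuous_intros prim_continuous; simp)+
    show "aeclass_on a b (\<lambda>x. C + prim a g x) = aeclass_on a b (\<lambda>x. C' + prim a g' x)"
      using C C' by simp
  qed
  have "C = C'" using eq[of a] ab g g' by (simp add: prim_left)
  then have "prim a (g - g') x = 0" if "x \<in> {a..b}" for x
    using eq[OF that] g g' by (simp add: prim_diff[of g a b g'])
  then have "g - g' = 0"
    using g g' by (intro prim_eq_0_imp[OF _ ab] subspace_diff[OF subspace_L2]) auto
  then show ?thesis by simp
qed

lemma weak_deriv_eqI:
  assumes "f \<in> L2 a b" "a < b" "g \<in> L2 a b" "is_weak_deriv a b f g"
  shows "weak_deriv a b f = g"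
  unfolding weak_deriv_def using assms weak_deriv_unique by (intro the_equality) auto

lemma weak_deriv_aeclass_on_prim:
  assumes "g \<in> L2 a b" "a < b"
  shows "aeclass_on a b (\<lambda>x. C + prim a g x) \<in> H1 a b"
    "weak_deriv a b (aeclass_on a b (\<lambda>x. C + prim a g x)) = g"
proof -
  have L: "aeclass_on a b (\<lambda>x. C + prim a g x) \<in> L2 a b"
    using assms by (intro aeclass_on_in_L2 continuous_intros prim_continuous)
  show "aeclass_on a b (\<lambda>x. C + prim a g x) \<in> H1 a b"
    using L is_weak_deriv_prim'[OF assms] assms(1) unfolding H1_def by blast
  show "weak_deriv a b (aeclass_on a b (\<lambda>x. C + prim a g x)) = g"
    by (rule weak_deriv_eqI[OF L assms(2,1) is_weak_deriv_prim'[OF assms]])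
qed

lemma H1_E:
  assumes "f \<in> H1 a b" "a < b"
  obtains C where "f \<in> L2 a b" "weak_deriv a b f \<in> L2 a b" "is_weak_deriv a b f (weak_deriv a b f)"
    "f = aeclass_on a b (\<lambda>x. C + prim a (weak_deriv a b f) x)"
proof -
  from assms obtain g where g: "f \<in> L2 a b" "g \<in> L2 a b" "is_weak_deriv a b f g"
    by (auto simp: H1_def)
  have "weak_deriv a b f = g" using g assms(2) by (intro weak_deriv_eqI)
  then show ?thesis using that g is_weak_deriv_imp_prim[OF g(1,2) assms(2) g(3)] by blast
qed

section \<open>Multiplication by continuous and by differentiable coefficients\<close>

lemma aeclass_on_mult_L2:
  assumes "continuous_on {a..b} k" "f \<in> L2 a b"
  shows "aeclass_on a b k * f \<in> L2 a b"
proof -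
  obtain u where u: "sq_on a b u" "f = aeclass u" using assms(2) by (rule L2_rep)
  note [measurable] = measurable_on_indicator[OF assms(1)] sq_on_measurable[OF u(1)]
  obtain C where C: "\<forall>x\<in>{a..b}. \<bar>k x\<bar> \<le> C" using continuous_bounded_on[OF assms(1)] by blast
  have "sq_on a b (\<lambda>x. indicator {a..b} x * k x * u x)"
    using C u by (intro sq_on_bounded_mult[where C=C]) auto
  then show ?thesis using L2_aeclass by (simp add: aeclass_on_def u aeclass_mult)
qed

lemma aeclass_on_mult:
  assumes "continuous_on {a..b} k" "continuous_on {a..b} l"
  shows "aeclass_on a b k * aeclass_on a b l = aeclass_on a b (\<lambda>x. k x * l x)"
  unfolding aeclass_on_def using assms[THEN measurable_on_indicator]
  by (subst aeclass_mult) (auto intro!: aeclass_eqI simp: indicator_def)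

lemma aeclass_on_cong: "(\<And>x. x \<in> {a..b} \<Longrightarrow> k x = l x) \<Longrightarrow> aeclass_on a b k = aeclass_on a b l"
  unfolding aeclass_on_def by (auto intro!: aeclass_eqI simp: indicator_def)

lemma aeclass_on_1_mult: "f \<in> L2 a b \<Longrightarrow> aeclass_on a b (\<lambda>x. 1) * f = f"
  by (simp add: L2_def)

text \<open>\<open>k\<close> is differentiable only within \<open>{a..b}\<close> and its extension
  by zero may jump at the ends, but near the ends \<open>\<psi>\<close> is identically zero.
  Differentiability is checked on the open interval and on the complement of the support, two open
  sets that cover the line.\<close>

lemma test_pair_mult:
  assumes t: "test_pair a b \<psi> \<psi>'"
    and k: "\<And>x. x \<in> {a..b} \<Longrightarrow> (k has_real_derivative k' x) (at x within {a..b})"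
    and k': "continuous_on {a..b} k'"
  shows "test_pair a b (\<lambda>x. indicator {a..b} x * k x * \<psi> x)
    (\<lambda>x. indicator {a..b} x * k' x * \<psi> x + indicator {a..b} x * k x * \<psi>' x)"
proof -
  let ?Z = "- closure {x. \<psi> x \<noteq> 0}"
  let ?\<chi> = "\<lambda>x. indicator {a..b} x * k x * \<psi> x"
  let ?\<chi>' = "\<lambda>x. indicator {a..b} x * k' x * \<psi> x + indicator {a..b} x * k x * \<psi>' x"
  have Zo: "open ?Z" by (rule open_Compl[OF closed_closure])
  have cover: "{a<..<b} \<union> ?Z = UNIV" using t by (auto simp: test_pair_def)
  have z: "\<psi> x = 0" if "x \<in> ?Z" for x using that closure_subset[of "{x. \<psi> x \<noteq> 0}"] by auto
  have d\<psi>: "(\<psi> has_real_derivative \<psi>' x) (at x)" for x using t by (simp add: test_pair_def)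
  have z': "\<psi>' x = 0" if "x \<in> ?Z" for x
  proof -
    have "(\<psi> has_real_derivative 0) (at x)"
      by (rule has_field_derivative_transform_within_open[OF DERIV_const Zo that z[symmetric]])
    then show ?thesis by (rule DERIV_unique[OF d\<psi>])
  qed
  have kd: "(k has_real_derivative k' x) (at x)" if "x \<in> {a<..<b}" for x
    using k[of x] at_within_Icc_at[of a x b] that by simp
  have kc: "continuous_on {a..b} k" using k by (rule DERIV_continuous_on)
  have "(?\<chi> has_real_derivative ?\<chi>' x) (at x)" for x
  proof (cases "x \<in> {a<..<b}")
    case True
    have "((\<lambda>x. k x * \<psi> x) has_real_derivative k' x * \<psi> x + k x * \<psi>' x) (at x)"
      using kd[OF True] d\<psi>[of x] by (auto intro!: derivative_eq_intros)
    then have "(?\<chi> has_real_derivative k' x * \<psi> x + k x * \<psi>' x) (at x)"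
      by (rule has_field_derivative_transform_within_open[of _ _ _ "{a<..<b}"]) (use True in auto)
    then show ?thesis using True by simp
  next
    case False
    then have xZ: "x \<in> ?Z" using cover by blast
    have "(?\<chi> has_real_derivative 0) (at x)"
      by (rule has_field_derivative_transform_within_open[OF DERIV_const Zo xZ]) (simp only: z mult_zero_right)
    then show ?thesis using z[OF xZ] z'[OF xZ] by simp
  qed
  moreover have "continuous_on UNIV ?\<chi>'"
  proof -
    have "continuous_on {a<..<b} (\<lambda>x. k' x * \<psi> x + k x * \<psi>' x)"
      using test_pair_continuous[OF t]
      by (intro continuous_intros continuous_on_subset[OF k'] continuous_on_subset[OF kc])
        (auto intro: continuous_on_subset)
    then have 1: "continuous_on {a<..<b} ?\<chi>'" by (rule continuous_on_eq) auto
    have 2: "continuous_on ?Z ?\<chi>'"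
      by (rule continuous_on_eq[OF continuous_on_const[of _ 0]]) (simp only: z z' mult_zero_right add_0)
    have "continuous_on ({a<..<b} \<union> ?Z) ?\<chi>'" by (rule continuous_on_open_Un[OF open_greaterThanLessThan Zo 1 2])
    then show ?thesis unfolding cover .
  qed
  moreover have "closure {x. ?\<chi> x \<noteq> 0} \<subseteq> {a<..<b}"
  proof -
    have "closure {x. ?\<chi> x \<noteq> 0} \<subseteq> closure {x. \<psi> x \<noteq> 0}" by (rule closure_mono) auto
    then show ?thesis using t by (auto simp: test_pair_def)
  qed
  ultimately show ?thesis by (simp add: test_pair_def)
qed

text \<open>The factor moves to the test function: \<open>f\<close> is tested against
  \<open>k * \<psi>\<close>, extended by zero, whose derivative splits into
  \<open>k' * \<psi>\<close> and \<open>k * \<psi>'\<close>.\<close>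

lemma is_weak_deriv_mult:
  assumes f: "f \<in> L2 a b" and g: "g \<in> L2 a b" and wd: "is_weak_deriv a b f g"
    and k: "\<And>x. x \<in> {a..b} \<Longrightarrow> (k has_real_derivative k' x) (at x within {a..b})"
    and k': "continuous_on {a..b} k'"
  shows "is_weak_deriv a b (aeclass_on a b k * f) (aeclass_on a b k' * f + aeclass_on a b k * g)"
  unfolding is_weak_deriv_iff
proof (intro allI impI)
  fix \<psi> \<psi>' assume t: "test_pair a b \<psi> \<psi>'"
  have kc: "continuous_on {a..b} k" using k by (rule DERIV_continuous_on)
  let ?\<chi> = "\<lambda>x. indicator {a..b} x * k x * \<psi> x"
  let ?\<chi>' = "\<lambda>x. indicator {a..b} x * k' x * \<psi> x + indicator {a..b} x * k x * \<psi>' x"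
  have t2: "test_pair a b ?\<chi> ?\<chi>'" by (rule test_pair_mult[OF t k k'])
  note [measurable] = test_pair_measurable[OF t] measurable_on_indicator[OF kc] measurable_on_indicator[OF k']
  have \<chi>: "aeclass ?\<chi> = aeclass_on a b k * aeclass \<psi>"
    by (simp add: aeclass_on_def aeclass_mult)
  have \<chi>': "aeclass ?\<chi>' = aeclass_on a b k' * aeclass \<psi> + aeclass_on a b k * aeclass \<psi>'"
    by (simp add: aeclass_on_def aeclass_mult aeclass_add)
  have "aefun_integral (f * aeclass ?\<chi>') = - aefun_integral (g * aeclass ?\<chi>)"
    using wd t2 unfolding is_weak_deriv_iff by blast
  moreover have "f * aeclass ?\<chi>' = (aeclass_on a b k' * f) * aeclass \<psi> + (aeclass_on a b k * f) * aeclass \<psi>'"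
    unfolding \<chi>' by (simp add: algebra_simps)
  moreover have "aefun_integral ((aeclass_on a b k' * f) * aeclass \<psi> + (aeclass_on a b k * f) * aeclass \<psi>')
      = aefun_integral ((aeclass_on a b k' * f) * aeclass \<psi>) + aefun_integral ((aeclass_on a b k * f) * aeclass \<psi>')"
    by (intro aefun_integral_add aefun_integrable_mult_continuous[of _ a b] aeclass_on_mult_L2 k' kc f test_pair_continuous[OF t])
  moreover have "aefun_integral ((aeclass_on a b k' * f + aeclass_on a b k * g) * aeclass \<psi>)
      = aefun_integral ((aeclass_on a b k' * f) * aeclass \<psi>) + aefun_integral ((aeclass_on a b k * g) * aeclass \<psi>)"
    unfolding distrib_right
    by (intro aefun_integral_add aefun_integrable_mult_continuous[of _ a b] aeclass_on_mult_L2 k' kc f g test_pair_continuous[OF t])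
  ultimately show "aefun_integral (aeclass_on a b k * f * aeclass \<psi>')
      = - aefun_integral ((aeclass_on a b k' * f + aeclass_on a b k * g) * aeclass \<psi>)"
    unfolding \<chi> by (simp add: mult_ac)
qed

lemma aeclass_on_add:
  assumes "continuous_on {a..b} k" "continuous_on {a..b} l"
  shows "aeclass_on a b (\<lambda>x. k x + l x) = aeclass_on a b k + aeclass_on a b l"
  unfolding aeclass_on_def using assms[THEN measurable_on_indicator]
  by (subst aeclass_add) (auto intro!: aeclass_eqI simp: distrib_left)

lemma aeclass_on_scale:
  assumes "continuous_on {a..b} k"
  shows "aeclass_on a b (\<lambda>x. c * k x) = c *\<^sub>R aeclass_on a b k"
  unfolding aeclass_on_def using measurable_on_indicator[OF assms]
  by (subst aeclass_scale) (auto intro!: aeclass_eqI)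

section \<open>Bounded linear maps on pairs of square integrable functions\<close>

context weighted_L2
begin

definition one :: aefun where "one = aeclass_on a b (\<lambda>_. 1)"

definition volterra :: "aefun \<Rightarrow> aefun" where "volterra f = aeclass_on a b (prim a f)"

abbreviation "X \<equiv> L2 a b"

lemma one_in [simp]: "one \<in> X"
  unfolding one_def by (intro aeclass_on_in_L2 continuous_intros)

lemma volterra_in [simp]: "f \<in> X \<Longrightarrow> volterra f \<in> X"
  unfolding volterra_def by (intro aeclass_on_in_L2 prim_continuous)

lemma volterra_add: "f \<in> X \<Longrightarrow> g \<in> X \<Longrightarrow> volterra (f + g) = volterra f + volterra g"
  using prim_add[of f a b g] aeclass_on_add[OF prim_continuous prim_continuous, of f a b g]
  by (simp add: volterra_def cong: aeclass_on_cong)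

lemma volterra_scale: "f \<in> X \<Longrightarrow> volterra (r *\<^sub>R f) = r *\<^sub>R volterra f"
  using prim_scale[of f a b r] aeclass_on_scale[OF prim_continuous, of f a b r]
  by (simp add: volterra_def cong: aeclass_on_cong)

lemma aeclass_on_const_prim:
  assumes "f \<in> X"
  shows "aeclass_on a b (\<lambda>x. c + prim a f x) = c *\<^sub>R one + volterra f"
proof -
  have "aeclass_on a b (\<lambda>x. c * 1 + prim a f x) = aeclass_on a b (\<lambda>x. c * 1) + volterra f"
    unfolding volterra_def
    by (rule aeclass_on_add[OF _ prim_continuous[OF assms]]) (rule continuous_on_const)
  also have "aeclass_on a b (\<lambda>x. c * 1) = c *\<^sub>R one"
    unfolding one_def by (rule aeclass_on_scale[OF continuous_on_const])
  finally show ?thesis by simp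
qed

lemma ip_one_pos: "ip one one > 0"
proof (rule ip_pos[OF one_in])
  show "one \<noteq> 0"
  proof
    assume "one = 0"
    then have "aeclass_on a b (\<lambda>_. 1) = aeclass_on a b (\<lambda>_. 0)"
      by (simp add: one_def aeclass_on_def aeclass_0)
    then show False using aeclass_on_eq_imp[of a b "\<lambda>_. 1" "\<lambda>_. 0" a] ab by auto
  qed
qed

lemma nrm_mult_le:
  assumes k: "continuous_on {a..b} k" and C: "\<And>x. x \<in> {a..b} \<Longrightarrow> \<bar>k x\<bar> \<le> C" and f: "f \<in> X"
  shows "nrm (aeclass_on a b k * f) \<le> C * nrm f"
proof -
  have C0: "C \<ge> 0" using C[of a] ab by auto
  obtain u where u: "sq_on a b u" "f = aeclass u" using f by (rule L2_rep)
  note [measurable] = measurable_on_indicator[OF k] sq_on_measurable[OF u(1)]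
  let ?v = "\<lambda>x. indicator {a..b} x * k x * u x"
  have v: "sq_on a b ?v" using C u(1) by (intro sq_on_bounded_mult[where C=C]) auto
  have kf: "aeclass_on a b k * f = aeclass ?v" by (simp add: u aeclass_on_def aeclass_mult)
  have "ip (aeclass_on a b k * f) (aeclass_on a b k * f) = (\<integral>x. ?v x * ?v x * w x \<partial>lborel)"
    unfolding kf by (rule ip_aeclass) measurable
  also have "\<dots> \<le> (\<integral>x. C\<^sup>2 * (u x * u x * w x) \<partial>lborel)"
  proof (rule integral_mono[OF ip_integrable[OF v v] integrable_mult_right[OF ip_integrable[OF u(1) u(1)]]])
    fix x
    show "?v x * ?v x * w x \<le> C\<^sup>2 * (u x * u x * w x)"
    proof (cases "x \<in> {a..b}")
      case True
      have "(k x)\<^sup>2 \<le> C\<^sup>2" using power_mono[of "\<bar>k x\<bar>" C 2] C[OF True] by simp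
      then have "(k x)\<^sup>2 * (u x * u x * w x) \<le> C\<^sup>2 * (u x * u x * w x)"
        by (rule mult_right_mono) (simp add: w_nonneg)
      then show ?thesis using True by (simp add: power2_eq_square mult_ac)
    qed (simp add: w_def)
  qed
  also have "\<dots> = C\<^sup>2 * ip f f" unfolding u by (simp add: ip_aeclass)
  finally have "sqrt (ip (aeclass_on a b k * f) (aeclass_on a b k * f)) \<le> sqrt (C\<^sup>2 * ip f f)"
    by (rule real_sqrt_le_mono)
  then show ?thesis using C0 by (simp add: ip_norm_def real_sqrt_mult)
qed

text \<open>An integral over any part of the interval is at most the L1 norm, hence the constant
  does not depend on \<open>t\<close>. This uniformity later becomes the pointwise bound on
  functions in the domain.\<close>

lemma prim_bound: "\<exists>K\<ge>0. \<forall>t. \<forall>f\<in>X. \<bar>prim a f t\<bar> \<le> K * nrm f"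
proof -
  obtain m where m: "m > 0" "\<forall>u. sq_on a b u \<longrightarrow> m * (\<integral>x. (u x)\<^sup>2 \<partial>lborel) \<le> ip (aeclass u) (aeclass u)"
    using ip_lower_bound by blast
  let ?K = "sqrt (b - a) * sqrt (1 / m)"
  have "\<bar>prim a f t\<bar> \<le> ?K * nrm f" if fX: "f \<in> X" for f t
  proof -
    obtain u where u: "sq_on a b u" "f = aeclass u" using fX by (rule L2_rep)
    note [measurable] = sq_on_measurable[OF u(1)]
    have int: "integrable lborel (\<lambda>x. indicator {a..t} x * u x)"
      by (rule Bochner_Integration.integrable_bound[OF sq_on_integrable[OF u(1)]]) (auto simp: indicator_def)
    have "\<bar>prim a f t\<bar> = \<bar>\<integral>x. indicator {a..t} x * u x \<partial>lborel\<bar>"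
      by (simp add: u prim_aeclass)
    also have "\<dots> \<le> (\<integral>x. \<bar>indicator {a..t} x * u x\<bar> \<partial>lborel)"
      by (rule integral_abs_bound)
    also have "\<dots> \<le> (\<integral>x. \<bar>u x\<bar> \<partial>lborel)"
      using int sq_on_integrable[OF u(1)] by (intro integral_mono) (auto simp: indicator_def)
    also have "\<dots> \<le> sqrt (b - a) * sqrt (\<integral>x. (u x)\<^sup>2 \<partial>lborel)" by (rule L1_le_L2[OF u(1)])
    also have "\<dots> \<le> sqrt (b - a) * sqrt (1 / m * ip f f)"
    proof -
      have "m * (\<integral>x. (u x)\<^sup>2 \<partial>lborel) \<le> ip f f" using m(2) u by blast
      then have "(\<integral>x. (u x)\<^sup>2 \<partial>lborel) \<le> 1 / m * ip f f" using m(1) by (simp add: field_simps)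
      then show ?thesis using ab by (intro mult_left_mono real_sqrt_le_mono) auto
    qed
    also have "\<dots> = ?K * nrm f" by (simp only: real_sqrt_mult ip_norm_def mult.assoc)
    finally show ?thesis .
  qed
  moreover have "?K \<ge> 0" using m(1) ab by simp
  ultimately show ?thesis by blast
qed

lemma nrm_aeclass_on_le:
  assumes k: "continuous_on {a..b} k" and C: "\<And>x. x \<in> {a..b} \<Longrightarrow> \<bar>k x\<bar> \<le> C"
  shows "nrm (aeclass_on a b k) \<le> C * nrm one"
proof -
  have "aeclass_on a b k * one = aeclass_on a b k"
    unfolding one_def using aeclass_on_mult[OF k, of "\<lambda>_. 1"] by simp
  then show ?thesis using nrm_mult_le[OF k C one_in] by simp
qed

lemma nrm_volterra_le: "\<exists>K\<ge>0. \<forall>f\<in>X. nrm (volterra f) \<le> K * nrm f"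
proof -
  obtain K where K: "K \<ge> 0" "\<forall>t. \<forall>f\<in>X. \<bar>prim a f t\<bar> \<le> K * nrm f" using prim_bound by blast
  have "nrm (volterra f) \<le> (K * nrm one) * nrm f" if "f \<in> X" for f
    using nrm_aeclass_on_le[OF prim_continuous[OF that], of "K * nrm f"] K that
    by (simp add: volterra_def mult_ac)
  then show ?thesis using K(1) by (intro exI[of _ "K * nrm one"]) simp
qed

text \<open>Linearity is joint in the pair \<open>(f, g)\<close>, not in each argument; in \<open>pair_fun\<close> the bound is
  uniform over the index set.\<close>

definition pair_op :: "(aefun \<Rightarrow> aefun \<Rightarrow> aefun) \<Rightarrow> bool" where
  "pair_op \<Phi> \<longleftrightarrow> (\<forall>f\<in>X. \<forall>g\<in>X. \<Phi> f g \<in> X) \<and>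
     (\<forall>f\<in>X. \<forall>g\<in>X. \<forall>f'\<in>X. \<forall>g'\<in>X. \<Phi> (f + f') (g + g') = \<Phi> f g + \<Phi> f' g') \<and>
     (\<forall>r. \<forall>f\<in>X. \<forall>g\<in>X. \<Phi> (r *\<^sub>R f) (r *\<^sub>R g) = r *\<^sub>R \<Phi> f g) \<and>
     (\<exists>K. \<forall>f\<in>X. \<forall>g\<in>X. nrm (\<Phi> f g) \<le> K * (nrm f + nrm g))"

definition pair_fun :: "'i set \<Rightarrow> ('i \<Rightarrow> aefun \<Rightarrow> aefun \<Rightarrow> real) \<Rightarrow> bool" where
  "pair_fun I \<Lambda> \<longleftrightarrow>
     (\<forall>i\<in>I. \<forall>f\<in>X. \<forall>g\<in>X. \<forall>f'\<in>X. \<forall>g'\<in>X. \<Lambda> i (f + f') (g + g') = \<Lambda> i f g + \<Lambda> i f' g') \<and>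
     (\<forall>i\<in>I. \<forall>r. \<forall>f\<in>X. \<forall>g\<in>X. \<Lambda> i (r *\<^sub>R f) (r *\<^sub>R g) = r * \<Lambda> i f g) \<and>
     (\<exists>K. \<forall>i\<in>I. \<forall>f\<in>X. \<forall>g\<in>X. \<bar>\<Lambda> i f g\<bar> \<le> K * (nrm f + nrm g))"

lemma pair_opI:
  assumes "\<And>f g. f \<in> X \<Longrightarrow> g \<in> X \<Longrightarrow> \<Phi> f g \<in> X"
    and "\<And>f g f' g'. f \<in> X \<Longrightarrow> g \<in> X \<Longrightarrow> f' \<in> X \<Longrightarrow> g' \<in> X \<Longrightarrow> \<Phi> (f + f') (g + g') = \<Phi> f g + \<Phi> f' g'"
    and "\<And>r f g. f \<in> X \<Longrightarrow> g \<in> X \<Longrightarrow> \<Phi> (r *\<^sub>R f) (r *\<^sub>R g) = r *\<^sub>R \<Phi> f g"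
    and "\<And>f g. f \<in> X \<Longrightarrow> g \<in> X \<Longrightarrow> nrm (\<Phi> f g) \<le> K * (nrm f + nrm g)"
  shows "pair_op \<Phi>"
  unfolding pair_op_def by (intro conjI ballI allI exI[of _ K] assms)

lemma pair_funI:
  assumes "\<And>i f g f' g'. i \<in> I \<Longrightarrow> f \<in> X \<Longrightarrow> g \<in> X \<Longrightarrow> f' \<in> X \<Longrightarrow> g' \<in> X \<Longrightarrow>
      \<Lambda> i (f + f') (g + g') = \<Lambda> i f g + \<Lambda> i f' g'"
    and "\<And>i r f g. i \<in> I \<Longrightarrow> f \<in> X \<Longrightarrow> g \<in> X \<Longrightarrow> \<Lambda> i (r *\<^sub>R f) (r *\<^sub>R g) = r * \<Lambda> i f g"
    and "\<And>i f g. i \<in> I \<Longrightarrow> f \<in> X \<Longrightarrow> g \<in> X \<Longrightarrow> \<bar>\<Lambda> i f g\<bar> \<le> K * (nrm f + nrm g)"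
  shows "pair_fun I \<Lambda>"
  unfolding pair_fun_def by (intro conjI ballI allI exI[of _ K] assms)

lemma
  assumes "pair_op \<Phi>"
  shows pair_op_in: "\<And>f g. f \<in> X \<Longrightarrow> g \<in> X \<Longrightarrow> \<Phi> f g \<in> X"
    and pair_op_add: "\<And>f g f' g'. f \<in> X \<Longrightarrow> g \<in> X \<Longrightarrow> f' \<in> X \<Longrightarrow> g' \<in> X \<Longrightarrow> \<Phi> (f + f') (g + g') = \<Phi> f g + \<Phi> f' g'"
    and pair_op_scale: "\<And>r f g. f \<in> X \<Longrightarrow> g \<in> X \<Longrightarrow> \<Phi> (r *\<^sub>R f) (r *\<^sub>R g) = r *\<^sub>R \<Phi> f g"
    and pair_op_bound: "\<exists>K. \<forall>f\<in>X. \<forall>g\<in>X. nrm (\<Phi> f g) \<le> K * (nrm f + nrm g)"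
  using assms unfolding pair_op_def by blast+

lemma
  assumes "pair_fun I \<Lambda>"
  shows pair_fun_add: "\<And>i f g f' g'. i \<in> I \<Longrightarrow> f \<in> X \<Longrightarrow> g \<in> X \<Longrightarrow> f' \<in> X \<Longrightarrow> g' \<in> X \<Longrightarrow>
      \<Lambda> i (f + f') (g + g') = \<Lambda> i f g + \<Lambda> i f' g'"
    and pair_fun_scale: "\<And>i r f g. i \<in> I \<Longrightarrow> f \<in> X \<Longrightarrow> g \<in> X \<Longrightarrow> \<Lambda> i (r *\<^sub>R f) (r *\<^sub>R g) = r * \<Lambda> i f g"
    and pair_fun_bound: "\<exists>K. \<forall>i\<in>I. \<forall>f\<in>X. \<forall>g\<in>X. \<bar>\<Lambda> i f g\<bar> \<le> K * (nrm f + nrm g)"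
  using assms unfolding pair_fun_def by blast+

lemma pair_op_fst: "pair_op (\<lambda>f g. f)"
  by (rule pair_opI[of _ 1]) auto

lemma pair_op_snd: "pair_op (\<lambda>f g. g)"
  by (rule pair_opI[of _ 1]) auto

lemma pair_op_compose:
  assumes \<Phi>: "pair_op \<Phi>" and B: "\<And>f. f \<in> X \<Longrightarrow> B f \<in> X"
    "\<And>f g. f \<in> X \<Longrightarrow> g \<in> X \<Longrightarrow> B (f + g) = B f + B g" "\<And>r f. f \<in> X \<Longrightarrow> B (r *\<^sub>R f) = r *\<^sub>R B f"
    and bd: "\<exists>K\<ge>0. \<forall>f\<in>X. nrm (B f) \<le> K * nrm f"
  shows "pair_op (\<lambda>f g. B (\<Phi> f g))"
proof -
  obtain K where K: "\<forall>f\<in>X. \<forall>g\<in>X. nrm (\<Phi> f g) \<le> K * (nrm f + nrm g)" using pair_op_bound[OF \<Phi>] by blast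
  obtain L where L: "L \<ge> 0" "\<forall>f\<in>X. nrm (B f) \<le> L * nrm f" using bd by blast
  show ?thesis
  proof (rule pair_opI[of _ "L * K"])
    fix f g assume f: "f \<in> X" and g: "g \<in> X"
    have "nrm (B (\<Phi> f g)) \<le> L * nrm (\<Phi> f g)" using L(2) pair_op_in[OF \<Phi> f g] by blast
    also have "\<dots> \<le> L * (K * (nrm f + nrm g))" using K f g L(1) by (intro mult_left_mono) auto
    finally show "nrm (B (\<Phi> f g)) \<le> L * K * (nrm f + nrm g)" by (simp only: mult.assoc)
  qed (simp_all add: B pair_op_in[OF \<Phi>] pair_op_add[OF \<Phi>] pair_op_scale[OF \<Phi>])
qed

lemma pair_op_volterra: "pair_op \<Phi> \<Longrightarrow> pair_op (\<lambda>f g. volterra (\<Phi> f g))"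
  by (erule pair_op_compose[OF _ volterra_in volterra_add volterra_scale nrm_volterra_le])

lemma pair_op_mult:
  assumes \<Phi>: "pair_op \<Phi>" and k: "continuous_on {a..b} k"
  shows "pair_op (\<lambda>f g. aeclass_on a b k * \<Phi> f g)"
proof (rule pair_op_compose[OF \<Phi>])
  obtain C where C: "\<forall>x\<in>{a..b}. \<bar>k x\<bar> \<le> C" using continuous_bounded_on[OF k] by blast
  have "C \<ge> 0" using bspec[OF C, of a] ab by auto
  then show "\<exists>K\<ge>0. \<forall>f\<in>X. nrm (aeclass_on a b k * f) \<le> K * nrm f"
    using nrm_mult_le[OF k] C by blast
qed (simp_all add: aeclass_on_mult_L2 k distrib_left)

lemma pair_op_plus:
  assumes \<Phi>: "pair_op \<Phi>" and \<Psi>: "pair_op \<Psi>"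
  shows "pair_op (\<lambda>f g. \<Phi> f g + \<Psi> f g)"
proof -
  obtain K where K: "\<forall>f\<in>X. \<forall>g\<in>X. nrm (\<Phi> f g) \<le> K * (nrm f + nrm g)" using pair_op_bound[OF \<Phi>] by blast
  obtain L where L: "\<forall>f\<in>X. \<forall>g\<in>X. nrm (\<Psi> f g) \<le> L * (nrm f + nrm g)" using pair_op_bound[OF \<Psi>] by blast
  show ?thesis
  proof (rule pair_opI[of _ "K + L"])
    fix f g assume f: "f \<in> X" and g: "g \<in> X"
    have "nrm (\<Phi> f g + \<Psi> f g) \<le> nrm (\<Phi> f g) + nrm (\<Psi> f g)"
      by (intro nrm_triangle pair_op_in[OF \<Phi>] pair_op_in[OF \<Psi>] f g)
    also have "\<dots> \<le> K * (nrm f + nrm g) + L * (nrm f + nrm g)" using K L f g by (intro add_mono) auto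
    finally show "nrm (\<Phi> f g + \<Psi> f g) \<le> (K + L) * (nrm f + nrm g)" by (simp only: distrib_right)
  qed (simp_all add: pair_op_in[OF \<Phi>] pair_op_add[OF \<Phi>] pair_op_scale[OF \<Phi>] pair_op_in[OF \<Psi>] pair_op_add[OF \<Psi>] pair_op_scale[OF \<Psi>]
      scaleR_add_right)
qed

lemma pair_op_rscale: "pair_op \<Phi> \<Longrightarrow> pair_op (\<lambda>f g. r *\<^sub>R \<Phi> f g)"
  by (erule pair_op_compose) (auto simp: scaleR_add_right nrm_scale intro: exI[of _ "\<bar>r\<bar>"])

lemma pair_op_minus: "pair_op \<Phi> \<Longrightarrow> pair_op \<Psi> \<Longrightarrow> pair_op (\<lambda>f g. \<Phi> f g - \<Psi> f g)"
  using pair_op_plus[OF _ pair_op_rscale[of \<Psi> "-1"], of \<Phi>] by simp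

lemma pair_op_functional:
  assumes \<Lambda>: "pair_fun {()} (\<lambda>_. \<Lambda>)" and x: "x \<in> X"
  shows "pair_op (\<lambda>f g. \<Lambda> f g *\<^sub>R x)"
proof -
  obtain K where K: "\<forall>f\<in>X. \<forall>g\<in>X. \<bar>\<Lambda> f g\<bar> \<le> K * (nrm f + nrm g)" using pair_fun_bound[OF \<Lambda>] by auto
  show ?thesis
  proof (rule pair_opI[of _ "K * nrm x"])
    fix f g assume f: "f \<in> X" and g: "g \<in> X"
    have "\<bar>\<Lambda> f g\<bar> * nrm x \<le> K * (nrm f + nrm g) * nrm x" using K f g x by (intro mult_right_mono) auto
    then show "nrm (\<Lambda> f g *\<^sub>R x) \<le> K * nrm x * (nrm f + nrm g)" using x by (simp add: nrm_scale mult_ac)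
  qed (use x pair_fun_add[OF \<Lambda>] pair_fun_scale[OF \<Lambda>] in \<open>auto simp: scaleR_add_left\<close>)
qed

lemma pair_fun_ip:
  assumes \<Phi>: "pair_op \<Phi>" and x: "x \<in> X"
  shows "pair_fun I (\<lambda>_ f g. ip (\<Phi> f g) x)"
proof -
  obtain K where K: "\<forall>f\<in>X. \<forall>g\<in>X. nrm (\<Phi> f g) \<le> K * (nrm f + nrm g)" using pair_op_bound[OF \<Phi>] by blast
  show ?thesis
  proof (rule pair_funI[of _ _ "K * nrm x"])
    fix f g assume f: "f \<in> X" and g: "g \<in> X"
    have "\<bar>ip (\<Phi> f g) x\<bar> \<le> nrm (\<Phi> f g) * nrm x" by (intro Cauchy_Schwarz pair_op_in[OF \<Phi>] f g x)
    also have "\<dots> \<le> K * (nrm f + nrm g) * nrm x" using K f g x by (intro mult_right_mono) auto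
    finally show "\<bar>ip (\<Phi> f g) x\<bar> \<le> K * nrm x * (nrm f + nrm g)" by (simp only: mult_ac)
  qed (simp_all add: x pair_op_in[OF \<Phi>] pair_op_add[OF \<Phi>] pair_op_scale[OF \<Phi>] ip_add_left ip_scale_left)
qed

lemma pair_fun_prim:
  assumes \<Phi>: "pair_op \<Phi>"
  shows "pair_fun I (\<lambda>t f g. prim a (\<Phi> f g) t)"
proof -
  obtain K where K: "\<forall>f\<in>X. \<forall>g\<in>X. nrm (\<Phi> f g) \<le> K * (nrm f + nrm g)" using pair_op_bound[OF \<Phi>] by blast
  obtain L where L: "L \<ge> 0" "\<forall>t. \<forall>f\<in>X. \<bar>prim a f t\<bar> \<le> L * nrm f" using prim_bound by blast
  show ?thesis
  proof (rule pair_funI[of _ _ "L * K"])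
    fix t f g assume f: "f \<in> X" and g: "g \<in> X"
    have "\<bar>prim a (\<Phi> f g) t\<bar> \<le> L * nrm (\<Phi> f g)" using L(2) pair_op_in[OF \<Phi> f g] by blast
    also have "\<dots> \<le> L * (K * (nrm f + nrm g))" using K f g L(1) by (intro mult_left_mono) auto
    finally show "\<bar>prim a (\<Phi> f g) t\<bar> \<le> L * K * (nrm f + nrm g)" by (simp only: mult.assoc)
  qed (simp_all add: pair_op_add[OF \<Phi>] pair_op_scale[OF \<Phi>] prim_add[OF pair_op_in[OF \<Phi>] pair_op_in[OF \<Phi>]]
      prim_scale[OF pair_op_in[OF \<Phi>]])
qed

lemma pair_fun_plus:
  assumes \<Phi>: "pair_fun I \<Phi>" and \<Psi>: "pair_fun I \<Psi>"
  shows "pair_fun I (\<lambda>i f g. \<Phi> i f g + \<Psi> i f g)"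
proof -
  obtain K where K: "\<forall>i\<in>I. \<forall>f\<in>X. \<forall>g\<in>X. \<bar>\<Phi> i f g\<bar> \<le> K * (nrm f + nrm g)" using pair_fun_bound[OF \<Phi>] by blast
  obtain L where L: "\<forall>i\<in>I. \<forall>f\<in>X. \<forall>g\<in>X. \<bar>\<Psi> i f g\<bar> \<le> L * (nrm f + nrm g)" using pair_fun_bound[OF \<Psi>] by blast
  show ?thesis
  proof (rule pair_funI[of _ _ "K + L"])
    fix i f g assume i: "i \<in> I" "f \<in> X" "g \<in> X"
    have "\<bar>\<Phi> i f g + \<Psi> i f g\<bar> \<le> \<bar>\<Phi> i f g\<bar> + \<bar>\<Psi> i f g\<bar>" by (rule abs_triangle_ineq)
    also have "\<dots> \<le> K * (nrm f + nrm g) + L * (nrm f + nrm g)" using K L i by (intro add_mono) auto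
    finally show "\<bar>\<Phi> i f g + \<Psi> i f g\<bar> \<le> (K + L) * (nrm f + nrm g)" by (simp only: distrib_right)
  qed (simp_all add: pair_fun_add[OF \<Phi>] pair_fun_scale[OF \<Phi>] pair_fun_add[OF \<Psi>] pair_fun_scale[OF \<Psi>] distrib_left)
qed

lemma pair_fun_mult:
  assumes \<Phi>: "pair_fun I \<Phi>" and C: "\<And>i. i \<in> I \<Longrightarrow> \<bar>k i\<bar> \<le> C"
  shows "pair_fun I (\<lambda>i f g. k i * \<Phi> i f g)"
proof -
  obtain K where K: "\<forall>i\<in>I. \<forall>f\<in>X. \<forall>g\<in>X. \<bar>\<Phi> i f g\<bar> \<le> K * (nrm f + nrm g)" using pair_fun_bound[OF \<Phi>] by blast
  show ?thesis
  proof (rule pair_funI[of _ _ "C * K"])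
    fix i f g assume i: "i \<in> I" "f \<in> X" "g \<in> X"
    have "\<bar>k i * \<Phi> i f g\<bar> \<le> C * (K * (nrm f + nrm g))"
      unfolding abs_mult using K C[OF i(1)] i by (intro mult_mono) (auto intro: order_trans[OF abs_ge_zero])
    then show "\<bar>k i * \<Phi> i f g\<bar> \<le> C * K * (nrm f + nrm g)" by (simp only: mult.assoc)
  qed (simp_all add: pair_fun_add[OF \<Phi>] pair_fun_scale[OF \<Phi>] distrib_left)
qed

lemma pair_fun_cmult: "pair_fun I \<Phi> \<Longrightarrow> pair_fun I (\<lambda>i f g. c * \<Phi> i f g)"
  by (rule pair_fun_mult[where k="\<lambda>_. c" and C="\<bar>c\<bar>"]) auto

lemma pair_fun_at:
  assumes \<Lambda>: "pair_fun I \<Lambda>" and i: "i \<in> I"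
  shows "pair_fun J (\<lambda>_. \<Lambda> i)"
proof -
  obtain K where K: "\<forall>i\<in>I. \<forall>f\<in>X. \<forall>g\<in>X. \<bar>\<Lambda> i f g\<bar> \<le> K * (nrm f + nrm g)" using pair_fun_bound[OF \<Lambda>] by blast
  show ?thesis
    by (rule pair_funI[of _ _ K]) (use K i in \<open>simp_all add: pair_fun_add[OF \<Lambda>] pair_fun_scale[OF \<Lambda>]\<close>)
qed

lemma pair_fun_sum:
  assumes \<Lambda>: "pair_fun I \<Lambda>" "i \<in> I" and F: "finite F" "\<And>n. n \<in> F \<Longrightarrow> f n \<in> X" "\<And>n. n \<in> F \<Longrightarrow> g n \<in> X"
  shows "\<Lambda> i (\<Sum>n\<in>F. c n *\<^sub>R f n) (\<Sum>n\<in>F. c n *\<^sub>R g n) = (\<Sum>n\<in>F. c n * \<Lambda> i (f n) (g n))"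
  using F
proof (induction F rule: finite_induct)
  case empty
  show ?case using pair_fun_scale[OF \<Lambda>, of 0 0 0] by simp
next
  case (insert n F)
  then show ?case
    by (simp add: pair_fun_add[OF \<Lambda>] pair_fun_scale[OF \<Lambda>])
qed

text \<open>By joint linearity the value at the limit pair is minus the value at the error pair,
  which the norm bound sends to zero.\<close>

lemma pair_fun_kernel_closed:
  assumes \<Lambda>: "pair_fun {()} (\<lambda>_. \<Lambda>)" and uv: "\<And>n::nat. u n \<in> X" "\<And>n. v n \<in> X" "f \<in> X" "g \<in> X"
    and lim: "ip_lim ip u f sequentially" "ip_lim ip v g sequentially"
    and ker: "\<And>n. \<Lambda> (u n) (v n) = 0"
  shows "\<Lambda> f g = 0"
proof -
  obtain K where K: "\<forall>f\<in>X. \<forall>g\<in>X. \<bar>\<Lambda> f g\<bar> \<le> K * (nrm f + nrm g)" using pair_fun_bound[OF \<Lambda>] by auto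
  have eq: "\<Lambda> f g = - \<Lambda> (u n - f) (v n - g)" for n
    using pair_fun_add[OF \<Lambda>, of "()" "u n - f" "v n - g" f g] ker[of n] uv by simp
  have "(\<lambda>n. K * (nrm (u n - f) + nrm (v n - g))) \<longlonglongrightarrow> K * (0 + 0)"
    using lim unfolding ip_lim_def by (intro tendsto_intros)
  moreover have "\<bar>\<Lambda> f g\<bar> \<le> K * (nrm (u n - f) + nrm (v n - g))" for n
    unfolding eq[of n] abs_minus using K uv by auto
  ultimately have "\<bar>\<Lambda> f g\<bar> \<le> K * (0 + 0)"
    by (intro tendsto_le[OF sequentially_bot _ tendsto_const]) auto
  then show ?thesis by simp
qed

end

section \<open>The graph of the Sturm--Liouville operator\<close>

locale Sturm_Liouville = weighted_L2 a b \<rho> for a b :: real and \<rho> :: "real \<Rightarrow> real" +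
  fixes p p' q :: "real \<Rightarrow> real" and \<alpha>\<^sub>a \<beta>\<^sub>a \<alpha>\<^sub>b \<beta>\<^sub>b :: real
  assumes p_deriv: "z \<in> {a..b} \<Longrightarrow> (p has_real_derivative p' z) (at z within {a..b})"
    and p'_cont: "continuous_on {a..b} p'" and q_cont: "continuous_on {a..b} q"
    and p_pos: "z \<in> {a..b} \<Longrightarrow> p z > 0"
begin

abbreviation "A f \<equiv> - SL_op a b p q \<rho> f"
abbreviation "DA \<equiv> SL_dom a b \<alpha>\<^sub>a \<beta>\<^sub>a \<alpha>\<^sub>b \<beta>\<^sub>b"
abbreviation "M k f \<equiv> aeclass_on a b k * f"

lemma p_cont: "continuous_on {a..b} p" using p_deriv by (rule DERIV_continuous_on)

lemma p_nz: "z \<in> {a..b} \<Longrightarrow> p z \<noteq> 0" using p_pos[of z] by simp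

lemma inv_p_cont: "continuous_on {a..b} (\<lambda>x. 1 / p x)"
  using p_cont p_nz by (intro continuous_intros) auto

lemma inv_\<rho>_cont: "continuous_on {a..b} (\<lambda>x. 1 / \<rho> x)"
  using \<rho>_pos by (intro continuous_intros \<rho>_cont) force

lemma M_cancel:
  assumes "continuous_on {a..b} k" "continuous_on {a..b} l" "f \<in> X" "\<And>x. x \<in> {a..b} \<Longrightarrow> k x * l x = 1"
  shows "M k (M l f) = f"
proof -
  have "M k (M l f) = aeclass_on a b (\<lambda>x. k x * l x) * f"
    by (simp add: aeclass_on_mult[OF assms(1,2), symmetric] mult.assoc)
  also have "aeclass_on a b (\<lambda>x. k x * l x) = aeclass_on a b (\<lambda>x. 1)" by (rule aeclass_on_cong[OF assms(4)])
  finally show ?thesis using aeclass_on_1_mult[OF assms(3)] by simp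
qed

lemma M_inv_p: "f \<in> X \<Longrightarrow> M (\<lambda>x. 1 / p x) (M p f) = f" "f \<in> X \<Longrightarrow> M p (M (\<lambda>x. 1 / p x) f) = f"
  using p_nz by (intro M_cancel inv_p_cont p_cont; simp)+

lemma M_inv_\<rho>: "f \<in> X \<Longrightarrow> M (\<lambda>x. 1 / \<rho> x) (M \<rho> f) = f" "f \<in> X \<Longrightarrow> M \<rho> (M (\<lambda>x. 1 / \<rho> x) f) = f"
  using \<rho>_pos by (intro M_cancel inv_\<rho>_cont \<rho>_cont; force)+

lemma M_neg_p: "aeclass_on a b (\<lambda>x. - p x) = - aeclass_on a b p"
  using aeclass_on_scale[OF p_cont, of "-1"] by simp

text \<open>The signs are those of \<open>(p f')' = q f + \<rho> g\<close>, since \<open>A\<close>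
  is the negative of \<open>SL_op\<close>.\<close>

definition rhs :: "aefun \<Rightarrow> aefun \<Rightarrow> aefun" where "rhs f g = M q f + M \<rho> g"

text \<open>The candidate for \<open>f'\<close>: the flux \<open>p f'\<close> starts at
  \<open>a\<close> with the value \<open>c\<close>, has derivative \<open>h\<close>, and is then
  divided by \<open>p\<close>.\<close>

definition slope :: "real \<Rightarrow> aefun \<Rightarrow> aefun" where
  "slope c h = M (\<lambda>x. 1 / p x) (c *\<^sub>R one + volterra h)"

lemma rhs_in [simp]: "f \<in> X \<Longrightarrow> g \<in> X \<Longrightarrow> rhs f g \<in> X"
  unfolding rhs_def by (intro S_add aeclass_on_mult_L2 q_cont \<rho>_cont)

lemma slope_in [simp]: "h \<in> X \<Longrightarrow> slope c h \<in> X"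
  unfolding slope_def by (intro aeclass_on_mult_L2 inv_p_cont S_add S_scale volterra_in one_in)

lemma slope_eq:
  assumes "h \<in> X"
  shows "slope c h = aeclass_on a b (\<lambda>x. (c + prim a h x) / p x)"
proof -
  have c: "continuous_on {a..b} (\<lambda>x. c + prim a h x)" by (intro continuous_intros prim_continuous[OF assms])
  show ?thesis
    unfolding slope_def aeclass_on_const_prim[OF assms, symmetric] aeclass_on_mult[OF inv_p_cont c] by simp
qed

lemma slope_continuous:
  assumes "h \<in> X"
  shows "continuous_on {a..b} (\<lambda>x. (c + prim a h x) / p x)"
  using p_cont p_nz prim_continuous[OF assms] by (intro continuous_intros) auto

text \<open>The boundary value problem integrated twice, with \<open>c\<close> in the role of
  \<open>(p f')(a)\<close> and \<open>d\<close> in that of \<open>f(a)\<close>. At either end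
  \<open>f'\<close> is written as the flux over \<open>p\<close>, so that no point value of a class
  occurs.\<close>

definition solves :: "aefun \<Rightarrow> aefun \<Rightarrow> real \<Rightarrow> real \<Rightarrow> bool" where
  "solves f g c d \<longleftrightarrow> f = d *\<^sub>R one + volterra (slope c (rhs f g)) \<and>
     \<alpha>\<^sub>a * (c / p a) + \<beta>\<^sub>a * d = 0 \<and>
     \<alpha>\<^sub>b * ((c + prim a (rhs f g) b) / p b) + \<beta>\<^sub>b * (d + prim a (slope c (rhs f g)) b) = 0"

lemma solves_imp_graph:
  assumes f: "f \<in> X" and g: "g \<in> X" and s: "solves f g c d"
  shows "f \<in> DA \<and> A f = g"
proof -
  define h where "h = rhs f g"
  define f1 where "f1 = slope c h"
  have h: "h \<in> X" and f1: "f1 \<in> X" using f g by (simp_all add: h_def f1_def)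
  have fe: "f = aeclass_on a b (\<lambda>x. d + prim a f1 x)"
    using s unfolding aeclass_on_const_prim[OF f1] by (simp add: solves_def h_def f1_def)
  have fH1: "f \<in> H1 a b" and wf: "weak_deriv a b f = f1"
    using weak_deriv_aeclass_on_prim[OF f1 ab, of d] unfolding fe by auto
  let ?F = "c *\<^sub>R one + volterra h"
  have F: "?F \<in> X" using h by simp
  have "is_weak_deriv a b ?F h"
    using is_weak_deriv_prim'[OF h ab, of c] by (simp add: aeclass_on_const_prim[OF h])
  \<comment> \<open>\<open>f'\<close> is the quotient of an H1 function by the continuously
    differentiable \<open>p\<close>; the product rule with \<open>1 / p\<close> puts it in H1, as
    membership of \<open>f\<close> in \<open>H2\<close> demands.\<close>
  then have "is_weak_deriv a b f1 (M (\<lambda>x. - p' x / (p x)\<^sup>2) ?F + M (\<lambda>x. 1 / p x) h)"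
    unfolding f1_def slope_def
  proof (rule is_weak_deriv_mult[OF F h])
    show "((\<lambda>x. 1 / p x) has_real_derivative - p' x / (p x)\<^sup>2) (at x within {a..b})" if "x \<in> {a..b}" for x
      using p_deriv[OF that] p_nz[OF that] by (auto intro!: derivative_eq_intros simp: power2_eq_square)
    show "continuous_on {a..b} (\<lambda>x. - p' x / (p x)\<^sup>2)"
      using p_nz by (intro continuous_intros p_cont p'_cont) auto
  qed
  moreover have "M (\<lambda>x. - p' x / (p x)\<^sup>2) ?F + M (\<lambda>x. 1 / p x) h \<in> X"
    using p_nz by (intro S_add aeclass_on_mult_L2 F h inv_p_cont continuous_intros p_cont p'_cont) auto
  ultimately have f1H: "f1 \<in> H1 a b" using f1 unfolding H1_def by blast
  \<comment> \<open>Multiplying by \<open>p\<close> undoes the division in \<open>slope\<close>, so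
    the flux is again an explicit primitive and its weak derivative can be read off.\<close>
  have "- (M p f1) = aeclass_on a b (\<lambda>x. - c + prim a (- h) x)"
    using volterra_scale[OF h, of "-1"] M_inv_p(2)[OF F] h
    by (subst aeclass_on_const_prim) (simp_all add: f1_def slope_def)
  then have "weak_deriv a b (- (M p f1)) = - h"
    using weak_deriv_aeclass_on_prim(2)[OF S_neg[OF h] ab, of "- c"] by simp
  then have "SL_op a b p q \<rho> f = M (\<lambda>x. 1 / \<rho> x) (- M \<rho> g)"
    by (simp add: SL_op_def wf h_def rhs_def)
  then have A: "A f = g" using M_inv_\<rho>(1)[OF g] by simp
  have c1: "continuous_on {a..b} (\<lambda>x. d + prim a f1 x)" by (intro continuous_intros prim_continuous[OF f1])
  have v0: "pt_value a b f x = d + prim a f1 x" if "x \<in> {a..b}" for x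
    unfolding fe by (rule pt_value_aeclass_on[OF c1 ab that])
  have v1: "pt_value a b f1 x = (c + prim a h x) / p x" if "x \<in> {a..b}" for x
    unfolding f1_def slope_eq[OF h] by (rule pt_value_aeclass_on[OF slope_continuous[OF h] ab that])
  have "\<alpha>\<^sub>a * pt_value a b f1 a + \<beta>\<^sub>a * pt_value a b f a = 0"
    "\<alpha>\<^sub>b * pt_value a b f1 b + \<beta>\<^sub>b * pt_value a b f b = 0"
    using s ab v0[of a] v0[of b] v1[of a] v1[of b] prim_left[OF h] prim_left[OF f1]
    unfolding solves_def h_def[symmetric] f1_def[symmetric] by simp_all
  then have "f \<in> DA"
    using fH1 f1H unfolding SL_dom_def H2_def by (simp add: wf)
  with A show ?thesis by blast
qed

lemma graph_imp_solves:
  assumes f: "f \<in> X" and g: "g \<in> X" and D: "f \<in> DA" and A: "A f = g"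
  shows "\<exists>c d. solves f g c d"
proof -
  define h where "h = rhs f g"
  have h: "h \<in> X" using f g by (simp add: h_def)
  define f1 where "f1 = weak_deriv a b f"
  define f2 where "f2 = weak_deriv a b f1"
  have H: "f \<in> H1 a b" "f1 \<in> H1 a b" using D by (auto simp: SL_dom_def H2_def f1_def)
  obtain d where d: "f1 \<in> X" "f = aeclass_on a b (\<lambda>x. d + prim a f1 x)"
    using H1_E[OF H(1) ab] unfolding f1_def by metis
  have f2: "f2 \<in> X" "is_weak_deriv a b f1 f2"
    using H1_E[OF H(2) ab] unfolding f2_def by metis+
  let ?r = "M (\<lambda>x. - p' x) f1 + M (\<lambda>x. - p x) f2"
  have r: "?r \<in> X" by (intro S_add aeclass_on_mult_L2 d f2 continuous_intros p'_cont p_cont)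
  have pf: "M (\<lambda>x. - p x) f1 \<in> X" by (intro aeclass_on_mult_L2 d continuous_intros p_cont)
  have wd: "is_weak_deriv a b (M (\<lambda>x. - p x) f1) ?r"
    by (rule is_weak_deriv_mult[OF d(1) f2]) (auto intro!: derivative_eq_intros p_deriv continuous_intros p'_cont)
  then have wr: "weak_deriv a b (- (M p f1)) = ?r"
    using weak_deriv_eqI[OF pf ab r wd] by (simp add: M_neg_p)
  have "g = - M (\<lambda>x. 1 / \<rho> x) (?r + M q f)"
    using A by (simp add: SL_op_def f1_def[symmetric] wr)
  then have "M \<rho> g = - M \<rho> (M (\<lambda>x. 1 / \<rho> x) (?r + M q f))" by simp
  also have "\<dots> = - (?r + M q f)"
    by (subst M_inv_\<rho>(2)) (intro S_add r aeclass_on_mult_L2 q_cont f, simp)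
  finally have rh: "?r = - h" by (simp add: h_def rhs_def)
  \<comment> \<open>\<open>C\<close> is the value at \<open>a\<close> of \<open>- p f'\<close>, with
    the sign inherited from \<open>SL_op\<close>; hence the constant \<open>c\<close> of
    \<open>solves\<close> is \<open>- C\<close>.\<close>
  obtain C where C: "M (\<lambda>x. - p x) f1 = aeclass_on a b (\<lambda>x. C + prim a (- h) x)"
    using is_weak_deriv_imp_prim[OF pf S_neg[OF h] ab wd[unfolded rh]] by metis
  have "M p f1 = (- C) *\<^sub>R one + volterra h"
  proof -
    have "- M p f1 = C *\<^sub>R one + volterra (- h)"
      using C unfolding aeclass_on_const_prim[OF S_neg[OF h]] M_neg_p by simp
    also have "volterra (- h) = - volterra h" using volterra_scale[OF h, of "-1"] by simp
    finally have "M p f1 = - (C *\<^sub>R one + - volterra h)" by (metis minus_minus)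
    then show ?thesis by simp
  qed
  then have f1: "f1 = slope (- C) h"
    using M_inv_p(1)[OF d(1)] by (simp add: slope_def)
  have c1: "continuous_on {a..b} (\<lambda>x. d + prim a f1 x)" by (intro continuous_intros prim_continuous[OF d(1)])
  have v0: "pt_value a b f x = d + prim a f1 x" if "x \<in> {a..b}" for x
    by (subst d(2)) (rule pt_value_aeclass_on[OF c1 ab that])
  have v1: "pt_value a b f1 x = (- C + prim a h x) / p x" if "x \<in> {a..b}" for x
    unfolding f1 slope_eq[OF h] by (rule pt_value_aeclass_on[OF slope_continuous[OF h] ab that])
  have "f = d *\<^sub>R one + volterra f1" using d aeclass_on_const_prim[OF d(1)] by simp
  moreover have "\<alpha>\<^sub>a * pt_value a b f1 a + \<beta>\<^sub>a * pt_value a b f a = 0"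
    "\<alpha>\<^sub>b * pt_value a b f1 b + \<beta>\<^sub>b * pt_value a b f b = 0"
    using D by (auto simp: SL_dom_def f1_def)
  moreover have "pt_value a b f a = d" "pt_value a b f b = d + prim a f1 b"
    "pt_value a b f1 a = - C / p a" "pt_value a b f1 b = (- C + prim a h b) / p b"
    using v0[of a] v0[of b] v1[of a] v1[of b] ab prim_left[OF d(1)] prim_left[OF h] by simp_all
  ultimately have "solves f g (- C) d"
    unfolding solves_def h_def[symmetric] f1[symmetric] by simp
  then show ?thesis by blast
qed

text \<open>\<open>one\<close> and \<open>hom_sol\<close> span the solutions of \<open>(p f')' = 0\<close>. Pairing with the component of
  \<open>hom_sol\<close> orthogonal to \<open>one\<close> recovers the constants \<open>(p f')(a)\<close> and \<open>f(a)\<close>, which makes them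
  bounded functionals.\<close>

definition hom_sol :: aefun where "hom_sol = volterra (M (\<lambda>x. 1 / p x) one)"
definition hom_sol_perp :: aefun where "hom_sol_perp = hom_sol - (ip hom_sol one / ip one one) *\<^sub>R one"
definition inhom_slope :: "aefun \<Rightarrow> aefun \<Rightarrow> aefun" where "inhom_slope f g = M (\<lambda>x. 1 / p x) (volterra (rhs f g))"
definition flux_at_a :: "aefun \<Rightarrow> aefun \<Rightarrow> real" where "flux_at_a f g = (1 / ip hom_sol_perp hom_sol_perp) * ip (f - volterra (inhom_slope f g)) hom_sol_perp"
definition value_at_a :: "aefun \<Rightarrow> aefun \<Rightarrow> real" where
  "value_at_a f g = (1 / ip one one) * ip (f - volterra (inhom_slope f g) - flux_at_a f g *\<^sub>R hom_sol) one"

lemma inv_p_one_in [simp]: "M (\<lambda>x. 1 / p x) one \<in> X"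
  by (intro aeclass_on_mult_L2 inv_p_cont one_in)

lemma hom_sol_in [simp]: "hom_sol \<in> X" by (simp add: hom_sol_def)

lemma hom_sol_perp_in [simp]: "hom_sol_perp \<in> X" by (simp add: hom_sol_perp_def)

lemma ip_one_hom_sol_perp: "ip one hom_sol_perp = 0"
  using ip_one_pos by (simp add: hom_sol_perp_def ip_diff_right ip_scale_right ip_commute[of one hom_sol])

lemma ip_hom_sol_hom_sol_perp: "ip hom_sol hom_sol_perp = ip hom_sol_perp hom_sol_perp"
proof -
  have "ip hom_sol_perp hom_sol_perp = ip hom_sol hom_sol_perp - (ip hom_sol one / ip one one) * ip one hom_sol_perp"
    by (subst (1) hom_sol_perp_def) (simp add: ip_diff_left ip_scale_left)
  then show ?thesis by (simp add: ip_one_hom_sol_perp)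
qed

text \<open>Were \<open>hom_sol\<close> a constant, its value 0 at \<open>a\<close> would make it
  zero, and then \<open>1 / p\<close>, of which it is the primitive, would vanish. So
  \<open>one\<close> and \<open>hom_sol\<close> are independent, and the division in
  \<open>flux_at_a\<close> is legitimate.\<close>

lemma ip_hom_sol_perp_pos: "ip hom_sol_perp hom_sol_perp > 0"
proof (rule ip_pos[OF hom_sol_perp_in], rule notI)
  assume "hom_sol_perp = 0"
  define r where "r = ip hom_sol one / ip one one"
  let ?i = "M (\<lambda>x. 1 / p x) one"
  have c: "continuous_on {a..b} (prim a ?i)" by (intro prim_continuous inv_p_one_in)
  have "aeclass_on a b (prim a ?i) = aeclass_on a b (\<lambda>x. r * 1)"
    using \<open>hom_sol_perp = 0\<close> aeclass_on_scale[of a b "\<lambda>_. 1" r]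
    by (simp add: hom_sol_perp_def r_def hom_sol_def volterra_def one_def)
  then have eq: "prim a ?i x = r" if "x \<in> {a..b}" for x
    using aeclass_on_eq_imp[OF c _ ab _ that, of "\<lambda>x. r * 1"] by simp
  then have "r = 0" using eq[of a] ab prim_left[OF inv_p_one_in] by simp
  then have "?i = 0" using eq by (intro prim_eq_0_imp[OF inv_p_one_in ab]) auto
  moreover have "?i = aeclass_on a b (\<lambda>x. 1 / p x)"
    unfolding one_def by (subst aeclass_on_mult[OF inv_p_cont]) auto
  moreover have "(0::aefun) = aeclass_on a b (\<lambda>x. 0)" by (simp add: aeclass_on_def aeclass_0)
  ultimately have "1 / p a = 0"
    using aeclass_on_eq_imp[OF inv_p_cont _ ab, of "\<lambda>x. 0" a] ab by auto
  then show False using p_nz[of a] ab by auto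
qed

lemma volterra_slope:
  assumes "f \<in> X" "g \<in> X"
  shows "volterra (slope c (rhs f g)) = c *\<^sub>R hom_sol + volterra (inhom_slope f g)"
proof -
  have 1: "M (\<lambda>x. 1 / p x) (volterra (rhs f g)) \<in> X"
    by (intro aeclass_on_mult_L2 inv_p_cont volterra_in rhs_in assms)
  have "slope c (rhs f g) = c *\<^sub>R M (\<lambda>x. 1 / p x) one + inhom_slope f g"
    by (simp add: slope_def inhom_slope_def distrib_left)
  then show ?thesis using 1
    by (simp add: volterra_add volterra_scale hom_sol_def inhom_slope_def)
qed

lemma inhom_slope_in [simp]: "f \<in> X \<Longrightarrow> g \<in> X \<Longrightarrow> inhom_slope f g \<in> X"
  unfolding inhom_slope_def by (intro aeclass_on_mult_L2 inv_p_cont volterra_in rhs_in)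

lemma solves_unique:
  assumes f: "f \<in> X" and g: "g \<in> X" and s: "solves f g c d"
  shows "c = flux_at_a f g" "d = value_at_a f g"
proof -
  have e: "f - volterra (inhom_slope f g) = d *\<^sub>R one + c *\<^sub>R hom_sol"
    using s volterra_slope[OF f g, of c] by (simp add: solves_def algebra_simps)
  show c: "c = flux_at_a f g"
    using ip_hom_sol_perp_pos unfolding flux_at_a_def e
    by (simp add: ip_add_left ip_scale_left ip_one_hom_sol_perp ip_hom_sol_hom_sol_perp)
  show "d = value_at_a f g"
    using ip_one_pos unfolding value_at_a_def e c[symmetric]
    by (simp add: ip_scale_left)
qed

lemma pair_op_inhom_slope: "pair_op inhom_slope"
proof -
  have "pair_op (\<lambda>f g. M (\<lambda>x. 1 / p x) (volterra (M q f + M \<rho> g)))"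
    by (intro pair_op_mult pair_op_volterra pair_op_plus pair_op_fst pair_op_snd inv_p_cont q_cont \<rho>_cont)
  then show ?thesis by (simp add: inhom_slope_def[abs_def] rhs_def)
qed

lemma pair_op_rhs: "pair_op rhs"
  unfolding rhs_def[abs_def] by (intro pair_op_mult pair_op_plus pair_op_fst pair_op_snd q_cont \<rho>_cont)

lemma pair_fun_flux_at_a: "pair_fun I (\<lambda>_. flux_at_a)"
  unfolding flux_at_a_def[abs_def]
  by (intro pair_fun_cmult pair_fun_ip pair_op_minus pair_op_fst pair_op_volterra pair_op_inhom_slope hom_sol_perp_in)

lemma pair_fun_value_at_a: "pair_fun I (\<lambda>_. value_at_a)"
  unfolding value_at_a_def[abs_def]
  by (intro pair_fun_cmult pair_fun_ip pair_op_minus pair_op_fst pair_op_volterra pair_op_inhom_slope pair_op_functional pair_fun_flux_at_a hom_sol_in one_in)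

text \<open>Replacing \<open>c\<close> and \<open>d\<close> by the functionals that recover them
  turns the integral equation of \<open>solves\<close> into the vanishing of one jointly linear
  bounded map; \<open>bc_a\<close> and \<open>bc_b\<close> do the same for the boundary
  conditions.\<close>

definition residual :: "aefun \<Rightarrow> aefun \<Rightarrow> aefun" where
  "residual f g = f - (value_at_a f g *\<^sub>R one + (flux_at_a f g *\<^sub>R hom_sol + volterra (inhom_slope f g)))"

text \<open>The value at \<open>t\<close> of the continuous representative of \<open>f\<close> when
  \<open>(f, g)\<close> is in the graph. The formula is kept for arbitrary pairs, where it is linear
  and bounded even though it need not represent \<open>f\<close>.\<close>

definition cont_rep :: "real \<Rightarrow> aefun \<Rightarrow> aefun \<Rightarrow> real" where
  "cont_rep t f g = value_at_a f g + (prim a (M (\<lambda>x. 1 / p x) one) t * flux_at_a f g + prim a (inhom_slope f g) t)"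

definition bc_a :: "aefun \<Rightarrow> aefun \<Rightarrow> real" where
  "bc_a f g = (\<alpha>\<^sub>a / p a) * flux_at_a f g + \<beta>\<^sub>a * value_at_a f g"

definition bc_b :: "aefun \<Rightarrow> aefun \<Rightarrow> real" where
  "bc_b f g = (\<alpha>\<^sub>b / p b) * (flux_at_a f g + prim a (rhs f g) b) + \<beta>\<^sub>b * cont_rep b f g"

lemma pair_op_residual: "pair_op residual"
  unfolding residual_def[abs_def]
  by (intro pair_op_minus pair_op_plus pair_op_fst pair_op_functional pair_fun_flux_at_a pair_fun_value_at_a pair_op_volterra pair_op_inhom_slope one_in hom_sol_in)

lemma pair_fun_cont_rep: "pair_fun {a..b} cont_rep"
proof -
  obtain K where "\<forall>t. \<forall>f\<in>X. \<bar>prim a f t\<bar> \<le> K * nrm f" using prim_bound by blast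
  then have "pair_fun {a..b} (\<lambda>t f g. value_at_a f g + (prim a (M (\<lambda>x. 1 / p x) one) t * flux_at_a f g + prim a (inhom_slope f g) t))"
    by (intro pair_fun_plus pair_fun_value_at_a pair_fun_prim pair_op_inhom_slope pair_fun_mult[where C="K * nrm (M (\<lambda>x. 1 / p x) one)"] pair_fun_flux_at_a) auto
  then show ?thesis by (simp add: cont_rep_def[abs_def])
qed

lemma pair_fun_bc_a: "pair_fun I (\<lambda>_. bc_a)"
  unfolding bc_a_def[abs_def] by (intro pair_fun_plus pair_fun_cmult pair_fun_flux_at_a pair_fun_value_at_a)

lemma pair_fun_bc_b: "pair_fun {()} (\<lambda>_. bc_b)"
  unfolding bc_b_def[abs_def]
  by (intro pair_fun_plus pair_fun_cmult pair_fun_flux_at_a pair_fun_at[OF pair_fun_prim[OF pair_op_rhs, of UNIV]] pair_fun_at[OF pair_fun_cont_rep])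
    (use ab in auto)

lemma prim_slope:
  assumes "f \<in> X" "g \<in> X"
  shows "prim a (slope c (rhs f g)) t = prim a (M (\<lambda>x. 1 / p x) one) t * c + prim a (inhom_slope f g) t"
proof -
  have "slope c (rhs f g) = c *\<^sub>R M (\<lambda>x. 1 / p x) one + inhom_slope f g"
    by (simp add: slope_def inhom_slope_def distrib_left)
  then show ?thesis
    using assms by (simp add: prim_add[of _ a b] prim_scale[of _ a b])
qed

text \<open>\<open>solves_unique\<close> forces the two constants, so the existence of some
  \<open>c\<close> and \<open>d\<close> amounts to \<open>solves\<close> holding at the recovered
  values.\<close>

lemma graph_iff:
  assumes f: "f \<in> X" and g: "g \<in> X"
  shows "f \<in> DA \<and> A f = g \<longleftrightarrow> residual f g = 0 \<and> bc_a f g = 0 \<and> bc_b f g = 0"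
proof -
  have "f \<in> DA \<and> A f = g \<longleftrightarrow> solves f g (flux_at_a f g) (value_at_a f g)"
    using solves_imp_graph[OF f g] graph_imp_solves[OF f g] solves_unique[OF f g] by metis
  also have "\<dots> \<longleftrightarrow> residual f g = 0 \<and> bc_a f g = 0 \<and> bc_b f g = 0"
    by (simp add: solves_def residual_def bc_a_def bc_b_def volterra_slope[OF f g] prim_slope[OF f g] cont_rep_def)
  finally show ?thesis .
qed

lemma graph_imp_cont_rep:
  assumes f: "f \<in> X" and g: "g \<in> X" and D: "f \<in> DA" "A f = g"
  shows "f = aeclass_on a b (\<lambda>t. cont_rep t f g)" "continuous_on {a..b} (\<lambda>t. cont_rep t f g)"
proof -
  have r: "residual f g = 0" using graph_iff[OF f g] D by blast
  let ?s = "slope (flux_at_a f g) (rhs f g)"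
  have s: "?s \<in> X" using f g by simp
  have "aeclass_on a b (\<lambda>t. value_at_a f g + prim a ?s t) = f"
    using r by (simp add: aeclass_on_const_prim[OF s] volterra_slope[OF f g] residual_def)
  then show "f = aeclass_on a b (\<lambda>t. cont_rep t f g)"
    by (simp add: prim_slope[OF f g] cont_rep_def)
  have "continuous_on {a..b} (\<lambda>t. value_at_a f g + prim a ?s t)"
    by (intro continuous_intros prim_continuous[OF s])
  then show "continuous_on {a..b} (\<lambda>t. cont_rep t f g)"
    by (simp add: prim_slope[OF f g] cont_rep_def)
qed

lemma graph_closed:
  assumes uv: "\<And>n::nat. u n \<in> X" "\<And>n. v n \<in> X" "f \<in> X" "g \<in> X"
    and lim: "ip_lim ip u f sequentially" "ip_lim ip v g sequentially"
    and gr: "\<And>n. u n \<in> DA \<and> A (u n) = v n"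
  shows "f \<in> DA \<and> A f = g"
proof -
  have k: "residual (u n) (v n) = 0" "bc_a (u n) (v n) = 0" "bc_b (u n) (v n) = 0" for n
    using gr[of n] graph_iff[OF uv(1,2), of n n] by auto
  have r: "residual f g \<in> X" by (rule pair_op_in[OF pair_op_residual uv(3,4)])
  \<comment> \<open>The residual is a vector. Fixing its value at the limit as the second argument
    of \<open>ip\<close> gives a scalar functional with closed kernel, whose value at the limit is
    the squared norm of the residual.\<close>
  have "ip (residual f g) (residual f g) = 0"
    by (rule pair_fun_kernel_closed[OF pair_fun_ip[OF pair_op_residual r] uv lim]) (simp add: k r)
  then have "residual f g = 0" using r ip_eq_0_iff by blast
  moreover have "bc_a f g = 0"
    by (rule pair_fun_kernel_closed[OF pair_fun_bc_a uv lim k(2)])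
  moreover have "bc_b f g = 0"
    by (rule pair_fun_kernel_closed[OF pair_fun_bc_b uv lim k(3)])
  ultimately show ?thesis using graph_iff[OF uv(3,4)] by blast
qed

text \<open>Linearity of \<open>A\<close> on finite sums is read off from the kernel description,
  which avoids arguing about linearity of \<open>weak_deriv\<close> and
  \<open>pt_value\<close>.\<close>

lemma graph_sum:
  fixes c :: "'i \<Rightarrow> real"
  assumes F: "finite F" and fg: "\<And>n. n \<in> F \<Longrightarrow> f n \<in> X" "\<And>n. n \<in> F \<Longrightarrow> g n \<in> X"
    and gr: "\<And>n. n \<in> F \<Longrightarrow> f n \<in> DA \<and> A (f n) = g n"
  shows "(\<Sum>n\<in>F. c n *\<^sub>R f n) \<in> DA \<and> A (\<Sum>n\<in>F. c n *\<^sub>R f n) = (\<Sum>n\<in>F. c n *\<^sub>R g n)"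
proof -
  let ?f = "\<Sum>n\<in>F. c n *\<^sub>R f n" and ?g = "\<Sum>n\<in>F. c n *\<^sub>R g n"
  have X: "?f \<in> X" "?g \<in> X" using fg by (auto intro!: S_sum S_scale)
  have k: "residual (f n) (g n) = 0" "bc_a (f n) (g n) = 0" "bc_b (f n) (g n) = 0" if "n \<in> F" for n
    using gr[OF that] graph_iff[OF fg, OF that that] by auto
  have r: "residual ?f ?g \<in> X" by (rule pair_op_in[OF pair_op_residual X])
  have "ip (residual ?f ?g) (residual ?f ?g) = (\<Sum>n\<in>F. c n * ip (residual (f n) (g n)) (residual ?f ?g))"
    by (rule pair_fun_sum[OF pair_fun_ip[OF pair_op_residual r, of "{()}"] _ F fg]) auto
  also have "\<dots> = 0" using k r by simp
  finally have "residual ?f ?g = 0" using r ip_eq_0_iff by blast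
  moreover have "bc_a ?f ?g = 0"
    using pair_fun_sum[OF pair_fun_bc_a[of "{()}"] _ F fg, where i="()" and c=c] k by simp
  moreover have "bc_b ?f ?g = 0"
    using pair_fun_sum[OF pair_fun_bc_b _ F fg, where i="()" and c=c] k by simp
  ultimately show ?thesis using graph_iff[OF X] by blast
qed

end

section \<open>Eigenvalue counting and the diagonal action of \<open>A\<close>\<close>

locale Sturm_Liouville_basis = Sturm_Liouville a b \<rho> p p' q \<alpha>\<^sub>a \<beta>\<^sub>a \<alpha>\<^sub>b \<beta>\<^sub>b + onb "L2 a b" "L2_inner a b \<rho>" e
  for a b \<rho> p p' q \<alpha>\<^sub>a \<beta>\<^sub>a \<alpha>\<^sub>b \<beta>\<^sub>b e +
  fixes lam :: "nat \<Rightarrow> real"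
  assumes e_eigen: "e n \<in> eigenspace DA (\<lambda>f. A f) (lam n)"
begin

lemma e_graph: "e n \<in> DA \<and> A (e n) = lam n *\<^sub>R e n"
  using e_eigen[of n] by (simp add: eigenspace_def)

text \<open>For continuous representatives \<open>u n\<close> of the basis vectors, the sum over
  \<open>F\<close> of the squares of \<open>u n t\<close> is the diagonal of the kernel of the
  projection onto their span. Its weighted integral is the trace, which is the cardinality of
  \<open>F\<close>; a pointwise bound on the diagonal therefore bounds that cardinality.\<close>

lemma finite_bounded_eigenvalues: "finite {n. \<bar>lam n\<bar> \<le> L}"
proof -
  define u where "u n t = cont_rep t (e n) (lam n *\<^sub>R e n)" for n t
  have gr: "e n \<in> DA" "A (e n) = lam n *\<^sub>R e n" for n using e_graph by auto
  have eu: "e n = aeclass_on a b (u n)" and uc: "continuous_on {a..b} (u n)" for n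
    using graph_imp_cont_rep[OF e_in S_scale[OF e_in] gr] unfolding u_def by auto
  obtain K0 where K0: "\<forall>t\<in>{a..b}. \<forall>f\<in>X. \<forall>g\<in>X. \<bar>cont_rep t f g\<bar> \<le> K0 * (nrm f + nrm g)"
    using pair_fun_bound[OF pair_fun_cont_rep] by blast
  define K where "K = max K0 0"
  have K: "K \<ge> 0" "\<bar>cont_rep t f g\<bar> \<le> K * (nrm f + nrm g)" if "t \<in> {a..b}" "f \<in> X" "g \<in> X" for t f g
  proof -
    have "\<bar>cont_rep t f g\<bar> \<le> K0 * (nrm f + nrm g)" using K0 that by blast
    also have "\<dots> \<le> K * (nrm f + nrm g)" using that by (intro mult_right_mono) (auto simp: K_def)
    finally show "\<bar>cont_rep t f g\<bar> \<le> K * (nrm f + nrm g)" .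
  qed (simp add: K_def)
  \<comment> \<open>Evaluation at \<open>t\<close> will give
    \<open>s \<le> K * (1 + \<bar>L\<bar>) * sqrt s\<close>; cancelling \<open>sqrt s\<close> leaves
    the square of this constant as the bound on \<open>s\<close>.\<close>
  define B where "B = (K * (1 + \<bar>L\<bar>))\<^sup>2"
  have pw: "(\<Sum>n\<in>F. (u n t)\<^sup>2) \<le> B" if F: "finite F" "F \<subseteq> {n. \<bar>lam n\<bar> \<le> L}" and t: "t \<in> {a..b}" for F t
  proof -
    let ?f = "\<Sum>n\<in>F. u n t *\<^sub>R e n" and ?g = "\<Sum>n\<in>F. u n t *\<^sub>R (lam n *\<^sub>R e n)"
    define s where "s = (\<Sum>n\<in>F. (u n t)\<^sup>2)"
    have s0: "s \<ge> 0" by (simp add: s_def sum_nonneg)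
    have X: "?f \<in> X" "?g \<in> X" by (intro S_sum S_scale e_in)+
    have nf: "nrm ?f = sqrt s" by (simp add: ip_norm_def ip_sum_e[OF F(1)] s_def)
    have "ip ?g ?g = (\<Sum>n\<in>F. (u n t * lam n)\<^sup>2)"
      using ip_sum_e[OF F(1), of "\<lambda>n. u n t * lam n"] by simp
    also have "\<dots> \<le> (\<Sum>n\<in>F. L\<^sup>2 * (u n t)\<^sup>2)"
    proof (rule sum_mono)
      fix n assume "n \<in> F"
      then have "\<bar>lam n\<bar> \<le> L" using F by auto
      from power_mono[OF this, of 2] have "(lam n)\<^sup>2 \<le> L\<^sup>2" by simp
      then show "(u n t * lam n)\<^sup>2 \<le> L\<^sup>2 * (u n t)\<^sup>2" by (simp add: power_mult_distrib mult.commute[of "(u n t)\<^sup>2"] mult_right_mono)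
    qed
    also have "\<dots> = L\<^sup>2 * s" by (simp add: s_def sum_distrib_left)
    finally have "nrm ?g \<le> sqrt (L\<^sup>2 * s)" unfolding ip_norm_def by (rule real_sqrt_le_mono)
    then have ng: "nrm ?g \<le> \<bar>L\<bar> * sqrt s" by (simp add: real_sqrt_mult)
    have "cont_rep t ?f ?g = (\<Sum>n\<in>F. u n t * cont_rep t (e n) (lam n *\<^sub>R e n))"
      by (rule pair_fun_sum[OF pair_fun_cont_rep t F(1)]) auto
    also have "\<dots> = s" by (simp add: s_def u_def power2_eq_square)
    finally have "s \<le> K * (nrm ?f + nrm ?g)" using K(2)[OF t X] by simp
    also have "\<dots> \<le> K * (sqrt s + \<bar>L\<bar> * sqrt s)"
      using nf ng K(1)[OF t X] by (intro mult_left_mono) auto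
    finally have "sqrt s * sqrt s \<le> K * (1 + \<bar>L\<bar>) * sqrt s"
      using s0 by (simp add: algebra_simps)
    then have "sqrt s \<le> K * (1 + \<bar>L\<bar>)"
    proof (cases "s = 0")
      case True
      then show ?thesis using K(1)[OF t X] by simp
    next
      case False
      then have "sqrt s > 0" using s0 by simp
      with \<open>sqrt s * sqrt s \<le> K * (1 + \<bar>L\<bar>) * sqrt s\<close> show ?thesis by (rule mult_right_le_imp_le)
    qed
    then have "(sqrt s)\<^sup>2 \<le> B" unfolding B_def by (rule power_mono) (simp add: s0)
    then show ?thesis using s0 by (simp add: s_def)
  qed
  have card: "real (card F) \<le> B * ip one one" if F: "F \<subseteq> {n. \<bar>lam n\<bar> \<le> L}" "finite F" for F
  proof -
    have sq: "sq_on a b (\<lambda>x. indicator {a..b} x * u n x)" for n by (rule sq_on_continuous[OF uc])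
    have s1: "sq_on a b (\<lambda>x. indicator {a..b} x * 1)" by (rule sq_on_continuous) auto
    let ?v = "\<lambda>n x. (indicator {a..b} x * u n x) * (indicator {a..b} x * u n x) * w x"
    have i: "integrable lborel (?v n)" for n by (rule ip_integrable[OF sq sq])
    have "real (card F) = (\<Sum>n\<in>F. ip (e n) (e n))" by simp
    also have "\<dots> = (\<Sum>n\<in>F. \<integral>x. ?v n x \<partial>lborel)"
    proof (rule sum.cong)
      fix n
      show "ip (e n) (e n) = (\<integral>x. ?v n x \<partial>lborel)"
        unfolding eu[of n] aeclass_on_def by (rule ip_aeclass) (auto intro: sq_on_measurable[OF sq])
    qed simp
    also have "\<dots> = (\<integral>x. (\<Sum>n\<in>F. ?v n x) \<partial>lborel)"
      using i by (simp add: Bochner_Integration.integral_sum)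
    also have "\<dots> \<le> (\<integral>x. B * ((indicator {a..b} x * 1) * (indicator {a..b} x * 1) * w x) \<partial>lborel)"
    proof (rule integral_mono)
      show "integrable lborel (\<lambda>x. \<Sum>n\<in>F. ?v n x)" using i by (intro Bochner_Integration.integrable_sum)
      show "integrable lborel (\<lambda>x. B * ((indicator {a..b} x * 1) * (indicator {a..b} x * 1) * w x))"
        by (intro integrable_mult_right ip_integrable[OF s1 s1])
      fix x
      show "(\<Sum>n\<in>F. ?v n x) \<le> B * ((indicator {a..b} x * 1) * (indicator {a..b} x * 1) * w x)"
      proof (cases "x \<in> {a..b}")
        case True
        have "(\<Sum>n\<in>F. ?v n x) = (\<Sum>n\<in>F. (u n x)\<^sup>2) * w x"
          using True by (simp add: sum_distrib_right power2_eq_square)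
        also have "\<dots> \<le> B * w x" using pw[OF F(2,1) True] by (intro mult_right_mono w_nonneg)
        finally show ?thesis using True by simp
      qed simp
    qed
    also have "\<dots> = B * ip one one"
      unfolding one_def aeclass_on_def by (subst ip_aeclass) auto
    finally show ?thesis .
  qed
  show ?thesis
  proof (rule ccontr)
    assume "infinite {n. \<bar>lam n\<bar> \<le> L}"
    then obtain F where F: "F \<subseteq> {n. \<bar>lam n\<bar> \<le> L}" "finite F" "card F = Suc (nat \<lceil>B * ip one one\<rceil>)"
      using infinite_arbitrarily_large by blast
    show False using card[OF F(1,2)] F(3) by linarith
  qed
qed

text \<open>On Fourier partial sums \<open>A\<close> acts termwise, and the partial sums of
  \<open>f\<close> and of its diagonal image both converge; closedness of the graph passes this to
  the limit. Here the differential operator meets the diagonal one.\<close>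

lemma diag_dom_subset:
  assumes f: "f \<in> diag_dom X ip e lam"
  shows "f \<in> DA" "A f = diag_op X ip e lam f"
proof -
  let ?g = "diag_op X ip e lam f"
  have fX: "f \<in> X" using f by (simp add: diag_dom_def)
  have g: "?g \<in> X" "\<And>n. ip ?g (e n) = lam n * ip f (e n)" by (rule diag_op_props[OF f])+
  have "f \<in> DA \<and> A f = ?g"
  proof (rule graph_closed[OF _ _ fX g(1) partial_sums_lim[OF fX] partial_sums_lim[OF g(1)]])
    fix N :: nat
    have "(\<Sum>n<N. ip f (e n) *\<^sub>R e n) \<in> DA \<and>
      A (\<Sum>n<N. ip f (e n) *\<^sub>R e n) = (\<Sum>n<N. ip f (e n) *\<^sub>R (lam n *\<^sub>R e n))"
      by (rule graph_sum) (use e_graph in auto)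
    then show "(\<Sum>n<N. ip f (e n) *\<^sub>R e n) \<in> DA \<and>
      A (\<Sum>n<N. ip f (e n) *\<^sub>R e n) = (\<Sum>n<N. ip ?g (e n) *\<^sub>R e n)"
      by (simp add: g(2) mult.commute)
  qed (intro S_sum S_scale e_in)+
  then show "f \<in> DA" "A f = ?g" by auto
qed

end

text \<open>Only finitely many values lie in any ball, so there are no limit points and the range is
  closed. A connected subset with two points would contain a whole interval, which is infinite and
  sits in a ball.\<close>

lemma totally_disconnected_closure_if_locally_finite:
  fixes l :: "nat \<Rightarrow> real"
  assumes fin: "\<And>L. finite {n. \<bar>l n\<bar> \<le> L}"
  shows "totally_disconnected (closure (range l))"
proof -
  have fin': "finite (range l \<inter> cball x r)" for x r
  proof (rule finite_subset)
    show "range l \<inter> cball x r \<subseteq> l ` {n. \<bar>l n\<bar> \<le> \<bar>x\<bar> + r}"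
      by (auto simp: dist_real_def)
    show "finite (l ` {n. \<bar>l n\<bar> \<le> \<bar>x\<bar> + r})" by (intro finite_imageI fin)
  qed
  then have "\<not> x islimpt range l" for x
    unfolding islimpt_eq_infinite_cball using zero_less_one by blast
  then have cl: "closure (range l) = range l" by (simp add: closure_def)
  have "x = y" if C: "C \<subseteq> range l" "connected C" and xy: "x \<in> C" "y \<in> C" "x \<le> y" for C x y
  proof (rule ccontr)
    assume "x \<noteq> y"
    then have "x < y" using xy by simp
    have "{x..y} \<subseteq> C" by (rule connected_contains_Icc[OF C(2) xy(1,2)])
    then have "{x..y} \<subseteq> range l \<inter> cball x (y - x)"
      using C(1) by (auto simp: dist_real_def)
    then have "finite {x..y}" using fin' finite_subset by blast
    then show False using infinite_Icc[OF \<open>x < y\<close>] by blast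
  qed
  then have "x = y" if "C \<subseteq> range l" "connected C" "x \<in> C" "y \<in> C" for C x y
    using that by (cases "x \<le> y") (metis, metis linear)
  then show ?thesis unfolding totally_disconnected_def cl by blast
qed

section \<open>Generation of the semigroup on the power spaces\<close>

theorem mainTheorem4:
  fixes a b \<alpha>\<^sub>a \<beta>\<^sub>a \<alpha>\<^sub>b \<beta>\<^sub>b \<gamma> \<epsilon> \<mu> \<alpha> :: real
    and p p' q \<rho> :: "real \<Rightarrow> real"
    and lam :: "nat \<Rightarrow> real"
    and \<phi> \<phi>\<^sub>\<alpha> :: "nat \<Rightarrow> aefun"
    and X DA X\<^sub>\<alpha> DA\<^sub>\<alpha> :: "aefun set"
    and ip ip\<^sub>\<alpha> :: "aefun \<Rightarrow> aefun \<Rightarrow> real"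
    and A :: "aefun \<Rightarrow> aefun"
    and w :: "nat \<Rightarrow> real"
  defines "X \<equiv> L2 a b" and "ip \<equiv> L2_inner a b \<rho>"
    and "A \<equiv> (\<lambda>f. - SL_op a b p q \<rho> f)"
    and "DA \<equiv> SL_dom a b \<alpha>\<^sub>a \<beta>\<^sub>a \<alpha>\<^sub>b \<beta>\<^sub>b"
    and "\<mu> \<equiv> \<gamma> + \<epsilon>"
    and "w \<equiv> (\<lambda>n. (\<mu> - lam n) powr \<alpha>)"
    and "X\<^sub>\<alpha> \<equiv> diag_dom X ip \<phi> w"
    and "ip\<^sub>\<alpha> \<equiv> power_inner X ip \<phi> w"
    and "\<phi>\<^sub>\<alpha> \<equiv> (\<lambda>n. ((\<mu> - lam n) powr (- \<alpha>)) *\<^sub>R \<phi> n)"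
    and "DA\<^sub>\<alpha> \<equiv> diag_dom X\<^sub>\<alpha> ip\<^sub>\<alpha> \<phi>\<^sub>\<alpha> lam"
  assumes "a < b"
    and "\<And>z. z \<in> {a..b} \<Longrightarrow> (p has_real_derivative p' z) (at z within {a..b})"
    and "continuous_on {a..b} p'"
    and "continuous_on {a..b} q" and "continuous_on {a..b} \<rho>"
    and "\<And>z. z \<in> {a..b} \<Longrightarrow> p z > 0" and "\<And>z. z \<in> {a..b} \<Longrightarrow> \<rho> z > 0"
    and "(\<alpha>\<^sub>a, \<beta>\<^sub>a) \<noteq> (0, 0)" and "(\<alpha>\<^sub>b, \<beta>\<^sub>b) \<noteq> (0, 0)"
    and "inj lam" and "range lam = eigenvalues DA A"
    and "\<And>n. \<phi> n \<in> eigenspace DA A (lam n)" and "orthonormal_basis X ip \<phi>"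
    and "\<epsilon> > 0" and "\<And>n. lam n < \<gamma>"
    and "\<alpha> > 0"
  shows "DA\<^sub>\<alpha> \<subseteq> DA \<and> riesz_spectral X\<^sub>\<alpha> ip\<^sub>\<alpha> DA\<^sub>\<alpha> A \<and>
    (\<exists>T. C0_semigroup X\<^sub>\<alpha> ip\<^sub>\<alpha> T \<and> infinitesimal_generator X\<^sub>\<alpha> ip\<^sub>\<alpha> T DA\<^sub>\<alpha> A)"
proof -
  interpret wL: weighted_L2 a b \<rho> by standard (use assms in auto)
  interpret SL: Sturm_Liouville_basis a b \<rho> p p' q \<alpha>\<^sub>a \<beta>\<^sub>a \<alpha>\<^sub>b \<beta>\<^sub>b \<phi> lam
    by standard (use assms in auto)
  \<comment> \<open>\<open>\<mu>\<close> exceeds every eigenvalue by more than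
    \<open>\<epsilon>\<close>, so \<open>\<epsilon> powr \<alpha>\<close> is a common positive lower
    bound for the weights.\<close>
  interpret P: power_space "L2 a b" "L2_inner a b \<rho>" \<phi> w "\<epsilon> powr \<alpha>"
  proof
    show "0 < \<epsilon> powr \<alpha>" using \<open>\<epsilon> > 0\<close> by simp
    show "\<epsilon> powr \<alpha> \<le> w n" for n
      using \<open>lam n < \<gamma>\<close> \<open>\<epsilon> > 0\<close> \<open>\<alpha> > 0\<close> unfolding w_def \<mu>_def by (intro powr_mono2) auto
  qed
  have \<phi>\<^sub>\<alpha>: "\<phi>\<^sub>\<alpha> = (\<lambda>n. (1 / w n) *\<^sub>R \<phi> n)"
    by (simp add: \<phi>\<^sub>\<alpha>_def w_def powr_minus_divide)
  have X\<^sub>\<alpha>: "X\<^sub>\<alpha> = diag_dom (L2 a b) (L2_inner a b \<rho>) \<phi> w" and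
    ip\<^sub>\<alpha>: "ip\<^sub>\<alpha> = power_inner (L2 a b) (L2_inner a b \<rho>) \<phi> w"
    by (simp_all add: X\<^sub>\<alpha>_def ip\<^sub>\<alpha>_def X_def ip_def)
  have coeff: "ip\<^sub>\<alpha> f (\<phi>\<^sub>\<alpha> n) = w n * ip f (\<phi> n)" if "f \<in> X\<^sub>\<alpha>" for f n
    using P.ipw_coeff[of f n] that by (simp only: \<phi>\<^sub>\<alpha> ip\<^sub>\<alpha> X\<^sub>\<alpha> ip_def)
  have key: "f \<in> DA" "A f \<in> X\<^sub>\<alpha>" "ip\<^sub>\<alpha> (A f) (\<phi>\<^sub>\<alpha> n) = lam n * ip\<^sub>\<alpha> f (\<phi>\<^sub>\<alpha> n)" if f: "f \<in> DA\<^sub>\<alpha>" for f n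
  proof -
    have fX: "f \<in> X\<^sub>\<alpha>" using f by (simp add: DA\<^sub>\<alpha>_def diag_dom_def)
    then have fX': "f \<in> X" by (simp add: X\<^sub>\<alpha>_def diag_dom_def)
    have sm: "summable (\<lambda>n. (lam n)\<^sup>2 * (w n * ip f (\<phi> n))\<^sup>2)"
      using f fX by (simp add: DA\<^sub>\<alpha>_def diag_dom_def coeff)
    \<comment> \<open>Since the weights are at least \<open>\<epsilon> powr \<alpha>\<close>, the
      domain condition in \<open>X\<^sub>\<alpha>\<close> dominates the one in \<open>X\<close>,
      where \<open>A\<close> is known to act diagonally.\<close>
    have "summable (\<lambda>n. (lam n)\<^sup>2 * (ip f (\<phi> n))\<^sup>2)"
    proof (rule summable_comparison_test'[where N=0])
      let ?\<delta> = "\<epsilon> powr \<alpha>"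
      show "summable (\<lambda>n. (1 / ?\<delta>\<^sup>2) * ((lam n)\<^sup>2 * (w n * ip f (\<phi> n))\<^sup>2))" by (intro summable_mult sm)
      fix n
      have "?\<delta>\<^sup>2 \<le> (w n)\<^sup>2" using P.w_ge[of n] P.delta by (intro power_mono) auto
      then have "?\<delta>\<^sup>2 * ((lam n)\<^sup>2 * (ip f (\<phi> n))\<^sup>2) \<le> (w n)\<^sup>2 * ((lam n)\<^sup>2 * (ip f (\<phi> n))\<^sup>2)"
        by (rule mult_right_mono) simp
      then show "norm ((lam n)\<^sup>2 * (ip f (\<phi> n))\<^sup>2) \<le> (1 / ?\<delta>\<^sup>2) * ((lam n)\<^sup>2 * (w n * ip f (\<phi> n))\<^sup>2)"
        using P.delta by (simp add: power_mult_distrib field_simps)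
    qed
    then have fd: "f \<in> diag_dom (L2 a b) (L2_inner a b \<rho>) \<phi> lam"
      using fX' by (simp add: diag_dom_def X_def ip_def)
    show "f \<in> DA" using SL.diag_dom_subset(1)[OF fd] by (simp add: DA_def)
    have Af: "A f = diag_op (L2 a b) (L2_inner a b \<rho>) \<phi> lam f"
      using SL.diag_dom_subset(2)[OF fd] by (simp add: A_def)
    have AX: "A f \<in> X" and Ac: "ip (A f) (\<phi> n) = lam n * ip f (\<phi> n)" for n
      using SL.diag_op_props[OF fd] by (simp_all add: Af X_def ip_def)
    \<comment> \<open>The summability that defines \<open>DA\<^sub>\<alpha>\<close> is, after
      regrouping factors, the condition for \<open>A f\<close> to lie in
      \<open>X\<^sub>\<alpha>\<close>; this is why the smaller domain keeps \<open>A\<close> inside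
      the space.\<close>
    have "summable (\<lambda>n. (w n)\<^sup>2 * (ip (A f) (\<phi> n))\<^sup>2)"
      using sm by (simp add: Ac power_mult_distrib mult_ac)
    then show AXa: "A f \<in> X\<^sub>\<alpha>" using AX by (simp add: X\<^sub>\<alpha>_def diag_dom_def)
    show "ip\<^sub>\<alpha> (A f) (\<phi>\<^sub>\<alpha> n) = lam n * ip\<^sub>\<alpha> f (\<phi>\<^sub>\<alpha> n)"
      using coeff[OF fX] coeff[OF AXa] Ac by simp
  qed
  \<comment> \<open>The abstract theory is used with carrier \<open>X\<^sub>\<alpha>\<close>, and
    \<open>\<gamma>\<close> serves as the growth exponent of the semigroup.\<close>
  interpret D: diagonal_operator X\<^sub>\<alpha> ip\<^sub>\<alpha> \<phi>\<^sub>\<alpha> lam A \<gamma>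
  proof
    show "hilbert_space X\<^sub>\<alpha> ip\<^sub>\<alpha>" unfolding X\<^sub>\<alpha> ip\<^sub>\<alpha> by (rule P.hilbert_Sw)
    show "orthonormal_basis X\<^sub>\<alpha> ip\<^sub>\<alpha> \<phi>\<^sub>\<alpha>" unfolding X\<^sub>\<alpha> ip\<^sub>\<alpha> \<phi>\<^sub>\<alpha> by (rule P.basis_Sw)
  qed (use key[unfolded DA\<^sub>\<alpha>_def] \<open>inj lam\<close> \<open>\<And>n. lam n < \<gamma>\<close> in \<open>auto intro: less_imp_le\<close>)
  have "riesz_spectral X\<^sub>\<alpha> ip\<^sub>\<alpha> DA\<^sub>\<alpha> A"
    unfolding DA\<^sub>\<alpha>_def
    by (intro D.riesz_spectral_A totally_disconnected_closure_if_locally_finite SL.finite_bounded_eigenvalues)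
  then show ?thesis
    using key(1) D.C0_semigroup_T D.infinitesimal_generator_A unfolding DA\<^sub>\<alpha>_def by blast
qed

end
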